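(* Let $V$ be a real vector space of dimension $\mathfrak n\ge 1$, $B$ a positive definite symmetric bilinear form on $V$, $L\subset V$ an integral lattice, $G\le \mathrm{SL}_2(\mathbb Z)$ a subgroup of finite index, and $\rho:\widetilde G\ltimes H(L,1)\to \mathrm{GL}(\mathcal W)$ a representation whose kernel has finite index, with $\rho(([0,0],-1))=-\mathrm{id}_{\mathcal W}$, and such that moreover $\rho(([v,0],1))=\rho(([0,v],1))=\mathrm{id}_{\mathcal W}$ for all $v\in L$. Let $k\in\frac12\mathbb Z$ with $k\notin\{0,-1,-2,\dots\}$. Let $\mathfrak B=(e_1,\dots,e_{\mathfrak n})$ be an $\mathbb R$-basis of $V$, let $d=|L^\sharp/L|$, let $\mathcal P_0=\{\mathbf p_1,\dots,\mathbf p_d\}\subset\mathbb Z_{\ge0}^{\mathfrak n}$ have $d$ elements, and write $L^\sharp/L=\{t_1+L,\dots,t_d+L\}$. If the function $$\mathcal F^{\mathfrak B}_{\underline L,\mathcal P_0}(\tau)=\det\Big(\frac{1}{(2\pi i)^{s(\mathbf p_i)}}\,\partial^{\mathbf p_i}\vartheta_{\underline L,t_j}\big|_{z=0}(\tau)\Big)_{1\le i,j\le d}$$ is not identically zero on $\mathbb H$, then the map $\phi\mapsto (D_{k,\mathbf p}\phi)_{\mathbf p\in\widehat{\mathcal P_0}}$ is a $\mathbb C$-linear embedding $$J^!_{k,L}(G,\rho)\hookrightarrow\prod_{\mathbf p\in\widehat{\mathcal P_0}}M^!_{k+s(\mathbf p)}(G,\rho|_{\widetilde G}).$$ Moreover it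 gives embeddings $J^{\mathrm{weak}}_{k,L}(G,\rho)\hookrightarrow\prod_{\mathbf p\in\widehat{\mathcal P_0}}M_{k+s(\mathbf p)}(G,\rho|_{\widetilde G})$, and, provided $\mathbf 0\in\widehat{\mathcal P_0}$, $J_{k,L}(G,\rho)\hookrightarrow M_k(G,\rho|_{\widetilde G})\times\prod_{\mathbf 0\ne\mathbf p\in\widehat{\mathcal P_0}}S_{k+s(\mathbf p)}(G,\rho|_{\widetilde G})$.
   Context: Notation: $e(x)=\exp(2\pi i x)$, $\mathbb H$ is the upper half plane, $q^n=e(n\tau)$. $\mathcal V=V\oplus iV$ is the complexification of $V$; $B$ is extended $\mathbb C$-bilinearly to $\mathcal V$, and $Q(v)=\frac12B(v,v)$. A lattice $L$ is the $\mathbb Z$-span of an $\mathbb R$-basis of $V$; it is integral if $B(L,L)\subseteq\mathbb Z$; $L^\sharp=\{v\in V:B(v,L)\subseteq\mathbb Z\}$. $\mathcal W$ is a finite-dimensional complex vector space. Metaplectic group: $\widetilde{\mathrm{SL}_2(\mathbb Z)}$ is the set of pairs $(\gamma,\varepsilon\sqrt{c\tau+d})$ with $\gamma=\begin{pmatrix}a&b\\c&d\end{pmatrix}\in\mathrm{SL}_2(\mathbb Z)$, $\varepsilon=\pm1$, $\sqrt{\cdot}$ the principal branch, with product $(\gamma_1,\phi_1(\tau))(\gamma_2,\phi_2(\tau))=(\gamma_1\gamma_2,\phi_1(\gamma_2\tau)\phi_2(\tau))$; $\widetilde G$ is the preimage of $G$. Heisenberg group: elements $([v,w],\xi)$ with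 $v,w\in V$, $|\xi|=1$, product $([v_1,w_1],\xi_1)([v_2,w_2],\xi_2)=([v_1+v_2,w_1+w_2],\xi_1\xi_2e^{\pi i(B(v_1,w_2)-B(v_2,w_1))})$; $H(L,1)$ is the subgroup with $v,w\in L$, $\xi=\pm1$. The metaplectic group acts on the right by $[v,w]\gamma=[av+cw,bv+dw]$, and $\widetilde G\ltimes H(L,1)$ is the corresponding semidirect product, whose elements $g=(\gamma,\varepsilon\sqrt{c\tau+d},[v,w],\xi)$ are the products $\gamma h$. For $k\in\frac12\mathbb Z$ and $f:\mathbb H\times\mathcal V\to\mathcal W$, the slash operator is $(f|_{k,B}g)(\tau,z)=(\varepsilon\sqrt{c\tau+d})^{-2k}\,\xi\,e\!\big(-\tfrac{cQ(z+\tau v+w)}{c\tau+d}+\tau Q(v)+B(v,z)+\tfrac12B(v,w)\big)f\big(\tfrac{a\tau+b}{c\tau+d},\tfrac{z+\tau v+w}{c\tau+d}\big)$. Jacobi forms: a holomorphic $\phi:\mathbb H\times\mathcal V\to\mathcal W$ with $\phi|_{k,B}g=\rho(g)\circ\phi$ for all $g\in\widetilde G\ltimes H(L,1)$ has, for every $g\in\widetilde{\mathrm{SL}_2(\mathbb Z)}\ltimes H(L,1)$, a normally convergent expansion $\phi|_{k,B}g=\sum_{n,t}c^g(n,t)q^ne(B(t,z))$ with $n\in\frac1M\mathbb Z$, $t\in\frac1M L^\sharp$ for some positive integer $M$. $J^!_{k,L}(G,\rho)$ (weakly holomorphic) consists of those $\phi$ such that for each $g$ there is $N_0$ with $c^g(n,t)=0$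 for $n<N_0$; $J^{\mathrm{weak}}_{k,L}(G,\rho)$ those with $N_0=0$ for all $g$; $J_{k,L}(G,\rho)$ those with $c^g(n,t)=0$ unless $n\ge Q(t)$, for all $g$. Modular forms: for a representation $\sigma$ of $\widetilde G$ on $\mathcal W$ (here $\rho|_{\widetilde G}(\gamma)=\rho(\gamma,[0,0],1)$), with $(h|_k(\gamma,\varepsilon\sqrt{c\tau+d}))(\tau)=(\varepsilon\sqrt{c\tau+d})^{-2k}h(\gamma\tau)$, $M^!_k(G,\sigma)$ is the space of holomorphic $h:\mathbb H\to\mathcal W$ with $h|_k\gamma=\sigma(\gamma)h$ for $\gamma\in\widetilde G$ such that for every $\gamma\in\widetilde{\mathrm{SL}_2(\mathbb Z)}$ the $q$-expansion (in fractional powers) of $h|_k\gamma$ has finitely many negative powers; $M_k$: no negative powers; $S_k$: only positive powers. Operators: for $\mathbf p\in\mathbb Z^{\mathfrak n}$, $s(\mathbf p)=\sum p_i$. For $\Lambda=(\lambda_{ij})\in M_{\mathfrak n}(\mathbb Z_{\ge0})$: $s(\Lambda)=\sum\lambda_{ij}$, $\Lambda!=\prod\lambda_{ij}!$, $\pi(\Lambda)\in\mathbb Z^{\mathfrak n}$ with $i$-th component $\sum_j\lambda_{ij}+\sum_j\lambda_{ji}$, and for a matrix $M=(m_{ij})$, $M^\Lambda=\prod m_{ij}^{\lambda_{ij}}$ ($0^0=1$). $G_{\mathfrak B}=(B(e_i,e_j))$. Write the Taylor expansion $\phi(\tau,z_1e_1+\dots+z_{\mathfrak n}e_{\mathfrak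 n})=\sum_{\mathbf j\in\mathbb Z_{\ge0}^{\mathfrak n}}h_{\mathbf j}(\tau)z_1^{j_1}\cdots z_{\mathfrak n}^{j_{\mathfrak n}}$, with $h_{\mathbf j}=0$ if $\mathbf j\notin\mathbb Z_{\ge0}^{\mathfrak n}$. For $\mathbf p\in\mathbb Z_{\ge0}^{\mathfrak n}$, with $\lambda=[s(\mathbf p)/2]$, $\lambda'=[(s(\mathbf p)-1)/2]$, $D_{k,\mathbf p}\phi=4^\lambda\lambda!\sum_{\Lambda:\,s(\Lambda)\le\lambda}\frac{(-\pi iG_{\mathfrak B})^\Lambda}{\Lambda!}\Big(\prod_{m=\lambda'}^{s(\mathbf p)-2-s(\Lambda)}(k+m)\Big)\frac{d^{s(\Lambda)}}{d\tau^{s(\Lambda)}}h_{\mathbf p-\pi(\Lambda)}$ (empty product $=1$). Partial order: $\mathbf p_1\preceq\mathbf p_2$ iff $\mathbf p_2-\mathbf p_1\in\mathbb Z_{\ge0}^{\mathfrak n}$ and $s(\mathbf p_1)\equiv s(\mathbf p_2)\pmod 2$; $\widehat{\mathcal P}=\{\mathbf p\in\mathbb Z^{\mathfrak n}_{\ge0}:\mathbf p\preceq\mathbf p'\text{ for some }\mathbf p'\in\mathcal P\}$. Theta series: for $t\in L^\sharp$, $\vartheta_{\underline L,t}(\tau,z)=\sum_{v\in t+L}e(\tau Q(v)+B(v,z))$; $\partial^{\mathbf p}=\partial^{s(\mathbf p)}/\partial z_1^{p_1}\cdots\partial z_{\mathfrak n}^{p_{\mathfrak n}}$ in the coordinates $z=\sum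 z_ie_i$. *)

theory Defs
  imports "HOL-Analysis.Analysis"
begin

definition ee :: "complex \<Rightarrow> complex" where
  "ee x = exp (2 * of_real pi * \<i> * x)"

definition Hset :: "complex set" where
  "Hset = {\<tau>. Im \<tau> > 0}"

definition cvec :: "real^'n \<Rightarrow> complex^'n" where
  "cvec v = (\<chi> i. complex_of_real (v $ i))"

text \<open>C-bilinear extension of a real bilinear form on real^n to complex^n
  (expanded in the standard basis).\<close>
definition Bc :: "(real^'n \<Rightarrow> real^'n \<Rightarrow> real) \<Rightarrow> complex^'n \<Rightarrow> complex^'n \<Rightarrow> complex" where
  "Bc B z1 z2 = (\<Sum>i\<in>UNIV. \<Sum>j\<in>UNIV. z1 $ i * z2 $ j * of_real (B (axis i 1) (axis j 1)))"

definition Qc :: "(real^'n \<Rightarrow> real^'n \<Rightarrow> real) \<Rightarrow> complex^'n \<Rightarrow> complex" where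
  "Qc B z = Bc B z z / 2"

definition Qr :: "(real^'n \<Rightarrow> real^'n \<Rightarrow> real) \<Rightarrow> real^'n \<Rightarrow> real" where
  "Qr B v = B v v / 2"

definition pos_def_sym_bilinear :: "(real^'n \<Rightarrow> real^'n \<Rightarrow> real) \<Rightarrow> bool" where
  "pos_def_sym_bilinear B \<longleftrightarrow> bilinear B \<and> (\<forall>v w. B v w = B w v) \<and> (\<forall>v. v \<noteq> 0 \<longrightarrow> B v v > 0)"

definition is_real_basis :: "('n \<Rightarrow> real^'n) \<Rightarrow> bool" where
  "is_real_basis b \<longleftrightarrow> inj b \<and> independent (range b) \<and> span (range b) = UNIV"

definition is_lattice :: "(real^'n) set \<Rightarrow> bool" where
  "is_lattice L \<longleftrightarrow> (\<exists>b. is_real_basis b \<and> L = {\<Sum>i\<in>UNIV. of_int (c i) *\<^sub>R b i | c. True})"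

definition integral_lattice :: "(real^'n \<Rightarrow> real^'n \<Rightarrow> real) \<Rightarrow> (real^'n) set \<Rightarrow> bool" where
  "integral_lattice B L \<longleftrightarrow> is_lattice L \<and> (\<forall>v\<in>L. \<forall>w\<in>L. B v w \<in> \<int>)"

definition dual_lattice :: "(real^'n \<Rightarrow> real^'n \<Rightarrow> real) \<Rightarrow> (real^'n) set \<Rightarrow> (real^'n) set" where
  "dual_lattice B L = {v. \<forall>l\<in>L. B v l \<in> \<int>}"

definition lat_cosets :: "(real^'n \<Rightarrow> real^'n \<Rightarrow> real) \<Rightarrow> (real^'n) set \<Rightarrow> (real^'n) set set" where
  "lat_cosets B L = {(\<lambda>l. t + l) ` L | t. t \<in> dual_lattice B L}"

type_synonym sl2 = "int \<times> int \<times> int \<times> int"   (* (a,b,c,d) *)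
type_synonym mp = "sl2 \<times> int"                     (* (gamma, epsilon) *)
type_synonym 'n jg = "mp \<times> ((real^'n) \<times> (real^'n) \<times> complex)"  (* (gamma~, [v,w], xi) *)

definition SL2Z :: "sl2 set" where
  "SL2Z = {(a,b,c,d). a * d - b * c = 1}"

definition sl2_one :: sl2 where "sl2_one = (1,0,0,1)"

fun sl2_mult :: "sl2 \<Rightarrow> sl2 \<Rightarrow> sl2" where
  "sl2_mult (a1,b1,c1,d1) (a2,b2,c2,d2) =
     (a1*a2 + b1*c2, a1*b2 + b1*d2, c1*a2 + d1*c2, c1*b2 + d1*d2)"

fun sl2_inv :: "sl2 \<Rightarrow> sl2" where
  "sl2_inv (a,b,c,d) = (d, -b, -c, a)"

definition finite_index_subgroup :: "sl2 set \<Rightarrow> bool" where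
  "finite_index_subgroup G \<longleftrightarrow> G \<subseteq> SL2Z \<and> sl2_one \<in> G \<and>
     (\<forall>g\<in>G. \<forall>h\<in>G. sl2_mult g h \<in> G) \<and> (\<forall>g\<in>G. sl2_inv g \<in> G) \<and>
     finite {(\<lambda>h. sl2_mult g h) ` G | g. g \<in> SL2Z}"

fun mobius :: "sl2 \<Rightarrow> complex \<Rightarrow> complex" where
  "mobius (a,b,c,d) \<tau> = (of_int a * \<tau> + of_int b) / (of_int c * \<tau> + of_int d)"

fun jfac :: "mp \<Rightarrow> complex \<Rightarrow> complex" where
  "jfac ((a,b,c,d), \<epsilon>) \<tau> = of_int \<epsilon> * csqrt (of_int c * \<tau> + of_int d)"

text \<open>Metaplectic product (g1,phi1)(g2,phi2) = (g1 g2, phi1(g2 tau) phi2(tau)).\<close>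
fun mp_mult :: "mp \<Rightarrow> mp \<Rightarrow> mp" where
  "mp_mult (g1, e1) (g2, e2) =
     (sl2_mult g1 g2,
      THE e. e \<in> {1, -1} \<and> (\<forall>\<tau>\<in>Hset. jfac (g1, e1) (mobius g2 \<tau>) * jfac (g2, e2) \<tau>
                                  = jfac (sl2_mult g1 g2, e) \<tau>))"

definition Mp_pre :: "sl2 set \<Rightarrow> mp set" where
  "Mp_pre G = {(g, e). g \<in> G \<and> e \<in> {1, -1}}"

fun hact :: "(real^'n) \<times> (real^'n) \<Rightarrow> sl2 \<Rightarrow> (real^'n) \<times> (real^'n)" where
  "hact (v, w) (a,b,c,d) = (of_int a *\<^sub>R v + of_int c *\<^sub>R w, of_int b *\<^sub>R v + of_int d *\<^sub>R w)"

fun heis_mult :: "(real^'n \<Rightarrow> real^'n \<Rightarrow> real) \<Rightarrow> (real^'n) \<times> (real^'n) \<times> complex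
      \<Rightarrow> (real^'n) \<times> (real^'n) \<times> complex \<Rightarrow> (real^'n) \<times> (real^'n) \<times> complex" where
  "heis_mult B (v1, w1, x1) (v2, w2, x2) =
     (v1 + v2, w1 + w2, x1 * x2 * exp (of_real pi * \<i> * of_real (B v1 w2 - B v2 w1)))"

text \<open>Semidirect product: (gamma1 h1)(gamma2 h2) = gamma1 gamma2 (h1 gamma2) h2.\<close>
fun jg_mult :: "(real^'n \<Rightarrow> real^'n \<Rightarrow> real) \<Rightarrow> 'n jg \<Rightarrow> 'n jg \<Rightarrow> 'n jg" where
  "jg_mult B (g1, (v1, w1, x1)) (g2, (v2, w2, x2)) =
     (mp_mult g1 g2,
      heis_mult B (fst (hact (v1, w1) (fst g2)), snd (hact (v1, w1) (fst g2)), x1) (v2, w2, x2))"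

definition JG :: "sl2 set \<Rightarrow> (real^'n) set \<Rightarrow> 'n jg set" where
  "JG G L = {(g, (v, w, x)). g \<in> Mp_pre G \<and> v \<in> L \<and> w \<in> L \<and> x \<in> {1, -1}}"

definition jg_rep :: "(real^'n \<Rightarrow> real^'n \<Rightarrow> real) \<Rightarrow> sl2 set \<Rightarrow> (real^'n) set
     \<Rightarrow> ('n jg \<Rightarrow> complex^'m^'m) \<Rightarrow> bool" where
  "jg_rep B G L \<rho> \<longleftrightarrow>
     (\<forall>g\<in>JG G L. invertible (\<rho> g)) \<and>
     (\<forall>g\<in>JG G L. \<forall>h\<in>JG G L. \<rho> (jg_mult B g h) = \<rho> g ** \<rho> h)"

definition rep_kernel_finite_index :: "(real^'n \<Rightarrow> real^'n \<Rightarrow> real) \<Rightarrow> sl2 set \<Rightarrow> (real^'n) set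
     \<Rightarrow> ('n jg \<Rightarrow> complex^'m^'m) \<Rightarrow> bool" where
  "rep_kernel_finite_index B G L \<rho> \<longleftrightarrow>
     finite {(\<lambda>k. jg_mult B g k) ` {h\<in>JG G L. \<rho> h = mat 1} | g. g \<in> JG G L}"

definition rho_res :: "(('n::finite) jg \<Rightarrow> complex^'m^'m) \<Rightarrow> mp \<Rightarrow> complex^'m^'m" where
  "rho_res \<rho> g = \<rho> (g, (0, 0, 1))"

text \<open>(epsilon sqrt(c tau + d))^(-2k) for k in 1/2 Z.\<close>
definition wpow :: "complex \<Rightarrow> real \<Rightarrow> complex" where
  "wpow w k = w powi (- \<lfloor>2 * k\<rfloor>)"

fun jslash :: "(real^'n \<Rightarrow> real^'n \<Rightarrow> real) \<Rightarrow> real \<Rightarrow> 'n jg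
     \<Rightarrow> (complex \<Rightarrow> complex^'n \<Rightarrow> complex^'m) \<Rightarrow> complex \<Rightarrow> complex^'n \<Rightarrow> complex^'m" where
  "jslash B k (((a,b,c,d), \<epsilon>), (v, w, x)) f \<tau> z =
     (let ct = of_int c * \<tau> + of_int d;
          u = z + \<tau> *s cvec v + cvec w
      in (wpow (jfac ((a,b,c,d), \<epsilon>) \<tau>) k * x *
          ee (- (of_int c * Qc B u) / ct + \<tau> * of_real (Qr B v) + Bc B (cvec v) z
              + of_real (B v w) / 2))
         *s f (mobius (a,b,c,d) \<tau>) ((1 / ct) *s u))"

definition mslash :: "real \<Rightarrow> mp \<Rightarrow> (complex \<Rightarrow> complex^'m) \<Rightarrow> complex \<Rightarrow> complex^'m" where
  "mslash k g h \<tau> = wpow (jfac g \<tau>) k *s h (mobius (fst g) \<tau>)"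

text \<open>Holomorphic on an open subset of H x \<V>: complex-Frechet differentiable
  (real derivative that is C-linear).\<close>
definition jholo_on :: "(complex \<times> (complex^'n)) set \<Rightarrow> (complex \<Rightarrow> complex^'n \<Rightarrow> complex^'m) \<Rightarrow> bool" where
  "jholo_on S f \<longleftrightarrow> (\<forall>x\<in>S. \<exists>D. ((\<lambda>(\<tau>, z). f \<tau> z) has_derivative D) (at x) \<and>
        (\<forall>c \<tau> z. D (c * \<tau>, c *s z) = c *s D (\<tau>, z)))"

definition vholo_on :: "complex set \<Rightarrow> (complex \<Rightarrow> complex^'m) \<Rightarrow> bool" where
  "vholo_on S h \<longleftrightarrow> (\<forall>i. (\<lambda>\<tau>. h \<tau> $ i) holomorphic_on S)"

definition jidx :: "(real^'n \<Rightarrow> real^'n \<Rightarrow> real) \<Rightarrow> (real^'n) set \<Rightarrow> nat \<Rightarrow> (real \<times> (real^'n)) set" where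
  "jidx B L M = {(n, t). (\<exists>a\<in>\<int>. n = a / real M) \<and>
                         (\<exists>s\<in>dual_lattice B L. t = (1 / real M) *\<^sub>R s)}"

definition jterm :: "(real^'n \<Rightarrow> real^'n \<Rightarrow> real) \<Rightarrow> (real \<times> (real^'n) \<Rightarrow> complex^'m)
     \<Rightarrow> complex \<Rightarrow> complex^'n \<Rightarrow> real \<times> (real^'n) \<Rightarrow> complex^'m" where
  "jterm B c \<tau> z nt = (ee (of_real (fst nt) * \<tau>) * ee (Bc B (cvec (snd nt)) z)) *s c nt"

definition jexpansion :: "(real^'n \<Rightarrow> real^'n \<Rightarrow> real) \<Rightarrow> (real^'n) set \<Rightarrow> real
     \<Rightarrow> (complex \<Rightarrow> complex^'n \<Rightarrow> complex^'m) \<Rightarrow> 'n jg \<Rightarrow> nat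
     \<Rightarrow> (real \<times> (real^'n) \<Rightarrow> complex^'m) \<Rightarrow> bool" where
  "jexpansion B L k f g M c \<longleftrightarrow> M > 0 \<and>
     (\<forall>\<tau>\<in>Hset. \<forall>z. (jterm B c \<tau> z has_sum jslash B k g f \<tau> z) (jidx B L M)) \<and>
     (\<forall>K. compact K \<and> K \<noteq> {} \<and> K \<subseteq> Hset \<times> UNIV \<longrightarrow>
        (\<lambda>nt. SUP x\<in>K. norm (jterm B c (fst x) (snd x) nt)) summable_on (jidx B L M))"

definition jacobi_base :: "(real^'n \<Rightarrow> real^'n \<Rightarrow> real) \<Rightarrow> (real^'n) set \<Rightarrow> sl2 set
     \<Rightarrow> ('n jg \<Rightarrow> complex^'m^'m) \<Rightarrow> real \<Rightarrow> (complex \<Rightarrow> complex^'n \<Rightarrow> complex^'m) \<Rightarrow> bool" where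
  "jacobi_base B L G \<rho> k \<phi> \<longleftrightarrow> jholo_on (Hset \<times> UNIV) \<phi> \<and>
     (\<forall>g\<in>JG G L. \<forall>\<tau>\<in>Hset. \<forall>z. jslash B k g \<phi> \<tau> z = \<rho> g *v \<phi> \<tau> z)"

definition Jwh :: "(real^'n \<Rightarrow> real^'n \<Rightarrow> real) \<Rightarrow> (real^'n) set \<Rightarrow> sl2 set
     \<Rightarrow> ('n jg \<Rightarrow> complex^'m^'m) \<Rightarrow> real \<Rightarrow> (complex \<Rightarrow> complex^'n \<Rightarrow> complex^'m) set" where
  "Jwh B L G \<rho> k = {\<phi>. jacobi_base B L G \<rho> k \<phi> \<and>
     (\<forall>g\<in>JG SL2Z L. \<exists>M c. jexpansion B L k \<phi> g M c \<and>
        (\<exists>N0. \<forall>nt\<in>jidx B L M. fst nt < N0 \<longrightarrow> c nt = 0))}"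

definition Jweak :: "(real^'n \<Rightarrow> real^'n \<Rightarrow> real) \<Rightarrow> (real^'n) set \<Rightarrow> sl2 set
     \<Rightarrow> ('n jg \<Rightarrow> complex^'m^'m) \<Rightarrow> real \<Rightarrow> (complex \<Rightarrow> complex^'n \<Rightarrow> complex^'m) set" where
  "Jweak B L G \<rho> k = {\<phi>. jacobi_base B L G \<rho> k \<phi> \<and>
     (\<forall>g\<in>JG SL2Z L. \<exists>M c. jexpansion B L k \<phi> g M c \<and>
        (\<forall>nt\<in>jidx B L M. fst nt < 0 \<longrightarrow> c nt = 0))}"

definition Jhol :: "(real^'n \<Rightarrow> real^'n \<Rightarrow> real) \<Rightarrow> (real^'n) set \<Rightarrow> sl2 set
     \<Rightarrow> ('n jg \<Rightarrow> complex^'m^'m) \<Rightarrow> real \<Rightarrow> (complex \<Rightarrow> complex^'n \<Rightarrow> complex^'m) set" where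
  "Jhol B L G \<rho> k = {\<phi>. jacobi_base B L G \<rho> k \<phi> \<and>
     (\<forall>g\<in>JG SL2Z L. \<exists>M c. jexpansion B L k \<phi> g M c \<and>
        (\<forall>nt\<in>jidx B L M. \<not> (fst nt \<ge> Qr B (snd nt)) \<longrightarrow> c nt = 0))}"

definition qidx :: "nat \<Rightarrow> real set" where
  "qidx M = {n. \<exists>a\<in>\<int>. n = a / real M}"

definition qexpansion :: "real \<Rightarrow> (complex \<Rightarrow> complex^'m) \<Rightarrow> mp \<Rightarrow> nat \<Rightarrow> (real \<Rightarrow> complex^'m) \<Rightarrow> bool" where
  "qexpansion k h g M c \<longleftrightarrow> M > 0 \<and>
     (\<forall>\<tau>\<in>Hset. ((\<lambda>n. ee (of_real n * \<tau>) *s c n) has_sum mslash k g h \<tau>) (qidx M)) \<and>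
     (\<forall>K. compact K \<and> K \<noteq> {} \<and> K \<subseteq> Hset \<longrightarrow>
        (\<lambda>n. SUP \<tau>\<in>K. norm (ee (of_real n * \<tau>) *s c n)) summable_on (qidx M))"

definition mform_base :: "real \<Rightarrow> sl2 set \<Rightarrow> (mp \<Rightarrow> complex^'m^'m) \<Rightarrow> (complex \<Rightarrow> complex^'m) \<Rightarrow> bool" where
  "mform_base k G \<sigma> h \<longleftrightarrow> vholo_on Hset h \<and>
     (\<forall>g\<in>Mp_pre G. \<forall>\<tau>\<in>Hset. mslash k g h \<tau> = \<sigma> g *v h \<tau>)"

definition Mwh :: "real \<Rightarrow> sl2 set \<Rightarrow> (mp \<Rightarrow> complex^'m^'m) \<Rightarrow> (complex \<Rightarrow> complex^'m) set" where
  "Mwh k G \<sigma> = {h. mform_base k G \<sigma> h \<and> (\<forall>g\<in>Mp_pre SL2Z. \<exists>M c. qexpansion k h g M c \<and>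
       (\<exists>N0. \<forall>n\<in>qidx M. n < N0 \<longrightarrow> c n = 0))}"

definition Mhol :: "real \<Rightarrow> sl2 set \<Rightarrow> (mp \<Rightarrow> complex^'m^'m) \<Rightarrow> (complex \<Rightarrow> complex^'m) set" where
  "Mhol k G \<sigma> = {h. mform_base k G \<sigma> h \<and> (\<forall>g\<in>Mp_pre SL2Z. \<exists>M c. qexpansion k h g M c \<and>
       (\<forall>n\<in>qidx M. n < 0 \<longrightarrow> c n = 0))}"

definition Scusp :: "real \<Rightarrow> sl2 set \<Rightarrow> (mp \<Rightarrow> complex^'m^'m) \<Rightarrow> (complex \<Rightarrow> complex^'m) set" where
  "Scusp k G \<sigma> = {h. mform_base k G \<sigma> h \<and> (\<forall>g\<in>Mp_pre SL2Z. \<exists>M c. qexpansion k h g M c \<and>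
       (\<forall>n\<in>qidx M. n \<le> 0 \<longrightarrow> c n = 0))}"

definition coordv :: "('n \<Rightarrow> real^'n) \<Rightarrow> complex^'n \<Rightarrow> complex^'n" where
  "coordv e z = (\<chi> l. \<Sum>i\<in>UNIV. z $ i * of_real (e i $ l))"

definition msum :: "('n \<Rightarrow> nat) \<Rightarrow> nat" where
  "msum p = (\<Sum>i\<in>UNIV. p i)"

definition taylor_coeffs :: "('n \<Rightarrow> real^'n) \<Rightarrow> (complex \<Rightarrow> complex^'n \<Rightarrow> complex^'m)
     \<Rightarrow> complex \<Rightarrow> ('n \<Rightarrow> nat) \<Rightarrow> complex^'m" where
  "taylor_coeffs e \<phi> \<tau> = (THE h. \<exists>r>0. \<forall>z. (\<forall>i. norm (z $ i) < r) \<longrightarrow>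
      ((\<lambda>j. (\<Prod>i\<in>UNIV. (z $ i) ^ j i) *s h j) has_sum \<phi> \<tau> (coordv e z)) UNIV)"

definition hcoef :: "('n \<Rightarrow> real^'n) \<Rightarrow> (complex \<Rightarrow> complex^'n \<Rightarrow> complex^'m)
     \<Rightarrow> ('n \<Rightarrow> int) \<Rightarrow> complex \<Rightarrow> complex^'m" where
  "hcoef e \<phi> j \<tau> = (if \<forall>i. j i \<ge> 0 then taylor_coeffs e \<phi> \<tau> (\<lambda>i. nat (j i)) else 0)"

definition vderiv :: "(complex \<Rightarrow> complex^'m) \<Rightarrow> complex \<Rightarrow> complex^'m" where
  "vderiv h \<tau> = (\<chi> i. deriv (\<lambda>t. h t $ i) \<tau>)"

definition msumL :: "('n \<Rightarrow> 'n \<Rightarrow> nat) \<Rightarrow> nat" where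
  "msumL \<Lambda> = (\<Sum>i\<in>UNIV. \<Sum>j\<in>UNIV. \<Lambda> i j)"

definition factL :: "('n \<Rightarrow> 'n \<Rightarrow> nat) \<Rightarrow> nat" where
  "factL \<Lambda> = (\<Prod>i\<in>UNIV. \<Prod>j\<in>UNIV. fact (\<Lambda> i j))"

definition piL :: "('n \<Rightarrow> 'n \<Rightarrow> nat) \<Rightarrow> 'n \<Rightarrow> nat" where
  "piL \<Lambda> i = (\<Sum>j\<in>UNIV. \<Lambda> i j) + (\<Sum>j\<in>UNIV. \<Lambda> j i)"

definition Dop :: "(real^'n \<Rightarrow> real^'n \<Rightarrow> real) \<Rightarrow> ('n \<Rightarrow> real^'n) \<Rightarrow> real
     \<Rightarrow> (complex \<Rightarrow> complex^'n \<Rightarrow> complex^'m) \<Rightarrow> ('n \<Rightarrow> nat) \<Rightarrow> complex \<Rightarrow> complex^'m" where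
  "Dop B e k \<phi> p \<tau> =
     (let s = msum p; lam = s div 2; lam' = (int s - 1) div 2
      in (of_nat (4 ^ lam * fact lam) :: complex) *s
         (\<Sum>\<Lambda>\<in>{\<Lambda>. msumL \<Lambda> \<le> lam}.
            ((\<Prod>i\<in>UNIV. \<Prod>j\<in>UNIV. (- of_real pi * \<i> * of_real (B (e i) (e j))) ^ \<Lambda> i j)
               / of_nat (factL \<Lambda>)
             * (\<Prod>m\<in>{lam'..int s - 2 - int (msumL \<Lambda>)}. (of_real k + of_int m)))
            *s (vderiv ^^ msumL \<Lambda>) (hcoef e \<phi> (\<lambda>i. int (p i) - int (piL \<Lambda> i))) \<tau>))"

definition mle :: "('n \<Rightarrow> nat) \<Rightarrow> ('n \<Rightarrow> nat) \<Rightarrow> bool" where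
  "mle p1 p2 \<longleftrightarrow> (\<forall>i. p1 i \<le> p2 i) \<and> even (msum p1) = even (msum p2)"

definition Phat :: "('n \<Rightarrow> nat) set \<Rightarrow> ('n \<Rightarrow> nat) set" where
  "Phat P = {p. \<exists>p'\<in>P. mle p p'}"

definition theta :: "(real^'n \<Rightarrow> real^'n \<Rightarrow> real) \<Rightarrow> (real^'n) set \<Rightarrow> real^'n
     \<Rightarrow> complex \<Rightarrow> complex^'n \<Rightarrow> complex" where
  "theta B L t \<tau> z = (\<Sum>\<^sub>\<infinity>v\<in>(\<lambda>l. t + l) ` L. ee (\<tau> * of_real (Qr B v) + Bc B (cvec v) z))"

definition pdi :: "'n \<Rightarrow> (complex^'n \<Rightarrow> complex) \<Rightarrow> complex^'n \<Rightarrow> complex" where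
  "pdi i f z = deriv (\<lambda>w. f (\<chi> j. if j = i then w else z $ j)) (z $ i)"

definition enum_idx :: "'n::finite list" where
  "enum_idx = (SOME xs. distinct xs \<and> set xs = UNIV)"

definition pderivs :: "('n::finite \<Rightarrow> nat) \<Rightarrow> (complex^'n \<Rightarrow> complex) \<Rightarrow> complex^'n \<Rightarrow> complex" where
  "pderivs p f = fold (\<lambda>i g. (pdi i ^^ p i) g) enum_idx f"

definition detL :: "nat \<Rightarrow> (nat \<Rightarrow> nat \<Rightarrow> complex) \<Rightarrow> complex" where
  "detL d A = (\<Sum>\<sigma>\<in>{\<sigma>. \<sigma> permutes {..<d}}. of_int (sign \<sigma>) * (\<Prod>i<d. A i (\<sigma> i)))"

definition Fdet :: "(real^'n \<Rightarrow> real^'n \<Rightarrow> real) \<Rightarrow> (real^'n) set \<Rightarrow> ('n \<Rightarrow> real^'n)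
     \<Rightarrow> nat \<Rightarrow> (nat \<Rightarrow> 'n \<Rightarrow> nat) \<Rightarrow> (nat \<Rightarrow> real^'n) \<Rightarrow> complex \<Rightarrow> complex" where
  "Fdet B L e d p t \<tau> = detL d (\<lambda>i j.
      (1 / (2 * of_real pi * \<i>) ^ msum (p i)) *
      pderivs (p i) (\<lambda>z. theta B L (t j) \<tau> (coordv e z)) 0)"

end

theory Submission
  imports Defs "HOL-Complex_Analysis.Conformal_Mappings"
begin

text \<open>
  Fix a direction \<open>u\<close> and let \<open>X\<^sub>r\<close> be the homogeneous part of degree \<open>r\<close>, evaluated at \<open>u\<close>, of the
  Taylor expansion of \<open>\<phi>\<close>. By the multinomial theorem the generating polynomial
  \<open>\<Sum>\<^sub>p u\<^sup>p D\<^sub>p \<phi>\<close> is an Eichler-Zagier combination of derivatives of the \<open>X\<^sub>r\<close>. The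
  transformation law of \<open>\<phi>\<close> determines that of the \<open>X\<^sub>r\<close>; expanding the derivatives, every term
  except the expected one carries a finite difference of a polynomial of too small degree, so the
  operators commute with the slash actions. Termwise differentiation of the Fourier expansion
  \<open>\<Sum> c(n,t) q\<^sup>n e(B(t,z))\<close> multiplies \<open>c(n,t)\<close> by a polynomial in \<open>(n,t)\<close> without constant term
  unless \<open>p = 0\<close>, which gives the conditions at the cusps.

  For injectivity, the vanishing of all \<open>D\<^sub>p \<phi>\<close> with \<open>p\<close> in the closed set of indices gives, by
  induction on the degree and since \<open>k\<close> is not a nonpositive integer, the vanishing of the Taylor
  coefficients with these indices. Invariance under the lattice yields
  \<open>\<phi> = \<Sum>\<^sub>j F\<^sub>j \<theta>\<^sub>j\<close>, so that \<open>(F\<^sub>j)\<close> lies in the kernel of the matrix of derivatives of theta series.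
  Hence \<open>\<phi>\<close> vanishes wherever the determinant does not, and then everywhere by analytic continuation.
\<close>

section \<open>Uniqueness of character expansions and power series\<close>

text \<open>Absolutely convergent sums of exponentials with real frequencies carry the whole
  argument. Since |e(nw)| is monotone in the imaginary part of w, a pointwise \<open>has_sum\<close>
  on an open set is majorised near each point by its values at two shifted points (finitely many in
  several variables); this gives holomorphy, termwise derivatives and Taylor coefficients. The
  operators are built from a definite description and from \<open>deriv\<close>, so they become
  algebraic only after passing to such expansions: there they multiply coefficients by a polynomial.
  The constant -pi i in the operators is dictated by the slash action: for z = x u its exponential
  factor is exp(\<alpha> c x^2/(c\<tau>+d)) with \<alpha> = -2 pi i Q(u), and the multinomial
  theorem gives back the same \<alpha> as the weight of each \<tau>-derivative. The theta
  decomposition is made at one fixed \<tau>, so the F_j are mere numbers; the analytic continuation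
  is applied to \<phi> itself, as a function of \<tau> for each z.\<close>

lemma ee_add: "ee (x + y) = ee x * ee y"
  by (simp add: ee_def algebra_simps exp_add)

lemma ee_0 [simp]: "ee 0 = 1"
  by (simp add: ee_def)

lemma ee_nonzero [simp]: "ee x \<noteq> 0"
  by (simp add: ee_def)

lemma norm_ee: "norm (ee x) = exp (- (2 * pi * Im x))"
  by (simp add: ee_def)

lemma ee_half: "ee (1 / 2) = -1"
  by (simp add: ee_def)

lemma ee_eq_1_iff: "ee x = 1 \<longleftrightarrow> x \<in> \<int>"
proof -
  have "ee x = 1 \<longleftrightarrow> (\<exists>n::int. 2 * of_real pi * \<i> * x = 2 * of_real pi * \<i> * of_int n)"
    unfolding ee_def exp_eq_1 by (auto simp: complex_eq_iff)
  also have "\<dots> \<longleftrightarrow> x \<in> \<int>" by (auto elim: Ints_cases)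
  finally show ?thesis .
qed

lemma has_sum_minus:
  fixes f g :: "'a \<Rightarrow> complex"
  assumes "(f has_sum s) A" "(g has_sum t) A"
  shows "((\<lambda>x. f x - g x) has_sum (s - t)) A"
  using has_sum_add [OF assms(1) has_sum_cmult_right [OF assms(2), of "-1"]] by simp

lemma has_sum_imp_abs_summable:
  fixes f :: "'a \<Rightarrow> complex"
  assumes "(f has_sum s) A"
  shows "(\<lambda>x. norm (f x)) summable_on A"
  using assms summable_on_iff_abs_summable_on_complex has_sum_imp_summable by blast

text \<open>The frequencies are arbitrary real vectors, so no compact torus is at hand for
  orthogonality integrals. After twisting so that the term of \<open>i0\<close> becomes constant,
  averages over two translates erase finitely many other characters while all weights stay bounded
  by 1; absolute summability makes the remaining tail arbitrarily small.\<close>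

lemma character_sum_coeff_eq_0:
  fixes a :: "'i \<Rightarrow> complex" and b :: "'i \<Rightarrow> 'n::finite \<Rightarrow> real"
  assumes inj: "inj_on b I"
    and zero: "\<And>\<theta>::'n \<Rightarrow> real. ((\<lambda>i. a i * ee (of_real (\<Sum>l\<in>UNIV. \<theta> l * b i l))) has_sum 0) I"
    and i0: "i0 \<in> I"
  shows "a i0 = 0"
proof -
  define ch where "ch i \<theta> = ee (of_real (\<Sum>l\<in>UNIV. \<theta> l * (b i l - b i0 l)))" for i and \<theta> :: "'n \<Rightarrow> real"
  have ch_add: "ch i (\<lambda>l. \<theta> l + \<eta> l) = ch i \<theta> * ch i \<eta>" for i \<theta> \<eta>
    unfolding ch_def ee_add [symmetric] of_real_add [symmetric] sum.distrib [symmetric]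
    by (simp only: distrib_right)
  have ch_i0: "ch i0 \<theta> = 1" for \<theta> by (simp add: ch_def)
  have ch_norm: "norm (ch i \<theta>) = 1" for i \<theta> by (simp add: ch_def norm_ee)
  have abs: "(\<lambda>i. norm (a i)) summable_on I"
    using has_sum_imp_abs_summable [OF zero [of "\<lambda>_. 0"]] by simp
  have base: "((\<lambda>i. a i * ch i \<theta>) has_sum 0) I" for \<theta>
  proof -
    have "((\<lambda>i. ee (- of_real (\<Sum>l\<in>UNIV. \<theta> l * b i0 l)) *
         (a i * ee (of_real (\<Sum>l\<in>UNIV. \<theta> l * b i l)))) has_sum
         (ee (- of_real (\<Sum>l\<in>UNIV. \<theta> l * b i0 l)) * 0)) I"
      by (intro has_sum_cmult_right zero)
    moreover have "ee (- of_real (\<Sum>l\<in>UNIV. \<theta> l * b i0 l)) *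
         (a i * ee (of_real (\<Sum>l\<in>UNIV. \<theta> l * b i l))) = a i * ch i \<theta>" for i
    proof -
      have "ch i \<theta> = ee (- of_real (\<Sum>l\<in>UNIV. \<theta> l * b i0 l)) * ee (of_real (\<Sum>l\<in>UNIV. \<theta> l * b i l))"
        unfolding ch_def ee_add [symmetric]
        by (rule arg_cong[where f=ee]) (simp add: algebra_simps sum_subtractf)
      thus ?thesis by simp
    qed
    ultimately show ?thesis by (simp only: mult_zero_right)
  qed
  \<comment> \<open>averaging over a translate by \<open>\<eta>\<close> with \<open>ch f \<eta> = -1\<close> removes the character \<open>f\<close> and keeps the trivial one\<close>
  have kill: "\<exists>w. (\<forall>i. norm (w i) \<le> 1) \<and> w i0 = 1 \<and> (\<forall>i\<in>F. w i = 0) \<and>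
      (\<forall>\<theta>. ((\<lambda>i. a i * w i * ch i \<theta>) has_sum 0) I)" if "finite F" "F \<subseteq> I - {i0}" for F
    using that
  proof (induction F rule: finite_induct)
    case empty
    show ?case by (intro exI[of _ "\<lambda>_. 1"]) (simp add: base)
  next
    case (insert f F)
    then obtain w where w: "\<And>i. norm (w i) \<le> (1::real)" "w i0 = 1" "\<And>i. i \<in> F \<Longrightarrow> w i = (0::complex)"
      "\<And>\<theta>. ((\<lambda>i. a i * w i * ch i \<theta>) has_sum 0) I" by blast
    have "b f \<noteq> b i0" using insert.prems inj i0 by (auto dest: inj_onD)
    then obtain l0 where l0: "b f l0 \<noteq> b i0 l0" by blast
    define \<eta> where "\<eta> l = (if l = l0 then 1 / (2 * (b f l0 - b i0 l0)) else 0)" for l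
    have \<eta>: "(\<Sum>l\<in>UNIV. \<eta> l * (b f l - b i0 l)) = (\<Sum>l\<in>UNIV. if l = l0 then 1/2 else 0)"
      by (rule sum.cong) (use l0 in \<open>auto simp: \<eta>_def field_simps\<close>)
    have "ch f \<eta> = -1" unfolding ch_def \<eta> using ee_half by simp
    define w' where "w' i = w i * ((1 + ch i \<eta>) / 2)" for i
    have "norm (w' i) \<le> 1" for i
    proof -
      have "norm ((1 + ch i \<eta>) / 2) \<le> 1"
        using norm_triangle_ineq[of 1 "ch i \<eta>"] by (simp add: ch_norm norm_divide)
      thus ?thesis unfolding w'_def norm_mult using w(1) by (intro mult_le_one) auto
    qed
    moreover have "w' i0 = 1" by (simp add: w'_def w ch_i0)
    moreover have "w' i = 0" if "i \<in> insert f F" for i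
      using that w(3) \<open>ch f \<eta> = -1\<close> by (auto simp: w'_def)
    moreover have "((\<lambda>i. a i * w' i * ch i \<theta>) has_sum 0) I" for \<theta>
    proof -
      have "((\<lambda>i. (1/2) * (a i * w i * ch i \<theta> + a i * w i * ch i (\<lambda>l. \<theta> l + \<eta> l))) has_sum ((1/2) * (0 + 0))) I"
        by (intro has_sum_cmult_right has_sum_add w(4))
      thus ?thesis by (simp add: w'_def ch_add algebra_simps add_divide_distrib)
    qed
    ultimately show ?case by blast
  qed
  have "norm (a i0) \<le> \<epsilon>" if \<epsilon>: "\<epsilon> > 0" for \<epsilon>
  proof -
    obtain F where F: "finite F" "F \<subseteq> I" "dist (\<Sum>i\<in>F. norm (a i)) (\<Sum>\<^sub>\<infinity>i\<in>I. norm (a i)) \<le> \<epsilon>"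
      using infsum_finite_approximation [OF abs \<epsilon>] by blast
    obtain w where w: "\<And>i. norm (w i) \<le> (1::real)" "w i0 = 1" "\<And>i. i \<in> F - {i0} \<Longrightarrow> w i = (0::complex)"
      "\<And>\<theta>. ((\<lambda>i. a i * w i * ch i \<theta>) has_sum 0) I"
      using kill[of "F - {i0}"] F by blast
    have s0: "((\<lambda>i. a i * w i) has_sum 0) I"
      using w(4)[of "\<lambda>_. 0"] by (simp add: ch_def)
    define F' where "F' = insert i0 F"
    have F': "finite F'" "F' \<subseteq> I" using F i0 by (auto simp: F'_def)
    \<comment> \<open>Within \<open>F'\<close> only \<open>i0\<close> keeps a nonzero weight, so the
      sum outside \<open>F'\<close> must be \<open>- a i0\<close>; it is bounded by the tail of the
      norms, which is at most \<epsilon>.\<close>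
    have "((\<lambda>i. a i * w i) has_sum (0 - (\<Sum>i\<in>F'. a i * w i))) (I - F')"
      by (intro has_sum_Diff s0 has_sum_finite F')
    moreover have "(\<Sum>i\<in>F'. a i * w i) = (\<Sum>i\<in>F'. if i = i0 then a i0 else 0)"
      by (rule sum.cong) (use w in \<open>auto simp: F'_def\<close>)
    ultimately have t: "((\<lambda>i. a i * w i) has_sum (- a i0)) (I - F')"
      using F' by (simp add: F'_def)
    have n: "((\<lambda>i. norm (a i)) has_sum ((\<Sum>\<^sub>\<infinity>i\<in>I. norm (a i)) - (\<Sum>i\<in>F'. norm (a i)))) (I - F')"
      by (intro has_sum_Diff has_sum_infsum abs has_sum_finite F')
    have "norm (- a i0) \<le> (\<Sum>\<^sub>\<infinity>i\<in>I. norm (a i)) - (\<Sum>i\<in>F'. norm (a i))"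
      using t n by (rule norm_infsum_le) (use w(1) in \<open>auto simp: norm_mult mult_left_le\<close>)
    also have "(\<Sum>i\<in>F'. norm (a i)) \<ge> (\<Sum>i\<in>F. norm (a i))"
      by (rule sum_mono2) (use F' in \<open>auto simp: F'_def\<close>)
    ultimately show ?thesis using F(3) by (auto simp: dist_real_def)
  qed
  thus ?thesis 
    by (metis field_le_epsilon norm_le_zero_iff add_0)
qed

text \<open>On the torus of radius r/2 the power series becomes a sum of characters with frequencies
  \<open>j\<close>, so \<open>character_sum_coeff_eq_0\<close> takes the place of Cauchy's
  formula.\<close>

lemma power_series_coeff_eq_0:
  fixes h :: "('n::finite \<Rightarrow> nat) \<Rightarrow> complex"
  assumes r: "r > 0"
    and zero: "\<And>z::'n \<Rightarrow> complex. (\<And>i. norm (z i) < r) \<Longrightarrow>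
       ((\<lambda>j. (\<Prod>i\<in>UNIV. z i ^ j i) * h j) has_sum 0) UNIV"
  shows "h j = 0"
proof -
  define a where "a j = h j * of_real ((r/2) ^ (\<Sum>i\<in>UNIV. j i))" for j
  have "a j = 0"
  proof (rule character_sum_coeff_eq_0 [where b = "\<lambda>j l. real (j l)" and I = UNIV])
    show "inj (\<lambda>j l. real ((j::'n \<Rightarrow> nat) l))"
      by (auto intro!: injI simp: fun_eq_iff)
    fix \<theta> :: "'n \<Rightarrow> real"
    have "((\<lambda>j. (\<Prod>i\<in>UNIV. (of_real (r/2) * ee (of_real (\<theta> i))) ^ j i) * h j) has_sum 0) UNIV"
      using r by (intro zero) (simp add: norm_mult norm_ee)
    moreover have "(\<Prod>i\<in>UNIV. (of_real (r/2) * ee (of_real (\<theta> i))) ^ j i) * h j =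
       a j * ee (of_real (\<Sum>l\<in>UNIV. \<theta> l * real (j l)))" for j
    proof -
      have "(\<Prod>i\<in>UNIV. (of_real (r/2) * ee (of_real (\<theta> i))) ^ j i) =
         of_real ((r/2) ^ (\<Sum>i\<in>UNIV. j i)) * (\<Prod>i\<in>UNIV. ee (of_real (\<theta> i)) ^ j i)"
        unfolding power_mult_distrib prod.distrib power_sum of_real_prod of_real_power ..
      also have "(\<Prod>i\<in>UNIV. ee (of_real (\<theta> i)) ^ j i) = ee (of_real (\<Sum>l\<in>UNIV. \<theta> l * real (j l)))"
        by (simp add: ee_def exp_sum sum_distrib_left exp_of_nat_mult [symmetric] mult_ac)
      finally show ?thesis by (simp add: a_def mult_ac)
    qed
    ultimately show "((\<lambda>j. a j * ee (of_real (\<Sum>l\<in>UNIV. \<theta> l * real (j l)))) has_sum 0) UNIV" by simp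
  qed auto
  thus ?thesis using r by (simp add: a_def)
qed

lemma has_sum_group:
  fixes f :: "'i \<Rightarrow> complex" and deg :: "'i \<Rightarrow> 'd"
  assumes "(f has_sum S) I" "\<And>s. finite {i\<in>I. deg i = s}"
  shows "((\<lambda>s. \<Sum>i | i \<in> I \<and> deg i = s. f i) has_sum S) UNIV"
proof (rule has_sum_SigmaD)
  show "((\<lambda>(s, i). f i) has_sum S) (SIGMA s:UNIV. {i. i \<in> I \<and> deg i = s})"
    by (rule iffD1 [OF has_sum_reindex_bij_witness [of I snd "\<lambda>i. (deg i, i)" _ _ f]])
       (use assms in auto)
qed (use assms in \<open>auto intro!: has_sum_finite\<close>)

text \<open>Used to read off one coefficient in a scaling variable when one side is indexed by
  multi-indices or by pairs rather than by the degree; the terms may be grouped by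
  \<open>deg\<close> because its fibres are finite.\<close>

lemma power_series_graded_unique:
  fixes a :: "'i \<Rightarrow> complex" and c :: "nat \<Rightarrow> complex"
  assumes fin: "\<And>s. finite {i\<in>I. deg i = s}"
    and a: "\<And>x. ((\<lambda>i. a i * x ^ deg i) has_sum F x) I"
    and c: "\<And>x. ((\<lambda>s. c s * x ^ s) has_sum F x) UNIV"
  shows "c s = (\<Sum>i | i \<in> I \<and> deg i = s. a i)"
proof -
  define d where "d s = c s - (\<Sum>i | i \<in> I \<and> deg i = s. a i)" for s
  have "((\<lambda>s. d s * x ^ s) has_sum 0) UNIV" for x
  proof -
    have "((\<lambda>s. \<Sum>i | i \<in> I \<and> deg i = s. a i * x ^ deg i) has_sum F x) UNIV"
      by (rule has_sum_group [OF a fin])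
    also have "(\<lambda>s. \<Sum>i | i \<in> I \<and> deg i = s. a i * x ^ deg i) =
       (\<lambda>s. (\<Sum>i | i \<in> I \<and> deg i = s. a i) * x ^ s)"
      unfolding sum_distrib_right by (intro ext sum.cong) auto
    finally show ?thesis using has_sum_minus [OF c[of x]]
      by (fastforce simp: d_def algebra_simps)
  qed
  \<comment> \<open>One variable is the case of exponents indexed by \<open>unit\<close> in
    \<open>power_series_coeff_eq_0\<close>.\<close>
  have zero: "((\<lambda>j::unit \<Rightarrow> nat. (\<Prod>i\<in>UNIV. z i ^ j i) * d (j ())) has_sum 0) UNIV" for z
    by (rule iffD1 [OF has_sum_reindex_bij_witness [of UNIV "\<lambda>j. j ()" "\<lambda>s _. s"]],
       rule_tac [6] refl, rule_tac [6] \<open>((\<lambda>s. d s * z () ^ s) has_sum 0) UNIV\<close>) (auto simp: UNIV_unit mult.commute)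
  have "d ((\<lambda>_::unit. s) ()) = 0"
    by (rule power_series_coeff_eq_0 [where r = 1 and h = "\<lambda>j. d (j ())"]) (use zero in auto)
  thus ?thesis by (simp add: d_def)
qed

text \<open>A finite set of functions lies in the product of its coordinate projections, where the
  sum of products factorises; so the product of the single sums bounds all finite partial
  sums.\<close>

lemma abs_summable_prod_PiE:
  fixes f :: "'n::finite \<Rightarrow> 'b \<Rightarrow> complex"
  assumes "\<And>x. (\<lambda>y. norm (f x y)) summable_on C x"
  shows "(\<lambda>g. norm (\<Prod>x\<in>UNIV. f x (g x))) summable_on (PiE UNIV C)"
proof (rule nonneg_bdd_above_summable_on)
  show "bdd_above (sum (\<lambda>g. norm (\<Prod>x\<in>UNIV. f x (g x))) ` {F. F \<subseteq> PiE UNIV C \<and> finite F})"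
  proof (rule bdd_aboveI2)
    fix F assume F: "F \<in> {F. F \<subseteq> PiE UNIV C \<and> finite F}"
    have "(\<Sum>g\<in>F. norm (\<Prod>x\<in>UNIV. f x (g x))) \<le>
       (\<Sum>g\<in>PiE UNIV (\<lambda>x. (\<lambda>g. g x) ` F). \<Prod>x\<in>UNIV. norm (f x (g x)))"
      using F by (subst prod_norm, intro sum_mono2 finite_PiE) (auto simp: prod_nonneg)
    also have "\<dots> = (\<Prod>x\<in>UNIV. \<Sum>y\<in>(\<lambda>g. g x) ` F. norm (f x y))"
      using F by (intro prod_sum_PiE [symmetric]) auto
    also have "\<dots> \<le> (\<Prod>x\<in>UNIV. \<Sum>\<^sub>\<infinity>y\<in>C x. norm (f x y))"
      using F assms by (intro prod_mono conjI sum_nonneg finite_sum_le_infsum) (auto simp: PiE_def Pi_def)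
    finally show "(\<Sum>g\<in>F. norm (\<Prod>x\<in>UNIV. f x (g x))) \<le> (\<Prod>x\<in>UNIV. \<Sum>\<^sub>\<infinity>y\<in>C x. norm (f x y))" .
  qed
qed auto

section \<open>The exponential series in several variables and the multinomial theorem\<close>

lemma has_sum_exp: "((\<lambda>n. x ^ n / fact n) has_sum exp (x::complex)) UNIV"
proof -
  have "(\<lambda>n. x ^ n / fact n) sums exp x"
    using exp_converges[of x] by (simp add: scaleR_conv_of_real field_simps)
  moreover have "summable (\<lambda>n. norm (x ^ n / fact n))"
    using summable_norm_exp[of x] by (simp add: norm_divide norm_power field_simps)
  ultimately show ?thesis by (intro norm_summable_imp_has_sum)
qed

lemma has_sum_exp_multi:
  fixes x :: "'n::finite \<Rightarrow> complex"
  shows "((\<lambda>j. \<Prod>l\<in>UNIV. x l ^ j l / fact (j l)) has_sum exp (\<Sum>l\<in>UNIV. x l)) UNIV"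
proof -
  have s: "(\<lambda>n. norm (x l ^ n / fact n)) summable_on UNIV" for l
    using has_sum_exp has_sum_imp_abs_summable by blast
  have "(\<lambda>j. norm (\<Prod>l\<in>UNIV. x l ^ j l / fact (j l))) summable_on (PiE UNIV (\<lambda>_. UNIV))"
    by (rule abs_summable_prod_PiE) (rule s)
  hence "(\<lambda>j. \<Prod>l\<in>UNIV. x l ^ j l / fact (j l)) summable_on UNIV"
    by (simp add: abs_summable_summable)
  moreover have "infsum (\<lambda>j. \<Prod>l\<in>UNIV. x l ^ j l / fact (j l)) (PiE UNIV (\<lambda>_. UNIV)) =
     (\<Prod>l\<in>UNIV. infsum (\<lambda>n. x l ^ n / fact n) UNIV)"
    by (rule infsum_prod_PiE_abs) (auto intro: s)
  moreover have "infsum (\<lambda>n. x l ^ n / fact n) UNIV = exp (x l)" for l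
    by (rule infsumI has_sum_exp)+
  ultimately show ?thesis by (auto simp: has_sum_iff exp_sum)
qed

lemma finite_sum_le_nat: "finite {j::'n::finite \<Rightarrow> nat. (\<Sum>l\<in>UNIV. j l) \<le> s}"
proof (rule finite_subset)
  show "{j::'n \<Rightarrow> nat. (\<Sum>l\<in>UNIV. j l) \<le> s} \<subseteq> PiE UNIV (\<lambda>_. {..s})"
  proof
    fix j :: "'n \<Rightarrow> nat" assume "j \<in> {j. (\<Sum>l\<in>UNIV. j l) \<le> s}"
    moreover have "j l \<le> (\<Sum>l\<in>UNIV. j l)" for l by (rule member_le_sum) auto
    ultimately show "j \<in> PiE UNIV (\<lambda>_. {..s})" using order_trans by fastforce
  qed
qed (auto intro: finite_PiE)

text \<open>Both sides are the coefficient of y^\<nu> in exp(y \<Sum> x), computed from a product of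
  exponentials and from a single one.\<close>

lemma multinomial_fact:
  fixes x :: "'n::finite \<Rightarrow> complex"
  shows "(\<Sum>j | (\<Sum>l\<in>UNIV. j l) = \<nu>. \<Prod>l\<in>UNIV. x l ^ j l / fact (j l)) = (\<Sum>l\<in>UNIV. x l) ^ \<nu> / fact \<nu>"
proof -
  have "(\<Sum>l\<in>UNIV. x l) ^ \<nu> / fact \<nu> =
    (\<Sum>j | j \<in> UNIV \<and> (\<Sum>l\<in>UNIV. j l) = \<nu>. \<Prod>l\<in>UNIV. x l ^ j l / fact (j l))"
  proof (rule power_series_graded_unique [where F = "\<lambda>y. exp (\<Sum>l\<in>UNIV. y * x l)"])
    show "finite {j\<in>UNIV. (\<Sum>l\<in>UNIV. (j::'n \<Rightarrow> nat) l) = s}" for s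
      by (rule finite_subset[OF _ finite_sum_le_nat[of s]]) auto
    fix y
    have "(\<Prod>l\<in>UNIV. x l ^ j l / fact (j l)) * y ^ (\<Sum>l\<in>UNIV. j l) =
       (\<Prod>l\<in>UNIV. (y * x l) ^ j l / fact (j l))" for j
      by (simp add: power_sum prod.distrib [symmetric] power_mult_distrib mult_ac)
    thus "((\<lambda>j. (\<Prod>l\<in>UNIV. x l ^ j l / fact (j l)) * y ^ (\<Sum>l\<in>UNIV. j l)) has_sum exp (\<Sum>l\<in>UNIV. y * x l)) UNIV"
      using has_sum_exp_multi[of "\<lambda>l. y * x l"] by simp
    show "((\<lambda>s. (\<Sum>l\<in>UNIV. x l) ^ s / fact s * y ^ s) has_sum exp (\<Sum>l\<in>UNIV. y * x l)) UNIV"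
      using has_sum_exp[of "y * (\<Sum>l\<in>UNIV. x l)"]
      by (simp add: power_mult_distrib sum_distrib_left [symmetric] mult_ac)
  qed
  thus ?thesis by simp
qed

section \<open>Series of exponentials\<close>

text \<open>The modulus depends only on the imaginary part of \<open>w\<close>, and monotonically;
  on the disc it is therefore largest at the top or at the bottom point, according to the sign of
  \<open>n\<close>.\<close>

lemma norm_ee_le_vertical:
  fixes n :: real
  assumes "norm (w - w0) \<le> r"
  shows "norm (ee (of_real n * w)) \<le> norm (ee (of_real n * (w0 + \<i> * of_real r))) + norm (ee (of_real n * (w0 - \<i> * of_real r)))"
proof -
  have "\<bar>Im (w - w0)\<bar> \<le> r" using abs_Im_le_cmod assms by (rule order_trans)
  hence r: "Im w \<le> Im w0 + r" "Im w0 - r \<le> Im w" by (auto simp: abs_le_iff)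
  have "- (n * Im w) \<le> - (n * (Im w0 + r)) \<or> - (n * Im w) \<le> - (n * (Im w0 - r))"
    using r by (cases "n \<ge> 0") (auto intro: mult_left_mono mult_left_mono_neg simp del: distrib_left)
  hence "exp (- (2 * pi * (n * Im w))) \<le> exp (- (2 * pi * (n * (Im w0 + r)))) \<or>
         exp (- (2 * pi * (n * Im w))) \<le> exp (- (2 * pi * (n * (Im w0 - r))))"
    by (auto simp: mult_le_cancel_left)
  moreover have "exp (- (2 * pi * (n * (Im w0 + r)))) > 0" "exp (- (2 * pi * (n * (Im w0 - r)))) > 0"
    by auto
  ultimately have "exp (- (2 * pi * (n * Im w))) \<le> exp (- (2 * pi * (n * (Im w0 + r)))) + exp (- (2 * pi * (n * (Im w0 - r))))"
    by linarith
  thus ?thesis unfolding norm_ee by simp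
qed

lemma ee_has_field_derivative:
  "((\<lambda>w. a * ee (of_real n * w)) has_field_derivative (2 * of_real pi * \<i> * of_real n * a * ee (of_real n * w))) (at w)"
  unfolding ee_def by (auto intro!: derivative_eq_intros simp: mult_ac)

text \<open>The values at the top and the bottom of a closed disc majorise every term on it, so the
  M-test turns pointwise summability into uniform convergence, under which holomorphic functions may
  be differentiated termwise.\<close>

lemma exp_series_termwise_deriv:
  fixes n :: "'i \<Rightarrow> real" and a :: "'i \<Rightarrow> complex"
  assumes "open U" "w0 \<in> U"
    and sum: "\<And>w. w \<in> U \<Longrightarrow> ((\<lambda>i. a i * ee (of_real (n i) * w)) has_sum f w) I"
  shows "\<exists>D. (f has_field_derivative D) (at w0) \<and>
     ((\<lambda>i. 2 * of_real pi * \<i> * of_real (n i) * a i * ee (of_real (n i) * w0)) has_sum D) I"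
proof -
  obtain r where r: "r > 0" "cball w0 r \<subseteq> U" using assms open_contains_cball by blast
  define M where "M i = norm (a i * ee (of_real (n i) * (w0 + \<i> * of_real r))) + norm (a i * ee (of_real (n i) * (w0 - \<i> * of_real r)))" for i
  have "w0 + \<i> * of_real r \<in> cball w0 r" "w0 - \<i> * of_real r \<in> cball w0 r"
    using r by (auto simp: dist_norm norm_mult)
  hence M: "M summable_on I"
    unfolding M_def using r sum has_sum_imp_abs_summable by (intro summable_on_add) blast+
  define g where "g F w = (\<Sum>i\<in>F. a i * ee (of_real (n i) * w))" for F w
  define g' where "g' F w = (\<Sum>i\<in>F. 2 * of_real pi * \<i> * of_real (n i) * a i * ee (of_real (n i) * w))" for F w
  have g': "(g F has_field_derivative g' F w) (at w)" for F w
    unfolding g_def g'_def by (intro DERIV_sum ee_has_field_derivative)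
  have "uniform_limit (cball w0 r) g f (finite_subsets_at_top I)"
    unfolding g_def
  proof (rule Weierstrass_m_test_general' [OF _ _ M])
    fix i w assume w: "w \<in> cball w0 r"
    hence "norm (w - w0) \<le> r" by (simp add: dist_norm norm_minus_commute)
    thus "norm (a i * ee (of_real (n i) * w)) \<le> M i"
      using mult_left_mono [OF norm_ee_le_vertical norm_ge_zero [of "a i"]]
      unfolding M_def norm_mult distrib_left [symmetric] by blast
  qed (use sum r in blast)
  then obtain D where "\<And>w. w \<in> ball w0 r \<Longrightarrow> (f has_field_derivative D w) (at w) \<and> ((\<lambda>F. g' F w) \<longlongrightarrow> D w) (finite_subsets_at_top I)"
  proof (rule has_complex_derivative_uniform_limit [where f' = g', rotated, OF _ _ \<open>r > 0\<close>])
    show "\<forall>\<^sub>F F in finite_subsets_at_top I. continuous_on (cball w0 r) (g F) \<and>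
       (\<forall>w\<in>ball w0 r. (g F has_field_derivative g' F w) (at w))"
      using g' by (intro always_eventually allI conjI ballI DERIV_continuous_on)
        (auto intro: has_field_derivative_at_within)
  qed auto
  hence "(f has_field_derivative D w0) (at w0)" "((\<lambda>F. g' F w0) \<longlongrightarrow> D w0) (finite_subsets_at_top I)"
    using r by auto
  thus ?thesis unfolding g'_def has_sum_def by blast
qed

lemma exp_series_higher_deriv:
  fixes n :: "'i \<Rightarrow> real" and a :: "'i \<Rightarrow> complex"
  assumes U: "open U"
    and sum: "\<And>w. w \<in> U \<Longrightarrow> ((\<lambda>i. a i * ee (of_real (n i) * w)) has_sum f w) I"
    and w: "w \<in> U"
  shows "((\<lambda>i. (2 * of_real pi * \<i> * of_real (n i)) ^ \<nu> * a i * ee (of_real (n i) * w)) has_sum (deriv ^^ \<nu>) f w) I"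
  using w
proof (induction \<nu> arbitrary: w)
  case (Suc \<nu>)
  obtain D where D: "((deriv ^^ \<nu>) f has_field_derivative D) (at w)"
     "((\<lambda>i. 2 * of_real pi * \<i> * of_real (n i) * ((2 * of_real pi * \<i> * of_real (n i)) ^ \<nu> * a i) * ee (of_real (n i) * w)) has_sum D) I"
    using exp_series_termwise_deriv [OF U Suc.prems Suc.IH] by blast
  moreover from D(1) have "(deriv ^^ Suc \<nu>) f w = D" by (simp add: DERIV_imp_deriv)
  ultimately show ?case by (simp add: mult_ac)
qed (use sum in simp)

lemma exp_series_holomorphic:
  fixes n :: "'i \<Rightarrow> real" and a :: "'i \<Rightarrow> complex"
  assumes U: "open U"
    and sum: "\<And>w. w \<in> U \<Longrightarrow> ((\<lambda>i. a i * ee (of_real (n i) * w)) has_sum f w) I"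
  shows "f holomorphic_on U"
  using exp_series_termwise_deriv [OF U _ sum] U holomorphic_on_open by blast

lemma open_Hset: "open Hset"
  unfolding Hset_def by (rule open_halfspace_Im_gt)

text \<open>The sign vector of \<open>x\<close> is one of the \<open>\<sigma>\<close>, and its
  summand is already the left-hand side.\<close>

lemma exp_abs_le_sum_signs:
  fixes x :: "'n::finite \<Rightarrow> real"
  shows "exp (\<Sum>l\<in>UNIV. \<bar>x l\<bar>) \<le> (\<Sum>\<sigma>\<in>PiE UNIV (\<lambda>_. {1,-1}). exp (\<Sum>l\<in>UNIV. \<sigma> l * x l))"
proof -
  have "exp (\<Sum>l\<in>UNIV. \<bar>x l\<bar>) = exp (\<Sum>l\<in>UNIV. (if x l \<ge> 0 then 1 else -1) * x l)"
    by (intro arg_cong[where f=exp] sum.cong) auto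
  also have "\<dots> \<le> (\<Sum>\<sigma>\<in>PiE UNIV (\<lambda>_. {1,-1}). exp (\<Sum>l\<in>UNIV. \<sigma> l * x l))"
    by (rule member_le_sum [where f = "\<lambda>\<sigma>. exp (\<Sum>l\<in>UNIV. \<sigma> l * x l)"]) (auto intro!: finite_PiE)
  finally show ?thesis .
qed

lemma summable_on_finite_sum:
  fixes f :: "'b \<Rightarrow> 'a \<Rightarrow> real"
  assumes "\<And>s. s \<in> S \<Longrightarrow> f s summable_on A"
  shows "(\<lambda>x. \<Sum>s\<in>S. f s x) summable_on A"
  using assms by (induction S rule: infinite_finite_induct) (auto intro: summable_on_add)

text \<open>The values of the series at finitely many purely imaginary points, one for each sign
  vector, dominate the exponential of the weighted sum of absolute frequencies.\<close>

lemma exp_series_abs_majorant: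
  fixes a :: "'i \<Rightarrow> complex" and b :: "'i \<Rightarrow> 'n::finite \<Rightarrow> real"
  assumes "\<And>z::'n \<Rightarrow> complex. (\<lambda>i. a i * ee (\<Sum>l\<in>UNIV. z l * of_real (b i l))) summable_on I"
  shows "(\<lambda>i. norm (a i) * exp (\<Sum>l\<in>UNIV. R l * \<bar>b i l\<bar>)) summable_on I"
proof (rule summable_on_comparison_test)
  let ?S = "PiE UNIV (\<lambda>_::'n. {1,-1::real})"
  show "(\<lambda>i. \<Sum>\<sigma>\<in>?S. norm (a i) * exp (\<Sum>l\<in>UNIV. \<sigma> l * (\<bar>R l\<bar> * b i l))) summable_on I"
  proof (rule summable_on_finite_sum)
    fix \<sigma> :: "'n \<Rightarrow> real"
    \<comment> \<open>The division by 2 pi makes the modulus of \<open>ee\<close> equal to the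
      exponential of the signed sum.\<close>
    have "(\<lambda>i. norm (a i * ee (\<Sum>l\<in>UNIV. (- \<i> * of_real (\<sigma> l * \<bar>R l\<bar> / (2 * pi))) * of_real (b i l)))) summable_on I"
      by (rule summable_on_iff_abs_summable_on_complex [THEN iffD1]) (rule assms)
    thus "(\<lambda>i. norm (a i) * exp (\<Sum>l\<in>UNIV. \<sigma> l * (\<bar>R l\<bar> * b i l))) summable_on I"
      by (simp add: norm_mult norm_ee sum_negf sum_distrib_left mult_ac)
  qed
  fix i
  have "exp (\<Sum>l\<in>UNIV. R l * \<bar>b i l\<bar>) \<le> exp (\<Sum>l\<in>UNIV. \<bar>\<bar>R l\<bar> * b i l\<bar>)"
    by (auto simp: abs_mult intro!: sum_mono mult_right_mono)
  also have "\<dots> \<le> (\<Sum>\<sigma>\<in>?S. exp (\<Sum>l\<in>UNIV. \<sigma> l * (\<bar>R l\<bar> * b i l)))"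
    by (rule exp_abs_le_sum_signs)
  finally show "norm (a i) * exp (\<Sum>l\<in>UNIV. R l * \<bar>b i l\<bar>) \<le> (\<Sum>\<sigma>\<in>?S. norm (a i) * exp (\<Sum>l\<in>UNIV. \<sigma> l * (\<bar>R l\<bar> * b i l)))"
    unfolding sum_distrib_left [symmetric] by (intro mult_left_mono) auto
qed auto

text \<open>The coefficient of z^j in the Taylor expansion of e(\<Sum> z_l x_l).\<close>

definition mono_fact :: "('n::finite \<Rightarrow> nat) \<Rightarrow> ('n \<Rightarrow> real) \<Rightarrow> complex" where
  "mono_fact j x = (\<Prod>l\<in>UNIV. (2 * of_real pi * \<i> * of_real (x l)) ^ j l / fact (j l))"

lemma norm_mono_fact_le: "norm (mono_fact j x) \<le> exp (\<Sum>l\<in>UNIV. 2 * pi * \<bar>x l\<bar>)"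
proof -
  have "norm (mono_fact j x) = (\<Prod>l\<in>UNIV. (2 * pi * \<bar>x l\<bar>) ^ j l / fact (j l))"
    by (simp add: mono_fact_def prod_norm [symmetric] norm_divide norm_power norm_mult)
  also have "\<dots> \<le> (\<Prod>l\<in>UNIV. exp (2 * pi * \<bar>x l\<bar>))"
  proof (intro prod_mono conjI)
    fix l
    have "((\<lambda>m. (2 * pi * \<bar>x l\<bar>) ^ m / fact m) sums exp (2 * pi * \<bar>x l\<bar>))"
      using exp_converges[of "2 * pi * \<bar>x l\<bar>"] by (simp add: field_simps)
    thus "(2 * pi * \<bar>x l\<bar>) ^ j l / fact (j l) \<le> exp (2 * pi * \<bar>x l\<bar>)"
      using sum_le_suminf[of "\<lambda>m. (2 * pi * \<bar>x l\<bar>) ^ m / fact m" "{j l}"] by (auto simp: sums_iff)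
  qed auto
  finally show ?thesis by (simp add: exp_sum)
qed

text \<open>Each exponential is expanded and the two summations are exchanged. The double family is
  absolutely summable because the inner sums of norms are exponentials of \<Sum> 2 pi |z_l| |b_l|,
  which \<open>exp_series_abs_majorant\<close> controls.\<close>

lemma exp_series_taylor:
  fixes a :: "'i \<Rightarrow> complex" and b :: "'i \<Rightarrow> 'n::finite \<Rightarrow> real"
  assumes sum: "\<And>z::'n \<Rightarrow> complex. ((\<lambda>i. a i * ee (\<Sum>l\<in>UNIV. z l * of_real (b i l))) has_sum f z) I"
  shows "(\<lambda>i. a i * mono_fact j (b i)) summable_on I"
    and "((\<lambda>j. (\<Prod>l\<in>UNIV. z l ^ j l) * (\<Sum>\<^sub>\<infinity>i\<in>I. a i * mono_fact j (b i))) has_sum f z) UNIV"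
proof -
  have maj: "(\<lambda>i. norm (a i) * exp (\<Sum>l\<in>UNIV. R l * \<bar>b i l\<bar>)) summable_on I" for R
    by (rule exp_series_abs_majorant) (use sum has_sum_imp_summable in blast)
  show s1: "(\<lambda>i. a i * mono_fact j (b i)) summable_on I" for j
    by (rule abs_summable_summable, rule summable_on_comparison_test [OF maj [of "\<lambda>_. 2 * pi"]])
       (auto simp: norm_mult intro!: mult_left_mono norm_mono_fact_le)
  let ?T = "\<lambda>i j. a i * (\<Prod>l\<in>UNIV. (z l * (2 * of_real pi * \<i> * of_real (b i l))) ^ j l / fact (j l))"
  have inner: "(?T i has_sum (a i * ee (\<Sum>l\<in>UNIV. z l * of_real (b i l)))) UNIV" for i
    using has_sum_cmult_right [OF has_sum_exp_multi [of "\<lambda>l. z l * (2 * of_real pi * \<i> * of_real (b i l))"], of "a i"]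
    by (simp add: ee_def sum_distrib_left mult_ac)
  have "(\<lambda>(i, j). norm (?T i j)) summable_on I \<times> UNIV"
  proof (rule summable_on_SigmaI)
    show "((\<lambda>j. case (i, j) of (i, j) \<Rightarrow> norm (?T i j)) has_sum
        norm (a i) * exp (\<Sum>l\<in>UNIV. (2 * pi * norm (z l)) * \<bar>b i l\<bar>)) UNIV" for i
    proof -
      have "((\<lambda>j. complex_of_real (norm (a i)) * (\<Prod>l\<in>UNIV. of_real (2 * pi * norm (z l) * \<bar>b i l\<bar>) ^ j l / fact (j l))) has_sum
         (of_real (norm (a i)) * exp (\<Sum>l\<in>UNIV. of_real (2 * pi * norm (z l) * \<bar>b i l\<bar>)))) UNIV"
        by (intro has_sum_cmult_right has_sum_exp_multi)
      also have "of_real (norm (a i)) * exp (\<Sum>l\<in>UNIV. of_real (2 * pi * norm (z l) * \<bar>b i l\<bar>)) =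
         complex_of_real (norm (a i) * exp (\<Sum>l\<in>UNIV. (2 * pi * norm (z l)) * \<bar>b i l\<bar>))"
        by (simp only: of_real_sum [symmetric] exp_of_real of_real_mult [of "norm (a i)"])
      also have "(\<lambda>j. complex_of_real (norm (a i)) * (\<Prod>l\<in>UNIV. of_real (2 * pi * norm (z l) * \<bar>b i l\<bar>) ^ j l / fact (j l))) =
         (\<lambda>j. of_real (norm (?T i j)))"
      proof
        fix j
        have "norm (\<Prod>l\<in>UNIV. (z l * (2 * of_real pi * \<i> * of_real (b i l))) ^ j l / fact (j l)) =
          (\<Prod>l\<in>UNIV. (2 * pi * norm (z l) * \<bar>b i l\<bar>) ^ j l / fact (j l))"
          unfolding prod_norm [symmetric] by (intro prod.cong) (auto simp: norm_mult norm_power norm_divide mult_ac)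
        thus "complex_of_real (norm (a i)) * (\<Prod>l\<in>UNIV. of_real (2 * pi * norm (z l) * \<bar>b i l\<bar>) ^ j l / fact (j l)) = of_real (norm (?T i j))"
          unfolding norm_mult [of "a i"] by simp
      qed
      finally show ?thesis by (simp only: has_sum_of_real_iff prod.case)
    qed
  qed (rule maj, simp only: prod.case norm_ge_zero)
  hence abs: "(\<lambda>(i, j). ?T i j) summable_on I \<times> UNIV"
    by - (rule abs_summable_summable, simp only: case_prod_unfold)
  have "((\<lambda>(i, j). ?T i j) has_sum f z) (I \<times> UNIV)"
    by (rule has_sum_SigmaI [OF _ sum abs]) (simp only: prod.case inner)
  hence "((\<lambda>(j, i). ?T i j) has_sum f z) (UNIV \<times> I)"
    by (subst has_sum_swap) (simp only: case_prod_unfold fst_conv snd_conv prod.collapse)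
  thus "((\<lambda>j. (\<Prod>l\<in>UNIV. z l ^ j l) * (\<Sum>\<^sub>\<infinity>i\<in>I. a i * mono_fact j (b i))) has_sum f z) UNIV"
  proof (rule has_sum_SigmaD)
    fix j :: "'n \<Rightarrow> nat"
    have "((\<lambda>i. (\<Prod>l\<in>UNIV. z l ^ j l) * (a i * mono_fact j (b i))) has_sum
       ((\<Prod>l\<in>UNIV. z l ^ j l) * (\<Sum>\<^sub>\<infinity>i\<in>I. a i * mono_fact j (b i)))) I"
      by (intro has_sum_cmult_right has_sum_infsum s1)
    moreover have "(\<Prod>l\<in>UNIV. z l ^ j l) * (a i * mono_fact j (b i)) = ?T i j" for i
    proof -
      have "(\<Prod>l\<in>UNIV. (z l * (2 * of_real pi * \<i> * of_real (b i l))) ^ j l / fact (j l)) =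
        (\<Prod>l\<in>UNIV. z l ^ j l) * mono_fact j (b i)"
        unfolding mono_fact_def prod.distrib [symmetric] by (simp add: power_mult_distrib mult_ac)
      thus ?thesis by (simp add: mult_ac)
    qed
    ultimately show "((\<lambda>i. case (j, i) of (j, i) \<Rightarrow> ?T i j) has_sum
       ((\<Prod>l\<in>UNIV. z l ^ j l) * (\<Sum>\<^sub>\<infinity>i\<in>I. a i * mono_fact j (b i)))) I"
      by (simp only: prod.case)
  qed
qed

section \<open>Taylor coefficients of Jacobi-type expansions\<close>

lemma bilinear_expand_axis:
  fixes B :: "real^'n \<Rightarrow> real^'n \<Rightarrow> real"
  assumes "bilinear B"
  shows "B v w = (\<Sum>i\<in>UNIV. \<Sum>j\<in>UNIV. v $ i * w $ j * B (axis i 1) (axis j 1))"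
proof -
  have "B v w = B (\<Sum>i\<in>UNIV. (v $ i) *\<^sub>R axis i 1) (\<Sum>j\<in>UNIV. (w $ j) *\<^sub>R axis j 1)"
    using basis_expansion[of v] basis_expansion[of w] by (simp add: scalar_mult_eq_scaleR)
  also have "\<dots> = (\<Sum>(i, j)\<in>UNIV \<times> UNIV. B ((v $ i) *\<^sub>R axis i 1) ((w $ j) *\<^sub>R axis j 1))"
    by (rule bilinear_sum[OF assms])
  also have "\<dots> = (\<Sum>i\<in>UNIV. \<Sum>j\<in>UNIV. v $ i * w $ j * B (axis i 1) (axis j 1))"
    unfolding sum.cartesian_product [symmetric]
    by (simp add: bilinear_lmul[OF assms] bilinear_rmul[OF assms] mult_ac)
  finally show ?thesis .
qed

text \<open>In the coordinates of the basis a Jacobi expansion thus becomes a series of exponentials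
  with real frequencies B(t, e_l).\<close>

lemma Bc_coordv:
  assumes "bilinear B"
  shows "Bc B (cvec t) (coordv e z) = (\<Sum>l\<in>UNIV. z $ l * of_real (B t (e l)))"
proof -
  have "(\<Sum>l\<in>UNIV. z $ l * of_real (B t (e l))) =
     (\<Sum>l\<in>UNIV. \<Sum>i\<in>UNIV. \<Sum>j\<in>UNIV. z $ l * (of_real (t $ i) * of_real (e l $ j) * of_real (B (axis i 1) (axis j 1))))"
    by (subst bilinear_expand_axis[OF assms]) (simp add: sum_distrib_left)
  also have "\<dots> = (\<Sum>i\<in>UNIV. \<Sum>j\<in>UNIV. \<Sum>l\<in>UNIV. z $ l * (of_real (t $ i) * of_real (e l $ j) * of_real (B (axis i 1) (axis j 1))))"
    by (subst sum.swap, rule sum.cong[OF refl], rule sum.swap)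
  also have "\<dots> = Bc B (cvec t) (coordv e z)"
    unfolding Bc_def cvec_def coordv_def by (simp add: sum_distrib_left sum_distrib_right mult_ac)
  finally show ?thesis ..
qed

lemma Qc_coordv:
  assumes "bilinear B"
  shows "Qc B (coordv e z) = (\<Sum>i\<in>UNIV. \<Sum>j\<in>UNIV. z $ i * z $ j * of_real (B (e i) (e j))) / 2"
proof -
  have cv: "coordv e z = (\<Sum>i\<in>UNIV. z $ i *s cvec (e i))"
    by (simp add: vec_eq_iff coordv_def cvec_def)
  have "Bc B (coordv e z) w = (\<Sum>i\<in>UNIV. z $ i * Bc B (cvec (e i)) w)" for w
  proof -
    have "Bc B (coordv e z) w = (\<Sum>a\<in>UNIV. \<Sum>b\<in>UNIV. \<Sum>i\<in>UNIV. z $ i * (of_real (e i $ a) * w $ b * of_real (B (axis a 1) (axis b 1))))"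
      unfolding Bc_def coordv_def by (simp add: sum_distrib_left sum_distrib_right mult_ac)
    also have "\<dots> = (\<Sum>i\<in>UNIV. \<Sum>a\<in>UNIV. \<Sum>b\<in>UNIV. z $ i * (of_real (e i $ a) * w $ b * of_real (B (axis a 1) (axis b 1))))"
      by (subst (2) sum.swap, subst sum.swap, rule refl)
    finally show ?thesis unfolding Bc_def cvec_def by (simp add: sum_distrib_left)
  qed
  thus ?thesis unfolding Qc_def by (simp add: Bc_coordv[OF assms] sum_distrib_left mult_ac)
qed

lemma coordv_scale: "coordv e (c *s z) = c *s coordv e z"
  by (simp add: vec_eq_iff coordv_def sum_distrib_left mult_ac)

lemma has_sum_vec_nth:
  fixes f :: "'a \<Rightarrow> complex^'m"
  shows "(f has_sum s) A \<longleftrightarrow> (\<forall>m. ((\<lambda>x. f x $ m) has_sum s $ m) A)"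
proof
  assume "(f has_sum s) A"
  thus "\<forall>m. ((\<lambda>x. f x $ m) has_sum s $ m) A"
    using has_sum_bounded_linear [OF bounded_linear_vec_nth] by blast
next
  assume "\<forall>m. ((\<lambda>x. f x $ m) has_sum s $ m) A"
  thus "(f has_sum s) A"
    unfolding has_sum_def by (intro vec_tendstoI) simp
qed

text \<open>Pointwise summability is what the lemmas on exponential series take as input, and a free
  index set lets expansions with different denominators be moved to a common one.\<close>

definition jseries :: "(real^'n \<Rightarrow> real^'n \<Rightarrow> real) \<Rightarrow> (real \<times> (real^'n)) set \<Rightarrow>
     (real \<times> (real^'n) \<Rightarrow> complex^'m) \<Rightarrow> (complex \<Rightarrow> complex^'n \<Rightarrow> complex^'m) \<Rightarrow> bool" where
  "jseries B J c f \<longleftrightarrow> (\<forall>\<tau>\<in>Hset. \<forall>z. (jterm B c \<tau> z has_sum f \<tau> z) J)"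

lemma jseries_component:
  assumes "bilinear B" "jseries B J c f" "\<tau> \<in> Hset"
  shows "((\<lambda>nt. (c nt $ m * ee (of_real (fst nt) * \<tau>)) * ee (\<Sum>l\<in>UNIV. z $ l * of_real (B (snd nt) (e l))))
    has_sum f \<tau> (coordv e z) $ m) J"
proof -
  have "(jterm B c \<tau> (coordv e z) has_sum f \<tau> (coordv e z)) J"
    using assms by (auto simp: jseries_def)
  thus ?thesis unfolding has_sum_vec_nth jterm_def by (simp add: Bc_coordv[OF assms(1)] mult_ac)
qed

text \<open>\<open>taylor_coeffs\<close> is a definite description with an unspecified radius; two
  candidates agree since both series converge to \<open>f\<close> on the smaller polydisc.\<close>

lemma taylor_coeffs_eqI:
  fixes f :: "complex \<Rightarrow> complex^'n \<Rightarrow> complex^'m"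
  assumes "r > 0" "\<And>z. (\<forall>i. norm (z $ i) < r) \<Longrightarrow>
      ((\<lambda>j. (\<Prod>i\<in>UNIV. (z $ i) ^ j i) *s h j) has_sum f \<tau> (coordv e z)) UNIV"
  shows "taylor_coeffs e f \<tau> = h"
  unfolding taylor_coeffs_def
proof (rule the_equality)
  show "\<exists>r>0. \<forall>z. (\<forall>i. norm (z $ i) < r) \<longrightarrow>
      ((\<lambda>j. (\<Prod>i\<in>UNIV. (z $ i) ^ j i) *s h j) has_sum f \<tau> (coordv e z)) UNIV"
    using assms by blast
next
  fix h'
  assume "\<exists>r>0. \<forall>z. (\<forall>i. norm (z $ i) < r) \<longrightarrow>
      ((\<lambda>j. (\<Prod>i\<in>UNIV. (z $ i) ^ j i) *s h' j) has_sum f \<tau> (coordv e z)) UNIV"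
  then obtain r' where r': "r' > 0" "\<And>z. (\<forall>i. norm (z $ i) < r') \<Longrightarrow>
      ((\<lambda>j. (\<Prod>i\<in>UNIV. (z $ i) ^ j i) *s h' j) has_sum f \<tau> (coordv e z)) UNIV" by blast
  have "h' j $ m - h j $ m = 0" for j m
  proof (rule power_series_coeff_eq_0 [where r = "min r r'" and h = "\<lambda>j. h' j $ m - h j $ m"])
    fix z :: "'n \<Rightarrow> complex" assume z: "\<And>i. norm (z i) < min r r'"
    have "((\<lambda>j. (\<Prod>i\<in>UNIV. z i ^ j i) * h j $ m) has_sum f \<tau> (coordv e (\<chi> i. z i)) $ m) UNIV"
         "((\<lambda>j. (\<Prod>i\<in>UNIV. z i ^ j i) * h' j $ m) has_sum f \<tau> (coordv e (\<chi> i. z i)) $ m) UNIV"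
      using assms(2)[of "\<chi> i. z i"] r'(2)[of "\<chi> i. z i"] z by (simp_all add: has_sum_vec_nth)
    from has_sum_minus [OF this(2,1)]
    show "((\<lambda>j. (\<Prod>i\<in>UNIV. z i ^ j i) * (h' j $ m - h j $ m)) has_sum 0) UNIV"
      by (simp add: algebra_simps)
  qed (use assms r' in auto)
  thus "h' = h" by (simp add: fun_eq_iff vec_eq_iff)
qed

lemma taylor_coeffs_jseries:
  fixes f :: "complex \<Rightarrow> complex^'n \<Rightarrow> complex^'m"
  assumes B: "bilinear B" and s: "jseries B J c f" and \<tau>: "\<tau> \<in> Hset"
  shows "((\<lambda>nt. mono_fact j (\<lambda>l. B (snd nt) (e l)) * c nt $ m * ee (of_real (fst nt) * \<tau>))
           has_sum taylor_coeffs e f \<tau> j $ m) J" (is ?th1)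
    and "((\<lambda>j. (\<Prod>i\<in>UNIV. z i ^ j i) * taylor_coeffs e f \<tau> j $ m) has_sum f \<tau> (coordv e (\<chi> i. z i)) $ m) UNIV"
proof -
  define h :: "('n \<Rightarrow> nat) \<Rightarrow> complex^'m" where
    "h j = (\<chi> m. \<Sum>\<^sub>\<infinity>nt\<in>J. (c nt $ m * ee (of_real (fst nt) * \<tau>)) * mono_fact j (\<lambda>l. B (snd nt) (e l)))" for j
  have sm: "((\<lambda>nt. (c nt $ m * ee (of_real (fst nt) * \<tau>)) * ee (\<Sum>l\<in>UNIV. z l * of_real (B (snd nt) (e l))))
    has_sum f \<tau> (coordv e (\<chi> i. z i)) $ m) J" for z m
    using jseries_component [OF B s \<tau>, of m "\<chi> i. z i" e] by simp
  note T = exp_series_taylor [of "\<lambda>nt. c nt $ m * ee (of_real (fst nt) * \<tau>)" for m, OF sm]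
  have T2: "((\<lambda>j. (\<Prod>i\<in>UNIV. z i ^ j i) * h j $ m) has_sum f \<tau> (coordv e (\<chi> i. z i)) $ m) UNIV" for z m
    using T(2)[of z m] by (simp add: h_def)
  have tc: "taylor_coeffs e f \<tau> = h"
  proof (rule taylor_coeffs_eqI [of 1])
    fix z :: "complex^'n"
    have "(\<chi> i. z $ i) = z" by simp
    thus "((\<lambda>j. (\<Prod>i\<in>UNIV. (z $ i) ^ j i) *s h j) has_sum f \<tau> (coordv e z)) UNIV"
      using T2 [of "\<lambda>i. z $ i"] by (simp add: has_sum_vec_nth)
  qed auto
  show "((\<lambda>j. (\<Prod>i\<in>UNIV. z i ^ j i) * taylor_coeffs e f \<tau> j $ m) has_sum f \<tau> (coordv e (\<chi> i. z i)) $ m) UNIV"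
    using T2 by (simp add: tc)
  show ?th1
    using has_sum_infsum [OF T(1)[of m j]] unfolding tc h_def by (simp add: mult_ac)
qed

lemma deriv_taylor_jseries:
  fixes f :: "complex \<Rightarrow> complex^'n \<Rightarrow> complex^'m"
  assumes B: "bilinear B" and s: "jseries B J c f" and \<tau>: "\<tau> \<in> Hset"
  shows "((\<lambda>nt. (2 * of_real pi * \<i> * of_real (fst nt)) ^ \<nu> * (mono_fact j (\<lambda>l. B (snd nt) (e l)) * c nt $ m) *
        ee (of_real (fst nt) * \<tau>)) has_sum (deriv ^^ \<nu>) (\<lambda>\<tau>. taylor_coeffs e f \<tau> j $ m) \<tau>) J"
  using taylor_coeffs_jseries(1)[OF B s] by (intro exp_series_higher_deriv [OF open_Hset _ \<tau>]) auto

lemma taylor_jseries_holomorphic: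
  fixes f :: "complex \<Rightarrow> complex^'n \<Rightarrow> complex^'m"
  assumes B: "bilinear B" and s: "jseries B J c f"
  shows "(\<lambda>\<tau>. taylor_coeffs e f \<tau> j $ m) holomorphic_on Hset"
  by (rule exp_series_holomorphic [OF open_Hset]) (rule taylor_coeffs_jseries(1)[OF B s])

lemma vderiv_funpow_nth: "(vderiv ^^ \<nu>) h \<tau> $ m = (deriv ^^ \<nu>) (\<lambda>t. h t $ m) \<tau>"
proof (induction \<nu> arbitrary: \<tau>)
  case (Suc \<nu>)
  have "(\<lambda>t. (vderiv ^^ \<nu>) h t $ m) = (deriv ^^ \<nu>) (\<lambda>t. h t $ m)"
    by (rule ext) (rule Suc)
  thus ?case by (simp add: vderiv_def [of "(vderiv ^^ \<nu>) h"])
qed simp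

lemma deriv_funpow_zero [simp]: "(deriv ^^ \<nu>) (\<lambda>t. 0) = (\<lambda>t. 0::complex)"
  by (induction \<nu>) (auto simp: fun_eq_iff)

definition gram_coeff :: "(real^'n \<Rightarrow> real^'n \<Rightarrow> real) \<Rightarrow> ('n \<Rightarrow> real^'n) \<Rightarrow> ('n \<Rightarrow> 'n \<Rightarrow> nat) \<Rightarrow> complex" where
  "gram_coeff B e \<Lambda> = (\<Prod>i\<in>UNIV. \<Prod>j\<in>UNIV. (- of_real pi * \<i> * of_real (B (e i) (e j))) ^ \<Lambda> i j / fact (\<Lambda> i j))"

text \<open>The product of the k + m in the operator as a rising factorial. It has [s/2] - \<nu>
  factors because [s/2] + [(s-1)/2] = s - 1, which also holds at s = 0, where the lower end is
  -1.\<close>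

definition Dweight :: "real \<Rightarrow> nat \<Rightarrow> nat \<Rightarrow> complex" where
  "Dweight k s \<nu> = pochhammer (of_real k + of_int ((int s - 1) div 2)) (s div 2 - \<nu>)"

lemma prod_int_interval_pochhammer:
  "(\<Prod>m\<in>{a..a + int n - 1}. x + of_int m) = pochhammer (x + of_int a :: complex) n"
proof (induction n)
  case (Suc n)
  have "{a..a + int (Suc n) - 1} = insert (a + int n) {a..a + int n - 1}" by auto
  thus ?case using Suc by (simp add: pochhammer_Suc algebra_simps)
qed simp

lemma Dop_component:
  "Dop B e k f p \<tau> $ m = 4 ^ (msum p div 2) * fact (msum p div 2) *
     (\<Sum>\<Lambda> | msumL \<Lambda> \<le> msum p div 2. gram_coeff B e \<Lambda> * Dweight k (msum p) (msumL \<Lambda>) *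
        (if \<forall>i. piL \<Lambda> i \<le> p i then (deriv ^^ msumL \<Lambda>) (\<lambda>\<tau>. taylor_coeffs e f \<tau> (\<lambda>i. p i - piL \<Lambda> i) $ m) \<tau> else 0))"
proof -
  define s where "s = msum p"
  have W: "(\<Prod>m\<in>{(int s - 1) div 2..int s - 2 - int \<nu>}. of_real k + of_int m) = Dweight k s \<nu>" if "\<nu> \<le> s div 2" for \<nu>
  proof -
    have "int s - 2 - int \<nu> = (int s - 1) div 2 + int (s div 2 - \<nu>) - 1"
      using that by presburger
    thus ?thesis unfolding Dweight_def by (simp only: prod_int_interval_pochhammer)
  qed
  have G: "(\<Prod>i\<in>UNIV. \<Prod>j\<in>UNIV. (- of_real pi * \<i> * of_real (B (e i) (e j))) ^ \<Lambda> i j) / of_nat (factL \<Lambda>) = gram_coeff B e \<Lambda>" for \<Lambda>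
    by (simp add: gram_coeff_def factL_def prod_dividef)
  \<comment> \<open>\<open>hcoef\<close> is zero at an index with a negative entry; the guard
    preserves this once the subtraction is the truncated one of natural numbers.\<close>
  have H: "(vderiv ^^ \<nu>) (hcoef e f (\<lambda>i. int (p i) - int (piL \<Lambda> i))) \<tau> $ m =
     (if \<forall>i. piL \<Lambda> i \<le> p i then (deriv ^^ \<nu>) (\<lambda>\<tau>. taylor_coeffs e f \<tau> (\<lambda>i. p i - piL \<Lambda> i) $ m) \<tau> else 0)" for \<nu> \<Lambda>
  proof (cases "\<forall>i. piL \<Lambda> i \<le> p i")
    case True
    have "nat (int (p i) - int (piL \<Lambda> i)) = p i - piL \<Lambda> i" for i by simp
    thus ?thesis using True by (simp add: vderiv_funpow_nth hcoef_def)
  next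
    case False
    hence "\<not> (\<forall>i. int (p i) - int (piL \<Lambda> i) \<ge> 0)" by auto
    thus ?thesis using False by (simp only: vderiv_funpow_nth hcoef_def if_False) simp
  qed
  show ?thesis
    unfolding Dop_def Let_def s_def [symmetric]
    unfolding G vector_smult_component sum_component H by (simp add: W)
qed

section \<open>The generating polynomial of the operators\<close>

definition mon :: "('n::finite \<Rightarrow> complex) \<Rightarrow> ('n \<Rightarrow> nat) \<Rightarrow> complex" where
  "mon u p = (\<Prod>l\<in>UNIV. u l ^ p l)"

lemma mon_add: "mon u (\<lambda>i. p i + q i) = mon u p * mon u q"
  by (simp add: mon_def power_add prod.distrib)

lemma msum_piL: "msum (piL \<Lambda>) = 2 * msumL \<Lambda>"
proof -
  have "(\<Sum>i\<in>UNIV. \<Sum>j\<in>UNIV. \<Lambda> j i) = (\<Sum>i\<in>UNIV. \<Sum>j\<in>UNIV. \<Lambda> i j)" by (rule sum.swap)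
  thus ?thesis by (simp add: msum_def piL_def msumL_def sum.distrib)
qed

lemma mon_piL: "mon u (piL \<Lambda>) = (\<Prod>i\<in>UNIV. \<Prod>j\<in>UNIV. (u i * u j) ^ \<Lambda> i j)"
proof -
  have "(\<Prod>i\<in>UNIV. \<Prod>j\<in>UNIV. u i ^ \<Lambda> j i) = (\<Prod>i\<in>UNIV. \<Prod>j\<in>UNIV. u j ^ \<Lambda> i j)" by (rule prod.swap)
  thus ?thesis by (simp add: mon_def piL_def power_add prod.distrib power_sum power_mult_distrib)
qed

lemma finite_msum_le: "finite {p::'n::finite \<Rightarrow> nat. msum p \<le> s}"
  unfolding msum_def by (rule finite_sum_le_nat)

lemma finite_msum [simp]: "finite {p::'n::finite \<Rightarrow> nat. msum p = s}"
  by (rule finite_subset [OF _ finite_msum_le[of s]]) auto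

lemma msumL_curry: "msumL (curry j) = (\<Sum>x\<in>UNIV. j x)"
  by (simp add: msumL_def sum.cartesian_product curry_def case_prod_unfold)

lemma finite_msumL_le [simp]: "finite {\<Lambda>::'n::finite \<Rightarrow> 'n \<Rightarrow> nat. msumL \<Lambda> \<le> s}"
proof -
  have "{\<Lambda>::'n \<Rightarrow> 'n \<Rightarrow> nat. msumL \<Lambda> \<le> s} \<subseteq> curry ` {j. (\<Sum>x\<in>UNIV. j x) \<le> s}"
  proof
    fix \<Lambda> :: "'n \<Rightarrow> 'n \<Rightarrow> nat" assume "\<Lambda> \<in> {\<Lambda>. msumL \<Lambda> \<le> s}"
    moreover have "\<Lambda> = curry (case_prod \<Lambda>)" by simp
    ultimately show "\<Lambda> \<in> curry ` {j. (\<Sum>x\<in>UNIV. j x) \<le> s}"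
      using msumL_curry[of "case_prod \<Lambda>"] by (intro image_eqI[of _ _ "case_prod \<Lambda>"]) auto
  qed
  thus ?thesis using finite_sum_le_nat finite_subset by blast
qed

lemma sum_gram_coeff:
  fixes u :: "'n::finite \<Rightarrow> complex"
  shows "(\<Sum>\<Lambda> | msumL \<Lambda> = \<nu>. gram_coeff B e \<Lambda> * mon u (piL \<Lambda>)) =
    (\<Sum>i\<in>UNIV. \<Sum>j\<in>UNIV. - of_real pi * \<i> * of_real (B (e i) (e j)) * (u i * u j)) ^ \<nu> / fact \<nu>"
proof -
  let ?x = "\<lambda>(i, j). - of_real pi * \<i> * of_real (B (e i) (e j)) * (u i * u j)"
  have "(\<Sum>\<Lambda> | msumL \<Lambda> = \<nu>. gram_coeff B e \<Lambda> * mon u (piL \<Lambda>)) =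
     (\<Sum>\<Lambda> | msumL \<Lambda> = \<nu>. \<Prod>i\<in>UNIV. \<Prod>j\<in>UNIV. ?x (i, j) ^ \<Lambda> i j / fact (\<Lambda> i j))"
    unfolding gram_coeff_def mon_piL prod.distrib [symmetric]
    by (intro sum.cong prod.cong refl) (simp only: prod.case power_mult_distrib times_divide_eq_left)
  also have "\<dots> = (\<Sum>\<Lambda> | msumL \<Lambda> = \<nu>. \<Prod>x\<in>UNIV. ?x x ^ \<Lambda> (fst x) (snd x) / fact (\<Lambda> (fst x) (snd x)))"
    by (simp add: prod.cartesian_product case_prod_unfold)
  also have "\<dots> = (\<Sum>j | (\<Sum>x\<in>UNIV. j x) = \<nu>. \<Prod>x\<in>UNIV. ?x x ^ j x / fact (j x))"
    by (rule sum.reindex_bij_witness [of _ curry "\<lambda>f (x, y). f x y"])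
       (auto simp: msumL_curry [symmetric] curry_def case_prod_unfold)
  also have "\<dots> = (\<Sum>x\<in>UNIV. ?x x) ^ \<nu> / fact \<nu>"
    by (rule multinomial_fact)
  finally show ?thesis by (simp add: sum.cartesian_product)
qed

lemma higher_deriv_sum_cmult:
  assumes "finite A" "open U" "\<And>q. q \<in> A \<Longrightarrow> H q holomorphic_on U" "\<tau> \<in> U"
  shows "(deriv ^^ \<nu>) (\<lambda>\<tau>. \<Sum>q\<in>A. c q * H q \<tau>) \<tau> = (\<Sum>q\<in>A. c q * (deriv ^^ \<nu>) (H q) \<tau>)"
  using assms(1,3)
proof (induction A rule: finite_induct)
  case (insert x A)
  have "(deriv ^^ \<nu>) (\<lambda>\<tau>. c x * H x \<tau> + (\<Sum>q\<in>A. c q * H q \<tau>)) \<tau> =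
     (deriv ^^ \<nu>) (\<lambda>\<tau>. c x * H x \<tau>) \<tau> + (deriv ^^ \<nu>) (\<lambda>\<tau>. \<Sum>q\<in>A. c q * H q \<tau>) \<tau>"
    using insert assms by (intro higher_deriv_add) (auto intro!: holomorphic_intros)
  also have "(deriv ^^ \<nu>) (\<lambda>\<tau>. c x * H x \<tau>) \<tau> = c x * (deriv ^^ \<nu>) (H x) \<tau>"
    using insert assms by (intro higher_deriv_cmult) auto
  finally show ?case using insert by simp
qed simp

text \<open>Summation over p turns the index shift by \<pi>(\<Lambda>) into the factor
  u^\<pi>(\<Lambda>), and the remaining index q ranges freely over one degree. Only s(\<Lambda>)
  then matters, and the multinomial theorem collects all \<Lambda> with s(\<Lambda>) = \<nu> into a
  power of -2 pi i Q(u).\<close>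

lemma Dop_generating:
  fixes H :: "('n::finite \<Rightarrow> nat) \<Rightarrow> complex \<Rightarrow> complex" and u :: "'n \<Rightarrow> complex"
  assumes H: "\<And>q. H q holomorphic_on Hset" and \<tau>: "\<tau> \<in> Hset"
  shows "(\<Sum>p | msum p = s. mon u p * (\<Sum>\<Lambda> | msumL \<Lambda> \<le> s div 2. gram_coeff B e \<Lambda> * w (msumL \<Lambda>) *
        (if \<forall>i. piL \<Lambda> i \<le> p i then (deriv ^^ msumL \<Lambda>) (H (\<lambda>i. p i - piL \<Lambda> i)) \<tau> else 0))) =
    (\<Sum>\<nu>\<le>s div 2. (\<Sum>i\<in>UNIV. \<Sum>j\<in>UNIV. - of_real pi * \<i> * of_real (B (e i) (e j)) * (u i * u j)) ^ \<nu> / fact \<nu> *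
        w \<nu> * (deriv ^^ \<nu>) (\<lambda>\<tau>. \<Sum>q | msum q = s - 2 * \<nu>. mon u q * H q \<tau>) \<tau>)"
    (is "?L = ?R")
proof -
  have shift: "(\<Sum>p | msum p = s. mon u p * (if \<forall>i. piL \<Lambda> i \<le> p i then X (\<lambda>i. p i - piL \<Lambda> i) else 0)) =
     mon u (piL \<Lambda>) * (\<Sum>q | msum q = s - 2 * msumL \<Lambda>. mon u q * X q)" if "msumL \<Lambda> \<le> s div 2" for \<Lambda> :: "'n \<Rightarrow> 'n \<Rightarrow> nat" and X
  proof -
    have ms: "msum (\<lambda>i. q i + piL \<Lambda> i) = msum q + 2 * msumL \<Lambda>" for q
      using msum_piL[of \<Lambda>] by (simp add: msum_def sum.distrib)
    have "(\<Sum>p | msum p = s. mon u p * (if \<forall>i. piL \<Lambda> i \<le> p i then X (\<lambda>i. p i - piL \<Lambda> i) else 0)) =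
       (\<Sum>p | msum p = s \<and> (\<forall>i. piL \<Lambda> i \<le> p i). mon u p * X (\<lambda>i. p i - piL \<Lambda> i))"
      by (rule sum.mono_neutral_cong_right) auto
    also have "\<dots> = (\<Sum>q | msum q = s - 2 * msumL \<Lambda>. mon u (\<lambda>i. q i + piL \<Lambda> i) * X q)"
    proof (rule sum.reindex_bij_witness [of _ "\<lambda>q i. q i + piL \<Lambda> i" "\<lambda>p i. p i - piL \<Lambda> i"])
      fix p assume p: "p \<in> {p. msum p = s \<and> (\<forall>i. piL \<Lambda> i \<le> p i)}"
      hence eq: "(\<lambda>i. p i - piL \<Lambda> i + piL \<Lambda> i) = p" by auto
      show "(\<lambda>i. p i - piL \<Lambda> i + piL \<Lambda> i) = p" by (rule eq)
      show "(\<lambda>i. p i - piL \<Lambda> i) \<in> {q. msum q = s - 2 * msumL \<Lambda>}"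
        using ms[of "\<lambda>i. p i - piL \<Lambda> i"] p unfolding eq by auto
      show "mon u (\<lambda>i. p i - piL \<Lambda> i + piL \<Lambda> i) * X (\<lambda>i. p i - piL \<Lambda> i) = mon u p * X (\<lambda>i. p i - piL \<Lambda> i)"
        unfolding eq ..
    qed (use that ms in auto)
    finally show ?thesis by (simp add: mon_add sum_distrib_left mult_ac)
  qed
  define A where "A \<nu> = (\<Sum>q | msum q = s - 2 * \<nu>. mon u q * (deriv ^^ \<nu>) (H q) \<tau>)" for \<nu>
  have "?L = (\<Sum>\<Lambda> | msumL \<Lambda> \<le> s div 2. gram_coeff B e \<Lambda> * w (msumL \<Lambda>) *
     (\<Sum>p | msum p = s. mon u p * (if \<forall>i. piL \<Lambda> i \<le> p i then (deriv ^^ msumL \<Lambda>) (H (\<lambda>i. p i - piL \<Lambda> i)) \<tau> else 0)))"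
    unfolding sum_distrib_left by (subst sum.swap) (simp only: mult_ac)
  also have "\<dots> = (\<Sum>\<Lambda> | msumL \<Lambda> \<le> s div 2. gram_coeff B e \<Lambda> * mon u (piL \<Lambda>) * (w (msumL \<Lambda>) * A (msumL \<Lambda>)))"
    by (intro sum.cong refl) (simp add: shift [where X = "\<lambda>q. (deriv ^^ _) (H q) \<tau>"] A_def)
  also have "\<dots> = (\<Sum>\<nu>\<le>s div 2. \<Sum>\<Lambda> | msumL \<Lambda> \<le> s div 2 \<and> msumL \<Lambda> = \<nu>. gram_coeff B e \<Lambda> * mon u (piL \<Lambda>) * (w (msumL \<Lambda>) * A (msumL \<Lambda>)))"
    using sum.group [of "{\<Lambda>::'n \<Rightarrow> 'n \<Rightarrow> nat. msumL \<Lambda> \<le> s div 2}" "{..s div 2}" msumL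
       "\<lambda>\<Lambda>. gram_coeff B e \<Lambda> * mon u (piL \<Lambda>) * (w (msumL \<Lambda>) * A (msumL \<Lambda>))"]
    by (simp add: image_subset_iff)
  also have "\<dots> = (\<Sum>\<nu>\<le>s div 2. (\<Sum>\<Lambda> | msumL \<Lambda> = \<nu>. gram_coeff B e \<Lambda> * mon u (piL \<Lambda>)) * (w \<nu> * A \<nu>))"
  proof (rule sum.cong[OF refl])
    fix \<nu> assume "\<nu> \<in> {..s div 2}"
    hence "{\<Lambda>::'n \<Rightarrow> 'n \<Rightarrow> nat. msumL \<Lambda> \<le> s div 2 \<and> msumL \<Lambda> = \<nu>} = {\<Lambda>. msumL \<Lambda> = \<nu>}" by auto
    thus "(\<Sum>\<Lambda> | msumL \<Lambda> \<le> s div 2 \<and> msumL \<Lambda> = \<nu>. gram_coeff B e \<Lambda> * mon u (piL \<Lambda>) * (w (msumL \<Lambda>) * A (msumL \<Lambda>))) =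
       (\<Sum>\<Lambda> | msumL \<Lambda> = \<nu>. gram_coeff B e \<Lambda> * mon u (piL \<Lambda>)) * (w \<nu> * A \<nu>)"
      unfolding sum_distrib_right by (auto intro: sum.cong)
  qed
  also have "\<dots> = ?R"
  proof (rule sum.cong[OF refl])
    fix \<nu>
    have "A \<nu> = (deriv ^^ \<nu>) (\<lambda>\<tau>. \<Sum>q | msum q = s - 2 * \<nu>. mon u q * H q \<tau>) \<tau>"
      unfolding A_def by (rule higher_deriv_sum_cmult [symmetric, OF finite_msum open_Hset H \<tau>])
    thus "(\<Sum>\<Lambda> | msumL \<Lambda> = \<nu>. gram_coeff B e \<Lambda> * mon u (piL \<Lambda>)) * (w \<nu> * A \<nu>) =
       (\<Sum>i\<in>UNIV. \<Sum>j\<in>UNIV. - of_real pi * \<i> * of_real (B (e i) (e j)) * (u i * u j)) ^ \<nu> / fact \<nu> *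
        w \<nu> * (deriv ^^ \<nu>) (\<lambda>\<tau>. \<Sum>q | msum q = s - 2 * \<nu>. mon u q * H q \<tau>) \<tau>"
      unfolding sum_gram_coeff by simp
  qed
  finally show ?thesis .
qed

text \<open>Brings an identity of generating polynomials, valid for every direction u, back to the
  single operators.\<close>

lemma poly_coeff_unique:
  fixes X :: "('n::finite \<Rightarrow> nat) \<Rightarrow> complex"
  assumes "\<And>u. (\<Sum>p | msum p = s. mon u p * X p) = (\<Sum>p | msum p = s. mon u p * Y p)" "msum q = s"
  shows "X q = Y q"
proof -
  have "(if msum q = s then X q - Y q else 0) = 0"
  proof (rule power_series_coeff_eq_0 [of 1 "\<lambda>p. if msum p = s then X p - Y p else 0"])
    fix z :: "'n \<Rightarrow> complex"
    have "((\<lambda>p. mon z p * (X p - Y p)) has_sum (\<Sum>p | msum p = s. mon z p * (X p - Y p))) {p. msum p = s}"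
      by (intro has_sum_finite) simp
    moreover have "(\<Sum>p | msum p = s. mon z p * (X p - Y p)) = 0"
      using assms(1)[of z] by (simp add: algebra_simps sum_subtractf)
    ultimately have "((\<lambda>p. mon z p * (X p - Y p)) has_sum 0) {p. msum p = s}" by simp
    thus "((\<lambda>j. (\<Prod>i\<in>UNIV. z i ^ j i) * (if msum j = s then X j - Y j else 0)) has_sum 0) UNIV"
      by (rule has_sum_cong_neutral [THEN iffD1, rotated -1]) (auto simp: mon_def)
  qed simp
  thus ?thesis using assms(2) by simp
qed

section \<open>Covariance under the metaplectic group\<close>

lemma pochhammer_backward_diff:
  fixes z :: "'a::comm_ring_1"
  shows "pochhammer z (Suc m) - pochhammer (z - 1) (Suc m) = of_nat (Suc m) * pochhammer z m"
proof -
  have "pochhammer (z - 1) (Suc m) = (z - 1) * pochhammer z m"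
    using pochhammer_rec[of "z - 1" m] by simp
  thus ?thesis by (simp add: pochhammer_Suc algebra_simps)
qed

text \<open>The sum is the N-th backward difference of a polynomial of degree m in z, and each
  difference lowers the degree by one.\<close>

lemma alternating_binomial_pochhammer:
  fixes z :: complex
  shows "m < N \<Longrightarrow> (\<Sum>j\<le>N. (-1) ^ j * of_nat (N choose j) * pochhammer (z - of_nat j) m) = 0"
proof (induction N arbitrary: m z)
  case (Suc N)
  let ?f = "\<lambda>N m z. (\<Sum>j\<le>N. (-1) ^ j * of_nat (N choose j) * pochhammer (z - of_nat j) m) :: complex"
  have rec: "?f (Suc N) m z = ?f N m z - ?f N m (z - 1)"
  proof -
    let ?g = "\<lambda>j. (-1) ^ Suc j * of_nat (N choose Suc j) * pochhammer (z - of_nat (Suc j)) m"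
    have "?f (Suc N) m z = pochhammer z m + (\<Sum>j\<le>N. (-1) ^ Suc j * of_nat (Suc N choose Suc j) * pochhammer (z - of_nat (Suc j)) m)"
      by (subst sum.atMost_Suc_shift) simp
    also have "(\<Sum>j\<le>N. (-1) ^ Suc j * of_nat (Suc N choose Suc j) * pochhammer (z - of_nat (Suc j)) m) =
       (\<Sum>j\<le>N. ?g j - (-1) ^ j * of_nat (N choose j) * pochhammer (z - 1 - of_nat j) m)"
      by (intro sum.cong refl) (simp add: algebra_simps)
    also have "\<dots> = (\<Sum>j\<le>N. ?g j) - ?f N m (z - 1)" by (simp only: sum_subtractf)
    also have "pochhammer z m + ((\<Sum>j\<le>N. ?g j) - ?f N m (z - 1)) =
       (\<Sum>j\<le>Suc N. (-1) ^ j * of_nat (N choose j) * pochhammer (z - of_nat j) m) - ?f N m (z - 1)"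
      by (subst sum.atMost_Suc_shift) simp
    also have "(\<Sum>j\<le>Suc N. (-1) ^ j * of_nat (N choose j) * pochhammer (z - of_nat j) m) = ?f N m z"
      by simp
    finally show ?thesis .
  qed
  have "?f N m z - ?f N m (z - 1) = 0"
  proof (cases m)
    case 0
    thus ?thesis by simp
  next
    case (Suc m')
    have "?f N m z - ?f N m (z - 1) = of_nat m * ?f N m' z"
      unfolding sum_subtractf [symmetric] sum_distrib_left
    proof (intro sum.cong refl)
      fix j
      have "(-1) ^ j * of_nat (N choose j) * pochhammer (z - of_nat j) m - (-1) ^ j * of_nat (N choose j) * pochhammer (z - 1 - of_nat j) m
         = (-1) ^ j * of_nat (N choose j) * (pochhammer (z - of_nat j) (Suc m') - pochhammer (z - of_nat j - 1) (Suc m'))"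
        unfolding Suc by (simp add: algebra_simps)
      thus "(-1) ^ j * of_nat (N choose j) * pochhammer (z - of_nat j) m - (-1) ^ j * of_nat (N choose j) * pochhammer (z - 1 - of_nat j) m
         = of_nat m * ((-1) ^ j * of_nat (N choose j) * pochhammer (z - of_nat j) m')"
        unfolding pochhammer_backward_diff Suc by simp
    qed
    also have "?f N m' z = 0" using Suc Suc.IH \<open>m < Suc N\<close> by auto
    finally show ?thesis by simp
  qed
  thus ?case using rec by simp
qed simp

text \<open>Isolates a factor that does not depend on \<open>j\<close>, so that what remains is a
  polynomial in \<open>j\<close> of degree N - 1. Both sides split the same runs of consecutive
  factors at x + r - j; for j > r this starting point precedes x and the two runs exchange
  roles.\<close>

lemma pochhammer_exchange:
  fixes x :: complex
  assumes "r \<ge> 1" "j \<le> N" "N \<ge> 1"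
  shows "pochhammer x (r - 1 + N - j) * pochhammer (x + of_nat r - of_nat j) j =
     pochhammer x r * pochhammer (x + of_nat r - of_nat j) (N - 1)"
proof (cases "j \<le> r")
  case True
  have "r - 1 + N - j = (r - j) + (N - 1)" using True assms by simp
  hence 1: "pochhammer x (r - 1 + N - j) = pochhammer x (r - j) * pochhammer (x + of_nat r - of_nat j) (N - 1)"
    using pochhammer_product'[of x "r - j" "N - 1"] True by (simp add: of_nat_diff add_diff_eq)
  have 2: "pochhammer x r = pochhammer x (r - j) * pochhammer (x + of_nat r - of_nat j) j"
    using pochhammer_product'[of x "r - j" j] True by (simp add: of_nat_diff add_diff_eq)
  show ?thesis unfolding 1 2 by simp
next
  case False
  define w where "w = x + of_nat r - of_nat j"
  have x: "w + of_nat (j - r) = x" using False by (simp add: w_def of_nat_diff)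
  have 1: "pochhammer w j = pochhammer w (j - r) * pochhammer x r"
    using pochhammer_product'[of w "j - r" r] False x by simp
  have e: "r - 1 + N - j + (j - r) = N - 1" using assms False by linarith
  have 2: "pochhammer w (N - 1) = pochhammer w (j - r) * pochhammer x (r - 1 + N - j)"
    using pochhammer_product'[of w "j - r" "r - 1 + N - j"] x e by (simp add: add.commute)
  show ?thesis unfolding w_def [symmetric] 1 2 by simp
qed

text \<open>For \<open>i < n\<close> the sum is an \<open>N\<close>-th difference of a polynomial of degree \<open>N - 1\<close>,
  where \<open>N = n - i\<close>; this is the cancellation behind the covariance of the operators.\<close>

lemma Dweight_alternating_sum:
  assumes n: "n \<le> s div 2" and i: "i \<le> n"
  shows "(\<Sum>\<nu>=i..n. (-1) ^ (\<nu> - i) * Dweight k s \<nu> * of_nat (\<nu> choose i) / (fact \<nu> * fact (n - \<nu>)) *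
      pochhammer (of_real k + of_nat (s - \<nu> - n) + of_nat i) (\<nu> - i)) =
     (if i = n then Dweight k s n / fact n else 0)"
proof (cases "i = n")
  case False
  define N where "N = n - i"
  have N: "N \<ge> 1" "n = i + N" using False i by (auto simp: N_def)
  define l where "l = s div 2"
  define x where "x = (of_real k + of_int ((int s - 1) div 2) :: complex)"
  \<comment> \<open>With this \<open>r\<close> the argument k + (s - (i + j) - n) + i of the second
    rising factorial equals x + r - j, so \<open>pochhammer_exchange\<close> applies to its product
    with \<open>Dweight\<close>.\<close>
  define r where "r = l + 1 - n"
  have r: "r \<ge> 1" using n by (simp add: r_def l_def)
  have "2 * n \<le> s" using n by linarith
  have T: "(-1) ^ j * Dweight k s (i + j) * of_nat ((i + j) choose i) / (fact (i + j) * fact (n - (i + j))) *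
      pochhammer (of_real k + of_nat (s - (i + j) - n) + of_nat i) j =
      pochhammer x r / (fact i * fact N) * ((-1) ^ j * of_nat (N choose j) * pochhammer (x + of_nat r - of_nat j) (N - 1))"
    if j: "j \<le> N" for j
  proof -
    have D: "Dweight k s (i + j) = pochhammer x (r - 1 + N - j)"
    proof -
      have "s div 2 - (i + j) = r - 1 + N - j" using n j N by (simp add: r_def l_def)
      thus ?thesis by (simp add: Dweight_def x_def)
    qed
    have "int (s - (i + j) - n) + int i = (int s - 1) div 2 + int r - int j"
    proof -
      have "int (s - (i + j) - n) = int s - int i - int j - int n"
        using \<open>2 * n \<le> s\<close> j N by linarith
      moreover have "int r = int (s div 2) + 1 - int n" using n by (simp add: r_def l_def)
      moreover have "(int s - 1) div 2 = int s - 1 - int (s div 2)" by presburger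
      ultimately show ?thesis using N by linarith
    qed
    hence "(of_int (int (s - (i + j) - n) + int i) :: complex) = of_int ((int s - 1) div 2 + int r - int j)"
      by (simp only:)
    hence P: "of_real k + of_nat (s - (i + j) - n) + of_nat i = x + of_nat r - of_nat j"
      unfolding x_def by (simp add: algebra_simps)
    have C: "of_nat ((i + j) choose i) / (fact (i + j) * fact (n - (i + j))) = (of_nat (N choose j) / (fact i * fact N) :: complex)"
    proof -
      have c1: "of_nat ((i + j) choose i) = (fact (i + j) / (fact i * fact j) :: complex)"
        using binomial_fact[of i "i + j", where 'a = complex] by simp
      have c2: "of_nat (N choose j) = (fact N / (fact j * fact (N - j)) :: complex)"
        using binomial_fact[of j N, where 'a = complex] j by simp
      have "n - (i + j) = N - j" using N by simp
      thus ?thesis unfolding c1 c2 by (simp add: field_simps)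
    qed
    have "(-1) ^ j * Dweight k s (i + j) * of_nat ((i + j) choose i) / (fact (i + j) * fact (n - (i + j))) *
      pochhammer (of_real k + of_nat (s - (i + j) - n) + of_nat i) j =
      (-1) ^ j * (of_nat ((i + j) choose i) / (fact (i + j) * fact (n - (i + j)))) *
       (pochhammer x (r - 1 + N - j) * pochhammer (x + of_nat r - of_nat j) j)"
      unfolding D P by simp
    also have "\<dots> = pochhammer x r / (fact i * fact N) * ((-1) ^ j * of_nat (N choose j) * pochhammer (x + of_nat r - of_nat j) (N - 1))"
      unfolding C pochhammer_exchange[OF r j N(1)] by simp
    finally show ?thesis .
  qed
  have "(\<Sum>\<nu>=i..n. (-1) ^ (\<nu> - i) * Dweight k s \<nu> * of_nat (\<nu> choose i) / (fact \<nu> * fact (n - \<nu>)) *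
      pochhammer (of_real k + of_nat (s - \<nu> - n) + of_nat i) (\<nu> - i)) =
     (\<Sum>j\<le>N. (-1) ^ j * Dweight k s (i + j) * of_nat ((i + j) choose i) / (fact (i + j) * fact (n - (i + j))) *
      pochhammer (of_real k + of_nat (s - (i + j) - n) + of_nat i) j)"
    by (rule sum.reindex_bij_witness [of _ "\<lambda>j. i + j" "\<lambda>\<nu>. \<nu> - i"]) (use N in auto)
  also have "\<dots> = (\<Sum>j\<le>N. pochhammer x r / (fact i * fact N) * ((-1) ^ j * of_nat (N choose j) * pochhammer (x + of_nat r - of_nat j) (N - 1)))"
    by (intro sum.cong refl T) auto
  also have "\<dots> = 0"
    unfolding sum_distrib_left [symmetric] using alternating_binomial_pochhammer[of "N - 1" N "x + of_nat r"] N by simp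
  finally show ?thesis using False by simp
qed simp

text \<open>The coefficients in the classical formula for iterated derivatives of f(\<gamma>\<tau>)
  with automorphy factor (c\<tau>+d)^(-\<kappa>), up to powers of c\<tau>+d.\<close>

definition wcoef :: "complex \<Rightarrow> complex \<Rightarrow> nat \<Rightarrow> nat \<Rightarrow> complex" where
  "wcoef c \<kappa> \<nu> i = of_nat (\<nu> choose i) * (- c) ^ (\<nu> - i) * pochhammer (\<kappa> + of_nat i) (\<nu> - i)"

lemma wcoef_Suc_0: "wcoef c \<kappa> (Suc \<nu>) 0 = - c * (\<kappa> + of_nat \<nu>) * wcoef c \<kappa> \<nu> 0"
  by (simp add: wcoef_def pochhammer_Suc)

text \<open>The recursion that the product rule imposes in \<open>higher_deriv_weight\<close>;
  Pascal's rule and the absorption identity for binomial coefficients account for it.\<close>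

lemma wcoef_Suc_Suc:
  "wcoef c \<kappa> (Suc \<nu>) (Suc i) = - c * (\<kappa> + of_nat \<nu> + of_nat (Suc i)) * wcoef c \<kappa> \<nu> (Suc i) + wcoef c \<kappa> \<nu> i"
proof -
  consider "i > \<nu>" | "i = \<nu>" | "i < \<nu>" by linarith
  thus ?thesis
  proof cases
    case 3
    define q where "q = \<nu> - Suc i"
    have q: "\<nu> - i = Suc q" "\<nu> = i + 1 + q" using 3 by (auto simp: q_def)
    define P where "P = pochhammer (\<kappa> + of_nat i + 1) q"
    have P1: "pochhammer (\<kappa> + of_nat (Suc i)) (Suc q) = P * (\<kappa> + of_nat \<nu>)"
      by (simp add: P_def pochhammer_Suc q(2) add_ac)
    have P2: "pochhammer (\<kappa> + of_nat i) (Suc q) = (\<kappa> + of_nat i) * P"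
      by (simp add: P_def pochhammer_rec add_ac)
    have P3: "pochhammer (\<kappa> + of_nat (Suc i)) q = P" by (simp add: P_def add_ac)
    have "Suc i * (\<nu> choose Suc i) = (\<nu> - i) * (\<nu> choose i)"
      unfolding binomial_absorption binomial_absorb_comp ..
    hence "of_nat (Suc i * (\<nu> choose Suc i)) = (of_nat ((\<nu> - i) * (\<nu> choose i)) :: complex)" by (simp only:)
    hence ab: "(1 + of_nat i) * of_nat (\<nu> choose Suc i) = (of_nat \<nu> - of_nat i :: complex) * of_nat (\<nu> choose i)"
      using 3 by (simp add: of_nat_diff distrib_right)
    have "wcoef c \<kappa> (Suc \<nu>) (Suc i) = (- c) ^ Suc q * P * ((of_nat (\<nu> choose i) + of_nat (\<nu> choose Suc i)) * (\<kappa> + of_nat \<nu>))"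
      unfolding wcoef_def diff_Suc_Suc q(1) P1 by (simp add: algebra_simps)
    also have "(of_nat (\<nu> choose i) + of_nat (\<nu> choose Suc i)) * (\<kappa> + of_nat \<nu>) =
       (\<kappa> + of_nat \<nu> + of_nat (Suc i)) * of_nat (\<nu> choose Suc i) + (\<kappa> + of_nat i) * of_nat (\<nu> choose i)"
      using ab by (simp add: algebra_simps)
    also have "(- c) ^ Suc q * P * \<dots> = - c * (\<kappa> + of_nat \<nu> + of_nat (Suc i)) * wcoef c \<kappa> \<nu> (Suc i) + wcoef c \<kappa> \<nu> i"
      unfolding wcoef_def q(1) P2 q_def [symmetric] P3 by (simp add: algebra_simps)
    finally show ?thesis .
  qed (auto simp: wcoef_def binomial_eq_0)
qed

lemma wcoef_eq_0: "i > \<nu> \<Longrightarrow> wcoef c \<kappa> \<nu> i = 0"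
  by (simp add: wcoef_def)

section \<open>Automorphy factors and iterated derivatives along a metaplectic element\<close>

locale metaplectic_element =
  fixes a b c d :: int and \<epsilon> :: int and k :: real
  assumes det: "a * d - b * c = 1" and eps: "\<epsilon> \<in> {1, -1}" and k_half: "2 * k \<in> \<int>"
begin

definition J :: "complex \<Rightarrow> complex" where "J \<tau> = of_int c * \<tau> + of_int d"

definition \<omega> :: "complex \<Rightarrow> complex" where "\<omega> \<tau> = wpow (jfac ((a,b,c,d), \<epsilon>) \<tau>) k"

lemma J_nonzero:
  assumes "\<tau> \<in> Hset" shows "J \<tau> \<noteq> 0"
proof
  assume "J \<tau> = 0"
  hence "Im (J \<tau>) = 0" "Re (J \<tau>) = 0" by auto
  hence "c = 0" "d = 0" using assms by (auto simp: J_def Hset_def)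
  thus False using det by simp
qed

lemma mobius_eq: "mobius (a,b,c,d) \<tau> = (of_int a * \<tau> + of_int b) / J \<tau>"
  by (simp add: J_def)

lemma det_complex: "of_int a * of_int d - of_int b * of_int c = (1::complex)"
  using arg_cong [OF det, of "of_int :: int \<Rightarrow> complex"] by simp

lemma mobius_in_Hset:
  assumes "\<tau> \<in> Hset" shows "mobius (a,b,c,d) \<tau> \<in> Hset"
proof -
  have d: "(of_int a * of_int d - of_int b * of_int c) = (1::real)"
    using arg_cong [OF det, of "of_int :: int \<Rightarrow> real"] by simp
  have "Im ((of_int a * \<tau> + of_int b) * cnj (J \<tau>)) = (of_int a * of_int d - of_int b * of_int c) * Im \<tau>"
    by (simp add: J_def algebra_simps)
  hence "Im ((of_int a * \<tau> + of_int b) * cnj (J \<tau>)) > 0" unfolding d using assms by (simp add: Hset_def)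
  hence "Im ((of_int a * \<tau> + of_int b) / J \<tau>) > 0"
    by (simp only: Im_complex_div_gt_0)
  thus ?thesis unfolding mobius_eq Hset_def by simp
qed

lemma J_deriv: "(J has_field_derivative of_int c) (at \<tau>)"
  unfolding J_def [abs_def] by (auto intro!: derivative_eq_intros)

lemma mobius_deriv:
  assumes "\<tau> \<in> Hset"
  shows "(mobius (a,b,c,d) has_field_derivative inverse (J \<tau>) ^ 2) (at \<tau>)"
proof -
  have "((\<lambda>\<tau>. (of_int a * \<tau> + of_int b) / J \<tau>) has_field_derivative
     (of_int a * J \<tau> - (of_int a * \<tau> + of_int b) * of_int c) / (J \<tau> * J \<tau>)) (at \<tau>)"
    using J_nonzero[OF assms] by (auto intro!: derivative_eq_intros J_deriv)
  also have "of_int a * J \<tau> - (of_int a * \<tau> + of_int b) * of_int c = of_int a * of_int d - of_int b * of_int c"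
    by (simp add: J_def algebra_simps)
  finally show ?thesis unfolding mobius_eq [abs_def] det_complex by (simp add: power2_eq_square divide_inverse)
qed

lemma jfac_sq: "jfac ((a,b,c,d), \<epsilon>) \<tau> ^ 2 = J \<tau>"
proof -
  have "(of_int \<epsilon> :: complex) ^ 2 = 1" using eps by auto
  thus ?thesis by (simp add: power_mult_distrib J_def)
qed

text \<open>The factor is a power of a square root w of J; since w^2 = J, the sign \<epsilon> drops
  out and the factor differentiates like J^(-k).\<close>

lemma \<omega>_deriv:
  assumes \<tau>: "\<tau> \<in> Hset"
  shows "(\<omega> has_field_derivative - of_real k * of_int c * inverse (J \<tau>) * \<omega> \<tau>) (at \<tau>)"
proof -
  define w where "w \<tau> = jfac ((a,b,c,d), \<epsilon>) \<tau>" for \<tau>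
  have w0: "w \<tau> \<noteq> 0" using jfac_sq[of \<tau>] J_nonzero[OF \<tau>] by (auto simp: w_def)
  have wd: "(w has_field_derivative of_int c / (2 * w \<tau>)) (at \<tau>)"
  \<comment> \<open>For c = 0 the value J = d may be -1, on the branch cut, but then the factor is
    constant; for c \<noteq> 0 the value of J is not real and avoids the cut.\<close>
  proof (cases "c = 0")
    case True
    thus ?thesis unfolding w_def [abs_def] by simp
  next
    case False
    hence "J \<tau> \<notin> \<real>\<^sub>\<le>\<^sub>0" using \<tau> by (auto simp: complex_nonpos_Reals_iff J_def Hset_def)
    hence "((\<lambda>\<tau>. of_int \<epsilon> * csqrt (J \<tau>)) has_field_derivative of_int \<epsilon> * (of_int c / (2 * csqrt (J \<tau>)))) (at \<tau>)"
      by (intro DERIV_cmult has_field_derivative_csqrt' J_deriv)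
    moreover have "of_int \<epsilon> * (of_int c / (2 * csqrt (J \<tau>))) = of_int c / (2 * w \<tau>)"
      using eps by (auto simp: w_def J_def)
    ultimately show ?thesis by (simp add: w_def [abs_def] J_def)
  qed
  define K where "K = \<lfloor>2 * k\<rfloor>"
  have K: "of_int K = (2 * of_real k :: complex)"
  proof -
    have "of_int K = 2 * k" using k_half by (simp add: K_def)
    hence "of_real (of_int K) = (of_real (2 * k) :: complex)" by (simp only:)
    thus ?thesis by simp
  qed
  have "((\<lambda>\<tau>. w \<tau> powi (- K)) has_field_derivative of_int (- K) * w \<tau> powi (- K - 1) * (of_int c / (2 * w \<tau>))) (at \<tau>)"
    by (rule DERIV_power_int [OF wd]) (use w0 in simp)
  also have "of_int (- K) * w \<tau> powi (- K - 1) * (of_int c / (2 * w \<tau>)) = - of_real k * of_int c * inverse (w \<tau> ^ 2) * w \<tau> powi (- K)"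
    using w0 by (simp add: K power_int_diff power2_eq_square field_simps)
  finally show ?thesis using jfac_sq[of \<tau>] by (simp only: \<omega>_def [abs_def] wpow_def K_def w_def)
qed

lemma weight_term_deriv:
  assumes \<tau>: "\<tau> \<in> Hset" and g: "g holomorphic_on Hset"
  shows "((\<lambda>\<tau>. \<omega> \<tau> * inverse (J \<tau>) ^ M * g (mobius (a,b,c,d) \<tau>)) has_field_derivative
     - of_int c * (of_real k + of_nat M) * (\<omega> \<tau> * inverse (J \<tau>) ^ Suc M * g (mobius (a,b,c,d) \<tau>)) +
     \<omega> \<tau> * inverse (J \<tau>) ^ Suc (Suc M) * deriv g (mobius (a,b,c,d) \<tau>)) (at \<tau>)"
proof -
  have g': "(g has_field_derivative deriv g (mobius (a,b,c,d) \<tau>)) (at (mobius (a,b,c,d) \<tau>))"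
    by (rule holomorphic_derivI [OF g open_Hset mobius_in_Hset [OF \<tau>]])
  have gm: "((\<lambda>\<tau>. g (mobius (a,b,c,d) \<tau>)) has_field_derivative deriv g (mobius (a,b,c,d) \<tau>) * inverse (J \<tau>) ^ 2) (at \<tau>)"
    by (rule DERIV_chain2 [OF g' mobius_deriv [OF \<tau>]])
  have ji: "((\<lambda>\<tau>. inverse (J \<tau>)) has_field_derivative - (inverse (J \<tau>) * of_int c * inverse (J \<tau>))) (at \<tau>)"
    by (rule DERIV_inverse' [OF J_deriv J_nonzero [OF \<tau>]])
  have jp: "((\<lambda>\<tau>. inverse (J \<tau>) ^ M) has_field_derivative - of_int c * of_nat M * inverse (J \<tau>) ^ Suc M) (at \<tau>)"
  proof (cases M)
    case (Suc M')
    show ?thesis using DERIV_power [OF ji, of M] by (simp add: Suc mult_ac)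
  qed simp
  show ?thesis
    by (rule DERIV_cong [OF DERIV_mult [OF DERIV_mult [OF \<omega>_deriv [OF \<tau>] jp] gm]])
       (simp add: algebra_simps power2_eq_square)
qed

text \<open>Each differentiation either meets the automorphy factor, giving -c(\<kappa> + \<nu> +
  i)/J, or the inner function, giving 1/J^2 and raising i by one; \<open>wcoef\<close> solves this
  recursion.\<close>

lemma higher_deriv_weight:
  assumes f: "f holomorphic_on Hset" and \<tau>: "\<tau> \<in> Hset"
  shows "(deriv ^^ \<nu>) (\<lambda>\<tau>. \<omega> \<tau> * inverse (J \<tau>) ^ m * f (mobius (a,b,c,d) \<tau>)) \<tau> =
     (\<Sum>i\<le>\<nu>. wcoef (of_int c) (of_real k + of_nat m) \<nu> i *
       (\<omega> \<tau> * inverse (J \<tau>) ^ (m + \<nu> + i) * (deriv ^^ i) f (mobius (a,b,c,d) \<tau>)))"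
  using \<tau>
proof (induction \<nu> arbitrary: \<tau>)
  case 0
  show ?case by (simp add: wcoef_def)
next
  case (Suc \<nu>)
  let ?\<kappa> = "of_real k + of_nat m :: complex"
  define T where "T i = \<omega> \<tau> * inverse (J \<tau>) ^ (m + Suc \<nu> + i) * (deriv ^^ i) f (mobius (a,b,c,d) \<tau>)" for i
  have hol: "(deriv ^^ i) f holomorphic_on Hset" for i
    by (rule holomorphic_higher_deriv [OF f open_Hset])
  have "((\<lambda>\<tau>. \<Sum>i\<le>\<nu>. wcoef (of_int c) ?\<kappa> \<nu> i * (\<omega> \<tau> * inverse (J \<tau>) ^ (m + \<nu> + i) * (deriv ^^ i) f (mobius (a,b,c,d) \<tau>)))
     has_field_derivative (\<Sum>i\<le>\<nu>. wcoef (of_int c) ?\<kappa> \<nu> i * (- of_int c * (?\<kappa> + of_nat \<nu> + of_nat i) * T i + T (Suc i)))) (at \<tau>)"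
  proof (intro DERIV_sum DERIV_cmult)
    fix i
    show "((\<lambda>\<tau>. \<omega> \<tau> * inverse (J \<tau>) ^ (m + \<nu> + i) * (deriv ^^ i) f (mobius (a,b,c,d) \<tau>)) has_field_derivative
       (- of_int c * (?\<kappa> + of_nat \<nu> + of_nat i) * T i + T (Suc i))) (at \<tau>)"
      using weight_term_deriv [OF Suc.prems hol [of i], of "m + \<nu> + i"] by (simp add: T_def add_ac)
  qed
  hence "((deriv ^^ \<nu>) (\<lambda>\<tau>. \<omega> \<tau> * inverse (J \<tau>) ^ m * f (mobius (a,b,c,d) \<tau>)) has_field_derivative
     (\<Sum>i\<le>\<nu>. wcoef (of_int c) ?\<kappa> \<nu> i * (- of_int c * (?\<kappa> + of_nat \<nu> + of_nat i) * T i + T (Suc i)))) (at \<tau>)"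
    by (rule has_field_derivative_transform_within_open [OF _ open_Hset Suc.prems]) (simp only: Suc.IH)
  hence "(deriv ^^ Suc \<nu>) (\<lambda>\<tau>. \<omega> \<tau> * inverse (J \<tau>) ^ m * f (mobius (a,b,c,d) \<tau>)) \<tau> =
     (\<Sum>i\<le>\<nu>. wcoef (of_int c) ?\<kappa> \<nu> i * (- of_int c * (?\<kappa> + of_nat \<nu> + of_nat i) * T i + T (Suc i)))"
    by (simp add: DERIV_imp_deriv)
  also have "\<dots> = (\<Sum>i\<le>\<nu>. - of_int c * (?\<kappa> + of_nat \<nu> + of_nat i) * wcoef (of_int c) ?\<kappa> \<nu> i * T i) + (\<Sum>i\<le>\<nu>. wcoef (of_int c) ?\<kappa> \<nu> i * T (Suc i))"
    by (simp only: sum.distrib [symmetric] distrib_left mult_ac)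
  also have "(\<Sum>i\<le>\<nu>. - of_int c * (?\<kappa> + of_nat \<nu> + of_nat i) * wcoef (of_int c) ?\<kappa> \<nu> i * T i) =
     (\<Sum>i\<le>Suc \<nu>. - of_int c * (?\<kappa> + of_nat \<nu> + of_nat i) * wcoef (of_int c) ?\<kappa> \<nu> i * T i)"
    by (simp add: wcoef_eq_0)
  also have "\<dots> = - of_int c * (?\<kappa> + of_nat \<nu>) * wcoef (of_int c) ?\<kappa> \<nu> 0 * T 0 +
     (\<Sum>i\<le>\<nu>. - of_int c * (?\<kappa> + of_nat \<nu> + of_nat (Suc i)) * wcoef (of_int c) ?\<kappa> \<nu> (Suc i) * T (Suc i))"
    by (subst sum.atMost_Suc_shift) simp
  also have "- of_int c * (?\<kappa> + of_nat \<nu>) * wcoef (of_int c) ?\<kappa> \<nu> 0 * T 0 +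
     (\<Sum>i\<le>\<nu>. - of_int c * (?\<kappa> + of_nat \<nu> + of_nat (Suc i)) * wcoef (of_int c) ?\<kappa> \<nu> (Suc i) * T (Suc i)) + (\<Sum>i\<le>\<nu>. wcoef (of_int c) ?\<kappa> \<nu> i * T (Suc i)) =
     wcoef (of_int c) ?\<kappa> (Suc \<nu>) 0 * T 0 + (\<Sum>i\<le>\<nu>. wcoef (of_int c) ?\<kappa> (Suc \<nu>) (Suc i) * T (Suc i))"
    unfolding wcoef_Suc_0 wcoef_Suc_Suc distrib_right sum.distrib by simp
  also have "\<dots> = (\<Sum>i\<le>Suc \<nu>. wcoef (of_int c) ?\<kappa> (Suc \<nu>) i * T i)"
    by (subst sum.atMost_Suc_shift) simp
  finally show ?case by (simp only: T_def)
qed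

lemma weight_term_holomorphic:
  assumes "f holomorphic_on Hset"
  shows "(\<lambda>\<tau>. \<omega> \<tau> * inverse (J \<tau>) ^ m * f (mobius (a,b,c,d) \<tau>)) holomorphic_on Hset"
  using weight_term_deriv [OF _ assms] holomorphic_on_open [OF open_Hset] by blast

end

section \<open>Commutation of the operators with the slash action\<close>

lemma has_sum_product_complex:
  fixes f :: "'a \<Rightarrow> complex" and g :: "'b \<Rightarrow> complex"
  assumes "(f has_sum s) A" "(g has_sum t) B"
  shows "((\<lambda>(x, y). f x * g y) has_sum (s * t)) (A \<times> B)"
proof (rule has_sum_SigmaI)
  show "((\<lambda>y. case (x, y) of (x, y) \<Rightarrow> f x * g y) has_sum (f x * t)) B" for x
    using has_sum_cmult_right [OF assms(2)] by simp
  show "((\<lambda>x. f x * t) has_sum (s * t)) A"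
    using has_sum_cmult_right [OF assms(1), of t] by (simp add: mult.commute)
  have "(\<lambda>(x, y). norm (f x * g y)) summable_on A \<times> B"
  proof (rule summable_on_SigmaI)
    show "((\<lambda>y. case (x, y) of (x, y) \<Rightarrow> norm (f x * g y)) has_sum (norm (f x) * infsum (\<lambda>y. norm (g y)) B)) B" for x
      using has_sum_cmult_right [OF has_sum_infsum [OF has_sum_imp_abs_summable [OF assms(2)]]]
      by (simp add: norm_mult)
    show "(\<lambda>x. norm (f x) * infsum (\<lambda>y. norm (g y)) B) summable_on A"
      by (intro summable_on_cmult_left has_sum_imp_abs_summable [OF assms(1)])
  qed auto
  thus "(\<lambda>(x, y). f x * g y) summable_on A \<times> B"
    by - (rule abs_summable_summable, simp only: case_prod_unfold)
qed

context metaplectic_element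
begin

text \<open>After differentiating \<open>Y\<close>, the terms are regrouped by n = \<nu> + \<mu>,
  which fixes the component s - 2n of \<open>X\<close>. The coefficient of its i-th derivative is
  then an alternating sum over \<nu> that vanishes for i < n; the diagonal i = n is the expected
  right-hand side.\<close>

lemma Dweight_covariant:
  fixes X Y :: "nat \<Rightarrow> complex \<Rightarrow> complex"
  assumes X: "\<And>r. X r holomorphic_on Hset"
    and Y: "\<And>r \<tau>. \<tau> \<in> Hset \<Longrightarrow> Y r \<tau> = (\<Sum>\<mu>\<le>r div 2. (\<alpha> * of_int c) ^ \<mu> / fact \<mu> *
         (\<omega> \<tau> * inverse (J \<tau>) ^ (r - \<mu>) * X (r - 2 * \<mu>) (mobius (a,b,c,d) \<tau>)))"
    and \<tau>: "\<tau> \<in> Hset"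
  shows "(\<Sum>\<nu>\<le>s div 2. \<alpha> ^ \<nu> / fact \<nu> * Dweight k s \<nu> * (deriv ^^ \<nu>) (Y (s - 2 * \<nu>)) \<tau>) =
     \<omega> \<tau> * inverse (J \<tau>) ^ s *
       (\<Sum>\<nu>\<le>s div 2. \<alpha> ^ \<nu> / fact \<nu> * Dweight k s \<nu> * (deriv ^^ \<nu>) (X (s - 2 * \<nu>)) (mobius (a,b,c,d) \<tau>))"
proof -
  define l where "l = s div 2"
  have l: "2 * l \<le> s" by (simp add: l_def)
  define D where "D i r = (deriv ^^ i) (X r) (mobius (a,b,c,d) \<tau>)" for i r
  define g where "g \<nu> \<mu> i = \<alpha> ^ \<nu> / fact \<nu> * Dweight k s \<nu> * ((\<alpha> * of_int c) ^ \<mu> / fact \<mu> *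
     (wcoef (of_int c) (of_real k + of_nat (s - 2 * \<nu> - \<mu>)) \<nu> i *
       (\<omega> \<tau> * inverse (J \<tau>) ^ (s - 2 * \<nu> - \<mu> + \<nu> + i) * D i (s - 2 * \<nu> - 2 * \<mu>))))" for \<nu> \<mu> i
  have dY: "(deriv ^^ \<nu>) (Y (s - 2 * \<nu>)) \<tau> = (\<Sum>\<mu>\<le>l - \<nu>. (\<alpha> * of_int c) ^ \<mu> / fact \<mu> *
      (\<Sum>i\<le>\<nu>. wcoef (of_int c) (of_real k + of_nat (s - 2 * \<nu> - \<mu>)) \<nu> i *
       (\<omega> \<tau> * inverse (J \<tau>) ^ (s - 2 * \<nu> - \<mu> + \<nu> + i) * D i (s - 2 * \<nu> - 2 * \<mu>))))" for \<nu>
  proof -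
    have e: "(s - 2 * \<nu>) div 2 = l - \<nu>" by (simp add: l_def)
    let ?R = "\<lambda>\<tau>. \<Sum>\<mu>\<le>l - \<nu>. (\<alpha> * of_int c) ^ \<mu> / fact \<mu> *
         (\<omega> \<tau> * inverse (J \<tau>) ^ (s - 2 * \<nu> - \<mu>) * X (s - 2 * \<nu> - 2 * \<mu>) (mobius (a,b,c,d) \<tau>))"
    have YR: "Y (s - 2 * \<nu>) \<tau> = ?R \<tau>" if "\<tau> \<in> Hset" for \<tau>
      using Y [OF that, of "s - 2 * \<nu>"] unfolding e .
    have R: "?R holomorphic_on Hset"
      by (intro holomorphic_on_sum holomorphic_on_mult holomorphic_on_const weight_term_holomorphic X)
    hence "Y (s - 2 * \<nu>) holomorphic_on Hset"
      using YR by (metis (no_types, lifting) holomorphic_cong)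
    hence "(deriv ^^ \<nu>) (Y (s - 2 * \<nu>)) \<tau> = (deriv ^^ \<nu>) ?R \<tau>"
      by (rule higher_deriv_transform_within_open [OF _ R open_Hset \<tau> YR])
    also have "\<dots> = (\<Sum>\<mu>\<le>l - \<nu>. (\<alpha> * of_int c) ^ \<mu> / fact \<mu> * (deriv ^^ \<nu>)
         (\<lambda>\<tau>. \<omega> \<tau> * inverse (J \<tau>) ^ (s - 2 * \<nu> - \<mu>) * X (s - 2 * \<nu> - 2 * \<mu>) (mobius (a,b,c,d) \<tau>)) \<tau>)"
      by (rule higher_deriv_sum_cmult [OF _ open_Hset _ \<tau>]) (auto intro: weight_term_holomorphic X simp del: mobius.simps)
    finally show ?thesis by (simp only: higher_deriv_weight [OF X \<tau>] D_def)
  qed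
  have "(\<Sum>\<nu>\<le>l. \<alpha> ^ \<nu> / fact \<nu> * Dweight k s \<nu> * (deriv ^^ \<nu>) (Y (s - 2 * \<nu>)) \<tau>) =
     (\<Sum>\<nu>\<le>l. \<Sum>\<mu>\<le>l - \<nu>. \<Sum>i\<le>\<nu>. g \<nu> \<mu> i)"
    unfolding dY g_def by (simp only: sum_distrib_left)
  also have "\<dots> = (\<Sum>(\<nu>, \<mu>, i)\<in>(SIGMA \<nu>:{..l}. SIGMA \<mu>:{..l - \<nu>}. {..\<nu>}). g \<nu> \<mu> i)"
    by (simp add: sum.Sigma)
  also have "\<dots> = (\<Sum>(n, i, \<nu>)\<in>(SIGMA n:{..l}. SIGMA i:{..n}. {i..n}). g \<nu> (n - \<nu>) i)"
    by (rule sum.reindex_bij_witness [of _ "\<lambda>(n, i, \<nu>). (\<nu>, n - \<nu>, i)" "\<lambda>(\<nu>, \<mu>, i). (\<nu> + \<mu>, i, \<nu>)"]) auto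
  also have "\<dots> = (\<Sum>n\<le>l. \<Sum>i\<le>n. \<Sum>\<nu>=i..n. g \<nu> (n - \<nu>) i)"
    by (simp add: sum.Sigma)
  also have "\<dots> = (\<Sum>n\<le>l. \<Sum>i\<le>n. if i = n then \<omega> \<tau> * inverse (J \<tau>) ^ s * (\<alpha> ^ n / fact n * Dweight k s n * D n (s - 2 * n)) else 0)"
  proof (intro sum.cong refl)
    fix n i assume "n \<in> {..l}" "i \<in> {..n}"
    hence n: "n \<le> l" and i: "i \<le> n" by auto
    \<comment> \<open>With \<nu> + \<mu> = n the factors c^\<mu> and (-c)^(\<nu>-i) combine to
      c^(n-i) up to sign, and the powers of J combine likewise, so \<nu> survives only in the
      combinatorial coefficient.\<close>
    define C where "C = \<alpha> ^ n * of_int c ^ (n - i) * (\<omega> \<tau> * inverse (J \<tau>) ^ (s - n + i) * D i (s - 2 * n))"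
    have "g \<nu> (n - \<nu>) i = C * ((-1) ^ (\<nu> - i) * Dweight k s \<nu> * of_nat (\<nu> choose i) / (fact \<nu> * fact (n - \<nu>)) *
      pochhammer (of_real k + of_nat (s - \<nu> - n) + of_nat i) (\<nu> - i))" if "\<nu> \<in> {i..n}" for \<nu>
    proof -
      have e: "s - 2 * \<nu> - (n - \<nu>) = s - \<nu> - n" "s - \<nu> - n + \<nu> + i = s - n + i" "s - 2 * \<nu> - 2 * (n - \<nu>) = s - 2 * n"
        using that n l by auto
      have p: "\<alpha> ^ n = \<alpha> ^ \<nu> * \<alpha> ^ (n - \<nu>)" "of_int c ^ (n - i) = of_int c ^ (n - \<nu>) * (of_int c :: complex) ^ (\<nu> - i)"
        "(- of_int c) ^ (\<nu> - i) = (-1) ^ (\<nu> - i) * (of_int c :: complex) ^ (\<nu> - i)"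
        using that by (simp_all add: power_add [symmetric] power_mult_distrib [symmetric])
      show ?thesis unfolding g_def e C_def wcoef_def p power_mult_distrib by (simp add: field_simps)
    qed
    hence "(\<Sum>\<nu>=i..n. g \<nu> (n - \<nu>) i) = C * (\<Sum>\<nu>=i..n. (-1) ^ (\<nu> - i) * Dweight k s \<nu> * of_nat (\<nu> choose i) / (fact \<nu> * fact (n - \<nu>)) *
      pochhammer (of_real k + of_nat (s - \<nu> - n) + of_nat i) (\<nu> - i))"
      unfolding sum_distrib_left by (intro sum.cong refl)
    also have "\<dots> = C * (if i = n then Dweight k s n / fact n else 0)"
      using Dweight_alternating_sum [of n s i k] n i by (simp only: l_def)
    also have "\<dots> = (if i = n then \<omega> \<tau> * inverse (J \<tau>) ^ s * (\<alpha> ^ n / fact n * Dweight k s n * D n (s - 2 * n)) else 0)"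
    proof (cases "i = n")
      case True
      have "s - n + n = s" using n l by simp
      thus ?thesis using True by (simp add: C_def field_simps)
    qed simp
    finally show "(\<Sum>\<nu>=i..n. g \<nu> (n - \<nu>) i) = (if i = n then \<omega> \<tau> * inverse (J \<tau>) ^ s * (\<alpha> ^ n / fact n * Dweight k s n * D n (s - 2 * n)) else 0)" .
  qed
  also have "\<dots> = (\<Sum>n\<le>l. \<omega> \<tau> * inverse (J \<tau>) ^ s * (\<alpha> ^ n / fact n * Dweight k s n * D n (s - 2 * n)))"
    by simp
  finally show ?thesis by (simp only: l_def D_def sum_distrib_left)
qed

text \<open>Coefficients are compared in the scaling variable x: the exponential contributes degree
  2\<mu> with J^(-\<mu>), the rescaled argument degree r with J^(-r), and 2\<mu> + r = s gives the
  exponent s - \<mu>.\<close>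

lemma slash_taylor_relation:
  assumes \<tau>: "\<tau> \<in> Hset"
    and X: "\<And>x. ((\<lambda>r. X r * x ^ r) has_sum F x) UNIV"
    and Y: "\<And>x. ((\<lambda>r. Y r * x ^ r) has_sum (\<omega> \<tau> * exp (\<alpha> * of_int c * x\<^sup>2 * inverse (J \<tau>)) * F (inverse (J \<tau>) * x))) UNIV"
  shows "Y s = (\<Sum>\<mu>\<le>s div 2. (\<alpha> * of_int c) ^ \<mu> / fact \<mu> * (\<omega> \<tau> * inverse (J \<tau>) ^ (s - \<mu>) * X (s - 2 * \<mu>)))"
proof -
  define I where "I = inverse (J \<tau>)"
  define A where "A = (\<lambda>(\<mu>, r). \<omega> \<tau> * ((\<alpha> * of_int c * I) ^ \<mu> / fact \<mu> * (X r * I ^ r)))"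
  have fib: "{i. i \<in> UNIV \<and> (\<lambda>(\<mu>, r). 2 * \<mu> + r) i = s} = (\<lambda>\<mu>. (\<mu>, s - 2 * \<mu>)) ` {..s div 2}" for s :: nat
    by (auto simp: image_iff)
  have "Y s = (\<Sum>i | i \<in> UNIV \<and> (\<lambda>(\<mu>, r). 2 * \<mu> + r) i = s. A i)"
  proof (rule power_series_graded_unique [OF _ _ Y])
    show "finite {i. i \<in> UNIV \<and> (\<lambda>(\<mu>, r). 2 * \<mu> + r) i = (s::nat)}" for s unfolding fib by simp
    fix x
    have "((\<lambda>(\<mu>, r). (\<alpha> * of_int c * x\<^sup>2 * I) ^ \<mu> / fact \<mu> * (X r * (I * x) ^ r)) has_sum
       (exp (\<alpha> * of_int c * x\<^sup>2 * I) * F (I * x))) (UNIV \<times> UNIV)"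
      by (intro has_sum_product_complex has_sum_exp X)
    from has_sum_cmult_right [OF this, of "\<omega> \<tau>"]
    have "((\<lambda>i. \<omega> \<tau> * (case i of (\<mu>, r) \<Rightarrow> (\<alpha> * of_int c * x\<^sup>2 * I) ^ \<mu> / fact \<mu> * (X r * (I * x) ^ r))) has_sum
       (\<omega> \<tau> * (exp (\<alpha> * of_int c * x\<^sup>2 * I) * F (I * x)))) UNIV" by (simp only: UNIV_Times_UNIV)
    moreover have "\<omega> \<tau> * (case i of (\<mu>, r) \<Rightarrow> (\<alpha> * of_int c * x\<^sup>2 * I) ^ \<mu> / fact \<mu> * (X r * (I * x) ^ r)) =
       A i * x ^ (\<lambda>(\<mu>, r). 2 * \<mu> + r) i" for i
      by (cases i) (simp add: A_def power_mult_distrib power_add power_mult [symmetric] mult_ac)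
    ultimately show "((\<lambda>i. A i * x ^ (\<lambda>(\<mu>, r). 2 * \<mu> + r) i) has_sum
       (\<omega> \<tau> * exp (\<alpha> * of_int c * x\<^sup>2 * inverse (J \<tau>)) * F (inverse (J \<tau>) * x))) UNIV"
      by (simp only: I_def mult.assoc)
  qed
  also have "\<dots> = (\<Sum>\<mu>\<le>s div 2. A (\<mu>, s - 2 * \<mu>))"
    unfolding fib by (subst sum.reindex) (auto intro: inj_onI)
  also have "\<dots> = (\<Sum>\<mu>\<le>s div 2. (\<alpha> * of_int c) ^ \<mu> / fact \<mu> * (\<omega> \<tau> * inverse (J \<tau>) ^ (s - \<mu>) * X (s - 2 * \<mu>)))"
  proof (intro sum.cong refl)
    fix \<mu> assume "\<mu> \<in> {..s div 2}"
    hence "s - \<mu> = \<mu> + (s - 2 * \<mu>)" by auto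
    hence "I ^ (s - \<mu>) = I ^ \<mu> * I ^ (s - 2 * \<mu>)" by (simp only: power_add)
    thus "A (\<mu>, s - 2 * \<mu>) = (\<alpha> * of_int c) ^ \<mu> / fact \<mu> * (\<omega> \<tau> * inverse (J \<tau>) ^ (s - \<mu>) * X (s - 2 * \<mu>))"
      unfolding I_def [symmetric] A_def by (simp add: power_mult_distrib mult_ac)
  qed
  finally show ?thesis .
qed

lemma wpow_add:
  assumes "\<tau> \<in> Hset"
  shows "wpow (jfac ((a,b,c,d), \<epsilon>) \<tau>) (k + real s) = \<omega> \<tau> * inverse (J \<tau>) ^ s"
proof -
  define w where "w = jfac ((a,b,c,d), \<epsilon>) \<tau>"
  have w2: "w ^ 2 = J \<tau>" by (simp only: w_def jfac_sq)
  hence w0: "w \<noteq> 0" using J_nonzero [OF assms] by auto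
  have "\<lfloor>2 * (k + real s)\<rfloor> = \<lfloor>2 * k\<rfloor> + int (2 * s)"
    using floor_add_int [of "2 * k" "int (2 * s)"] by (simp add: distrib_left)
  hence "wpow w (k + real s) = w powi (- \<lfloor>2 * k\<rfloor> - int (2 * s))" by (simp add: wpow_def)
  also have "\<dots> = w powi (- \<lfloor>2 * k\<rfloor>) * inverse (w ^ (2 * s))"
    using power_int_diff [OF disjI1 [OF w0], of "- \<lfloor>2 * k\<rfloor>" "int (2 * s)"] by (simp only: power_int_of_nat divide_inverse)
  also have "w ^ (2 * s) = J \<tau> ^ s" by (simp add: power_mult w2)
  finally show ?thesis by (simp only: \<omega>_def wpow_def w_def power_inverse)
qed

end

lemma taylor_coeffs_homogeneous_part:
  fixes f :: "complex \<Rightarrow> complex^'n \<Rightarrow> complex^'m"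
  assumes B: "bilinear B" and s: "jseries B I c f" and \<tau>: "\<tau> \<in> Hset"
  shows "((\<lambda>r. (\<Sum>q | msum q = r. mon u q * taylor_coeffs e f \<tau> q $ m) * x ^ r) has_sum f \<tau> (coordv e (\<chi> i. x * u i)) $ m) UNIV"
proof -
  have "((\<lambda>r. \<Sum>j | j \<in> UNIV \<and> msum j = r. (\<Prod>i\<in>UNIV. (x * u i) ^ j i) * taylor_coeffs e f \<tau> j $ m) has_sum f \<tau> (coordv e (\<chi> i. x * u i)) $ m) UNIV"
    by (rule has_sum_group [OF taylor_coeffs_jseries(2) [OF B s \<tau>, of "\<lambda>i. x * u i"]]) simp
  also have "(\<lambda>r. \<Sum>j | j \<in> UNIV \<and> msum j = r. (\<Prod>i\<in>UNIV. (x * u i) ^ j i) * taylor_coeffs e f \<tau> j $ m) =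
     (\<lambda>r. (\<Sum>q | msum q = r. mon u q * taylor_coeffs e f \<tau> q $ m) * x ^ r)"
    unfolding sum_distrib_right
    by (intro ext sum.cong) (auto simp: mon_def power_mult_distrib prod.distrib power_sum [symmetric] msum_def)
  finally show ?thesis .
qed

text \<open>On the line through a direction u the slash action becomes the scalar relation of
  \<open>slash_taylor_relation\<close>; with \<open>Dweight_covariant\<close> this gives the
  identity of generating polynomials, and \<open>poly_coeff_unique\<close> extracts the single
  operator.\<close>

lemma Dop_covariant:
  fixes f :: "complex \<Rightarrow> complex^'n \<Rightarrow> complex^'m"
  assumes el: "metaplectic_element a b c d \<epsilon> k"
    and B: "bilinear B" and s: "jseries B I C f"
    and s': "jseries B I' C' (jslash B k (((a,b,c,d), \<epsilon>), (0, 0, 1)) f)" and \<tau>: "\<tau> \<in> Hset"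
  shows "Dop B e k (jslash B k (((a,b,c,d), \<epsilon>), (0, 0, 1)) f) p \<tau> =
     mslash (k + real (msum p)) ((a,b,c,d), \<epsilon>) (Dop B e k f p) \<tau>"
proof -
  interpret metaplectic_element a b c d \<epsilon> k by (rule el)
  define f' where "f' = jslash B k (((a,b,c,d), \<epsilon>), (0, 0, 1)) f"
  define s0 where "s0 = msum p"
  let ?\<gamma> = "mobius (a,b,c,d)"
  have slash: "f' \<tau> z = (\<omega> \<tau> * ee (- (of_int c * Qc B z) / J \<tau>)) *s f (?\<gamma> \<tau>) (inverse (J \<tau>) *s z)" for \<tau> z
  proof -
    have 1: "cvec (0 :: real^'n) = 0" by (simp add: cvec_def vec_eq_iff)
    have 2: "Bc B 0 z = 0" by (simp add: Bc_def)
    have 3: "B 0 0 = 0" by (rule bilinear_lzero [OF B])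
    have 4: "z + \<tau> *s 0 + 0 = z" by (simp add: vec_eq_iff)
    show ?thesis
      unfolding f'_def jslash.simps Let_def 1 2 4 Qr_def 3 \<omega>_def [symmetric] J_def [symmetric] by (simp add: inverse_eq_divide)
  qed
  have "Dop B e k f' p \<tau> $ m = \<omega> \<tau> * inverse (J \<tau>) ^ s0 * Dop B e k f p (?\<gamma> \<tau>) $ m" for m
  proof -
    define H where "H g q \<tau> = taylor_coeffs e g \<tau> q $ m" for g :: "complex \<Rightarrow> complex^'n \<Rightarrow> complex^'m" and q \<tau>
    define K where "K = (4 ^ (s0 div 2) * fact (s0 div 2) :: complex)"
    define E where "E g p \<tau> = (\<Sum>\<Lambda> | msumL \<Lambda> \<le> s0 div 2. gram_coeff B e \<Lambda> * Dweight k s0 (msumL \<Lambda>) *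
        (if \<forall>i. piL \<Lambda> i \<le> p i then (deriv ^^ msumL \<Lambda>) (H g (\<lambda>i. p i - piL \<Lambda> i)) \<tau> else 0))" for g p \<tau>
    have D: "Dop B e k g p \<tau> $ m = K * E g p \<tau>" for g \<tau>
      by (simp only: Dop_component s0_def [symmetric] K_def E_def H_def [abs_def])
    have hol: "H f q holomorphic_on Hset" "H f' q holomorphic_on Hset" for q
      using taylor_jseries_holomorphic [OF B] s s' by (auto simp: H_def [abs_def] f'_def)
    have "E f' p \<tau> = \<omega> \<tau> * inverse (J \<tau>) ^ s0 * E f p (?\<gamma> \<tau>)"
    proof (rule poly_coeff_unique [where s = s0])
      fix u :: "'n \<Rightarrow> complex"
      \<comment> \<open>Equal to -2 pi i Q(u): the same number governs the exponential in the slash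
        action and the weights of the operator, which is what makes the unwanted terms
        cancel.\<close>
      define \<alpha> where "\<alpha> = (\<Sum>i\<in>UNIV. \<Sum>j\<in>UNIV. - of_real pi * \<i> * of_real (B (e i) (e j)) * (u i * u j))"
      define X where "X g r \<tau> = (\<Sum>q | msum q = r. mon u q * H g q \<tau>)" for g r \<tau>
      have gen: "(\<Sum>p | msum p = s0. mon u p * E g p \<tau>) = (\<Sum>\<nu>\<le>s0 div 2. \<alpha> ^ \<nu> / fact \<nu> * Dweight k s0 \<nu> * (deriv ^^ \<nu>) (X g (s0 - 2 * \<nu>)) \<tau>)"
        if "\<And>q. H g q holomorphic_on Hset" "\<tau> \<in> Hset" for g \<tau>
        unfolding E_def X_def [abs_def] \<alpha>_def by (rule Dop_generating [OF that])
      have Xh: "X f r holomorphic_on Hset" for r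
        unfolding X_def [abs_def] by (intro holomorphic_intros hol)
      have rel: "X f' r \<tau> = (\<Sum>\<mu>\<le>r div 2. (\<alpha> * of_int c) ^ \<mu> / fact \<mu> *
         (\<omega> \<tau> * inverse (J \<tau>) ^ (r - \<mu>) * X f (r - 2 * \<mu>) (?\<gamma> \<tau>)))" if \<tau>: "\<tau> \<in> Hset" for r \<tau>
      proof (rule slash_taylor_relation [OF \<tau>])
        show "((\<lambda>r. X f r (?\<gamma> \<tau>) * x ^ r) has_sum f (?\<gamma> \<tau>) (coordv e (\<chi> i. x * u i)) $ m) UNIV" for x
          unfolding X_def H_def by (rule taylor_coeffs_homogeneous_part [OF B s mobius_in_Hset [OF \<tau>]])
        fix x
        have "((\<lambda>r. X f' r \<tau> * x ^ r) has_sum f' \<tau> (coordv e (\<chi> i. x * u i)) $ m) UNIV"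
          unfolding X_def H_def f'_def by (rule taylor_coeffs_homogeneous_part [OF B s' \<tau>])
        also have "f' \<tau> (coordv e (\<chi> i. x * u i)) $ m = \<omega> \<tau> * exp (\<alpha> * of_int c * x\<^sup>2 * inverse (J \<tau>)) *
           f (?\<gamma> \<tau>) (coordv e (\<chi> i. inverse (J \<tau>) * x * u i)) $ m"
        proof -
          have "inverse (J \<tau>) *s coordv e (\<chi> i. x * u i) = coordv e (\<chi> i. inverse (J \<tau>) * x * u i)"
            unfolding coordv_scale [symmetric] by (rule arg_cong [where f = "coordv e"]) (simp add: vec_eq_iff mult.assoc)
          moreover have "ee (- (of_int c * Qc B (coordv e (\<chi> i. x * u i))) / J \<tau>) = exp (\<alpha> * of_int c * x\<^sup>2 * inverse (J \<tau>))"
          proof -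
            have "2 * of_real pi * \<i> * Qc B (coordv e (\<chi> i. x * u i)) = - \<alpha> * x\<^sup>2"
              unfolding Qc_coordv [OF B] \<alpha>_def
              by (simp add: sum_distrib_left sum_distrib_right sum_negf [symmetric] power2_eq_square mult_ac)
            hence "2 * of_real pi * \<i> * (- (of_int c * Qc B (coordv e (\<chi> i. x * u i))) / J \<tau>) = - (of_int c * (- \<alpha> * x\<^sup>2)) / J \<tau>"
              by (metis (no_types, lifting) minus_mult_right mult.left_commute times_divide_eq_right)
            thus ?thesis unfolding ee_def by (simp add: divide_inverse mult_ac)
          qed
          ultimately show ?thesis unfolding slash by simp
        qed
        finally show "((\<lambda>r. X f' r \<tau> * x ^ r) has_sum \<omega> \<tau> * exp (\<alpha> * of_int c * x\<^sup>2 * inverse (J \<tau>)) *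
           f (?\<gamma> \<tau>) (coordv e (\<chi> i. inverse (J \<tau>) * x * u i)) $ m) UNIV" .
      qed
      have "(\<Sum>p | msum p = s0. mon u p * E f' p \<tau>) = \<omega> \<tau> * inverse (J \<tau>) ^ s0 * (\<Sum>p | msum p = s0. mon u p * E f p (?\<gamma> \<tau>))"
        unfolding gen [OF hol(2) \<tau>] gen [OF hol(1) mobius_in_Hset [OF \<tau>]]
        by (rule Dweight_covariant [OF Xh rel \<tau>])
      thus "(\<Sum>p | msum p = s0. mon u p * E f' p \<tau>) = (\<Sum>p | msum p = s0. mon u p * (\<omega> \<tau> * inverse (J \<tau>) ^ s0 * E f p (?\<gamma> \<tau>)))"
        by (simp add: sum_distrib_left mult_ac)
    qed (simp add: s0_def)
    thus ?thesis unfolding D by simp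
  qed
  thus ?thesis
    unfolding f'_def [symmetric] mslash_def fst_conv wpow_add [OF \<tau>] s0_def [symmetric]
    by (simp add: vec_eq_iff)
qed

section \<open>Fourier expansions and modularity\<close>

lemma has_sum_finite_sum:
  fixes f :: "'b \<Rightarrow> 'a \<Rightarrow> complex"
  assumes "\<And>s. s \<in> S \<Longrightarrow> (f s has_sum g s) A"
  shows "((\<lambda>x. \<Sum>s\<in>S. f s x) has_sum (\<Sum>s\<in>S. g s)) A"
  using assms by (induction S rule: infinite_finite_induct) (auto intro: has_sum_add)

text \<open>The operator acts on \<open>q\<^sup>n e(B(t,z))\<close> as multiplication of \<open>q\<^sup>n\<close> by this polynomial in \<open>(n, t)\<close>.\<close>

definition Dpoly :: "(real^'n \<Rightarrow> real^'n \<Rightarrow> real) \<Rightarrow> ('n \<Rightarrow> real^'n) \<Rightarrow> real \<Rightarrow> ('n \<Rightarrow> nat) \<Rightarrow> real \<times> (real^'n) \<Rightarrow> complex" where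
  "Dpoly B e k p nt = 4 ^ (msum p div 2) * fact (msum p div 2) *
     (\<Sum>\<Lambda> | msumL \<Lambda> \<le> msum p div 2. gram_coeff B e \<Lambda> * Dweight k (msum p) (msumL \<Lambda>) *
        (if \<forall>i. piL \<Lambda> i \<le> p i then (2 * of_real pi * \<i> * of_real (fst nt)) ^ msumL \<Lambda> * mono_fact (\<lambda>i. p i - piL \<Lambda> i) (\<lambda>l. B (snd nt) (e l)) else 0))"

lemma Dop_jseries:
  assumes B: "bilinear B" and s: "jseries B I c f" and \<tau>: "\<tau> \<in> Hset"
  shows "((\<lambda>nt. Dpoly B e k p nt * c nt $ m * ee (of_real (fst nt) * \<tau>)) has_sum Dop B e k f p \<tau> $ m) I"
proof -
  let ?K = "4 ^ (msum p div 2) * fact (msum p div 2) :: complex"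
  let ?A = "\<lambda>\<Lambda> nt. gram_coeff B e \<Lambda> * Dweight k (msum p) (msumL \<Lambda>) *
        (if \<forall>i. piL \<Lambda> i \<le> p i then (2 * of_real pi * \<i> * of_real (fst nt)) ^ msumL \<Lambda> * (mono_fact (\<lambda>i. p i - piL \<Lambda> i) (\<lambda>l. B (snd nt) (e l)) * c nt $ m) * ee (of_real (fst nt) * \<tau>) else 0)"
  have "((\<lambda>nt. ?K * (\<Sum>\<Lambda> | msumL \<Lambda> \<le> msum p div 2. ?A \<Lambda> nt)) has_sum Dop B e k f p \<tau> $ m) I"
    unfolding Dop_component
  proof (intro has_sum_cmult_right has_sum_finite_sum)
    fix \<Lambda> :: "'a \<Rightarrow> 'a \<Rightarrow> nat"
    show "((\<lambda>nt. if \<forall>i. piL \<Lambda> i \<le> p i then (2 * of_real pi * \<i> * of_real (fst nt)) ^ msumL \<Lambda> * (mono_fact (\<lambda>i. p i - piL \<Lambda> i) (\<lambda>l. B (snd nt) (e l)) * c nt $ m) * ee (of_real (fst nt) * \<tau>) else 0) has_sum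
       (if \<forall>i. piL \<Lambda> i \<le> p i then (deriv ^^ msumL \<Lambda>) (\<lambda>\<tau>. taylor_coeffs e f \<tau> (\<lambda>i. p i - piL \<Lambda> i) $ m) \<tau> else 0)) I"
    proof (cases "\<forall>i. piL \<Lambda> i \<le> p i")
      case True
      thus ?thesis using deriv_taylor_jseries [OF B s \<tau>] by simp
    next
      case False
      show ?thesis unfolding if_not_P [OF False] by (rule has_sum_0) simp
    qed
  qed
  moreover have "?K * (\<Sum>\<Lambda> | msumL \<Lambda> \<le> msum p div 2. ?A \<Lambda> nt) = Dpoly B e k p nt * c nt $ m * ee (of_real (fst nt) * \<tau>)" for nt
    unfolding Dpoly_def mult.assoc sum_distrib_right
    by (intro arg_cong2 [where f = "(*)"] sum.cong refl) (simp add: mult_ac)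
  ultimately show ?thesis by (simp only:)
qed

section \<open>Linearity of the operators\<close>

lemma jseries_extend:
  assumes "jseries B I c f" "I \<subseteq> I'"
  shows "jseries B I' (\<lambda>nt. if nt \<in> I then c nt else 0) f"
  unfolding jseries_def
proof (intro ballI allI)
  fix \<tau> z assume "\<tau> \<in> Hset"
  hence "(jterm B c \<tau> z has_sum f \<tau> z) I" using assms by (auto simp: jseries_def)
  thus "(jterm B (\<lambda>nt. if nt \<in> I then c nt else 0) \<tau> z has_sum f \<tau> z) I'"
    by (rule has_sum_cong_neutral [THEN iffD1, rotated -1]) (use assms(2) in \<open>auto simp: jterm_def vec_eq_iff\<close>)
qed

lemma jseries_add:
  assumes "jseries B I c f" "jseries B I c' g"
  shows "jseries B I (\<lambda>nt. a *s c nt + b *s c' nt) (\<lambda>\<tau> z. a *s f \<tau> z + b *s g \<tau> z)"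
  unfolding jseries_def has_sum_vec_nth
proof (intro ballI allI)
  fix \<tau> z m assume \<tau>: "\<tau> \<in> Hset"
  have "((\<lambda>x. jterm B c \<tau> z x $ m) has_sum f \<tau> z $ m) I" "((\<lambda>x. jterm B c' \<tau> z x $ m) has_sum g \<tau> z $ m) I"
    using assms \<tau> unfolding jseries_def has_sum_vec_nth by auto
  from has_sum_add [OF has_sum_cmult_right [OF this(1), of a] has_sum_cmult_right [OF this(2), of b]]
  show "((\<lambda>x. jterm B (\<lambda>nt. a *s c nt + b *s c' nt) \<tau> z x $ m) has_sum (a *s f \<tau> z + b *s g \<tau> z) $ m) I"
    by (simp add: jterm_def algebra_simps)
qed

text \<open>Neither \<open>taylor_coeffs\<close> nor \<open>deriv\<close> is linear on arbitrary
  functions. On functions with expansions the operator multiplies the coefficients by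
  \<open>Dpoly\<close>, and linearity is read off over the union of the two index sets.\<close>

lemma Dop_linear:
  assumes B: "bilinear B" and f: "jseries B I c f" and g: "jseries B I' c' g" and \<tau>: "\<tau> \<in> Hset"
  shows "Dop B e k (\<lambda>\<tau> z. a *s f \<tau> z + b *s g \<tau> z) p \<tau> = a *s Dop B e k f p \<tau> + b *s Dop B e k g p \<tau>"
proof -
  have f': "jseries B (I \<union> I') (\<lambda>nt. if nt \<in> I then c nt else 0) f"
    and g': "jseries B (I \<union> I') (\<lambda>nt. if nt \<in> I' then c' nt else 0) g"
    using jseries_extend f g by blast+
  define C where "C nt = (if nt \<in> I then c nt else 0)" for nt
  define C' where "C' nt = (if nt \<in> I' then c' nt else 0)" for nt
  have "Dop B e k (\<lambda>\<tau> z. a *s f \<tau> z + b *s g \<tau> z) p \<tau> $ m = a * Dop B e k f p \<tau> $ m + b * Dop B e k g p \<tau> $ m" for m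
  proof (rule has_sum_unique)
    show "((\<lambda>nt. Dpoly B e k p nt * (a *s C nt + b *s C' nt) $ m * ee (of_real (fst nt) * \<tau>)) has_sum
       Dop B e k (\<lambda>\<tau> z. a *s f \<tau> z + b *s g \<tau> z) p \<tau> $ m) (I \<union> I')"
      unfolding C_def C'_def by (rule Dop_jseries [OF B jseries_add [OF f' g'] \<tau>])
    have "((\<lambda>nt. a * (Dpoly B e k p nt * C nt $ m * ee (of_real (fst nt) * \<tau>)) +
        b * (Dpoly B e k p nt * C' nt $ m * ee (of_real (fst nt) * \<tau>))) has_sum
       (a * Dop B e k f p \<tau> $ m + b * Dop B e k g p \<tau> $ m)) (I \<union> I')"
      unfolding C_def C'_def by (intro has_sum_add has_sum_cmult_right Dop_jseries [OF B f' \<tau>] Dop_jseries [OF B g' \<tau>])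
    thus "((\<lambda>nt. Dpoly B e k p nt * (a *s C nt + b *s C' nt) $ m * ee (of_real (fst nt) * \<tau>)) has_sum
       (a * Dop B e k f p \<tau> $ m + b * Dop B e k g p \<tau> $ m)) (I \<union> I')"
      by (simp add: algebra_simps)
  qed
  thus ?thesis by (simp add: vec_eq_iff)
qed

text \<open>Passes the representation matrix through the operator; as in \<open>Dop_linear\<close>,
  the reason is that \<open>Dpoly\<close> is a scalar factor on the coefficients.\<close>

lemma Dop_matrix_mult:
  fixes A :: "complex^'m^'m"
  assumes B: "bilinear B" and f: "jseries B I c f" and g: "\<And>\<tau> z. \<tau> \<in> Hset \<Longrightarrow> g \<tau> z = A *v f \<tau> z"
    and \<tau>: "\<tau> \<in> Hset"
  shows "Dop B e k g p \<tau> = A *v Dop B e k f p \<tau>"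
proof -
  have g': "jseries B I (\<lambda>nt. A *v c nt) g"
    unfolding jseries_def has_sum_vec_nth
  proof (intro ballI allI)
    fix \<tau> z m assume \<tau>: "\<tau> \<in> Hset"
    have "((\<lambda>x. jterm B c \<tau> z x $ m') has_sum f \<tau> z $ m') I" for m'
      using f \<tau> unfolding jseries_def has_sum_vec_nth by auto
    hence "((\<lambda>x. \<Sum>m'\<in>UNIV. A $ m $ m' * jterm B c \<tau> z x $ m') has_sum (\<Sum>m'\<in>UNIV. A $ m $ m' * f \<tau> z $ m')) I"
      by (intro has_sum_finite_sum has_sum_cmult_right)
    thus "((\<lambda>x. jterm B (\<lambda>nt. A *v c nt) \<tau> z x $ m) has_sum g \<tau> z $ m) I"
      by (simp add: g [OF \<tau>] matrix_vector_mult_def jterm_def sum_distrib_left mult_ac)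
  qed
  have "Dop B e k g p \<tau> $ m = (A *v Dop B e k f p \<tau>) $ m" for m
  proof (rule has_sum_unique)
    show "((\<lambda>nt. Dpoly B e k p nt * (A *v c nt) $ m * ee (of_real (fst nt) * \<tau>)) has_sum Dop B e k g p \<tau> $ m) I"
      by (rule Dop_jseries [OF B g' \<tau>])
    have "((\<lambda>nt. \<Sum>m'\<in>UNIV. A $ m $ m' * (Dpoly B e k p nt * c nt $ m' * ee (of_real (fst nt) * \<tau>))) has_sum
        (\<Sum>m'\<in>UNIV. A $ m $ m' * Dop B e k f p \<tau> $ m')) I"
      by (intro has_sum_finite_sum has_sum_cmult_right Dop_jseries [OF B f \<tau>])
    thus "((\<lambda>nt. Dpoly B e k p nt * (A *v c nt) $ m * ee (of_real (fst nt) * \<tau>)) has_sum (A *v Dop B e k f p \<tau>) $ m) I"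
      by (simp add: matrix_vector_mult_def sum_distrib_left sum_distrib_right mult_ac)
  qed
  thus ?thesis by (simp add: vec_eq_iff)
qed

section \<open>Expansions at the cusps\<close>

lemma norm_vec_le_sum: "norm (x :: complex^'m) \<le> (\<Sum>m\<in>UNIV. norm (x $ m))"
  by (simp add: norm_vec_def L2_set_le_sum)

text \<open>For fixed n the modulus is monotone in the imaginary part, so the points of
  \<open>K\<close> with least and greatest imaginary part bound the supremum over the compact
  set.\<close>

lemma q_series_normal_convergence:
  fixes c :: "real \<Rightarrow> complex^'m"
  assumes sum: "\<And>\<tau>. \<tau> \<in> Hset \<Longrightarrow> ((\<lambda>n. ee (of_real n * \<tau>) *s c n) has_sum h \<tau>) A"
    and K: "compact K" "K \<noteq> {}" "K \<subseteq> Hset"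
  shows "(\<lambda>n. SUP \<tau>\<in>K. norm (ee (of_real n * \<tau>) *s c n)) summable_on A"
proof -
  have norm_s: "norm (a *s v) = norm a * norm v" for a and v :: "complex^'m"
    by (simp add: norm_vec_def norm_mult L2_set_right_distrib)
  have abs: "(\<lambda>n. norm (ee (of_real n * \<tau>) *s c n)) summable_on A" if "\<tau> \<in> Hset" for \<tau>
  proof (rule summable_on_comparison_test)
    show "(\<lambda>n. \<Sum>m\<in>UNIV. norm ((ee (of_real n * \<tau>) *s c n) $ m)) summable_on A"
      by (intro summable_on_finite_sum)
        (use sum [OF that] has_sum_imp_abs_summable in \<open>auto simp: has_sum_vec_nth simp del: vector_smult_component\<close>)
  qed (rule norm_vec_le_sum, simp)
  have cont: "continuous_on K Im" by (intro continuous_intros)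
  obtain t1 where t1: "t1 \<in> K" "\<And>\<tau>. \<tau> \<in> K \<Longrightarrow> Im t1 \<le> Im \<tau>"
    using continuous_attains_inf [OF K(1,2) cont] by blast
  obtain t2 where t2: "t2 \<in> K" "\<And>\<tau>. \<tau> \<in> K \<Longrightarrow> Im \<tau> \<le> Im t2"
    using continuous_attains_sup [OF K(1,2) cont] by blast
  define M where "M n = norm (ee (of_real n * t1) *s c n) + norm (ee (of_real n * t2) *s c n)" for n
  have M: "norm (ee (of_real n * \<tau>) *s c n) \<le> M n" if "\<tau> \<in> K" for n \<tau>
  proof -
    have "- (n * Im \<tau>) \<le> - (n * Im t1) \<or> - (n * Im \<tau>) \<le> - (n * Im t2)"
      using t1(2) [OF that] t2(2) [OF that] by (cases "n \<ge> 0") (auto intro: mult_left_mono mult_left_mono_neg)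
    hence "exp (- (2 * pi * (n * Im \<tau>))) \<le> exp (- (2 * pi * (n * Im t1))) \<or>
         exp (- (2 * pi * (n * Im \<tau>))) \<le> exp (- (2 * pi * (n * Im t2)))"
      by (auto simp: mult_le_cancel_left)
    moreover have "exp (- (2 * pi * (n * Im t1))) > 0" "exp (- (2 * pi * (n * Im t2))) > 0" by auto
    ultimately have "exp (- (2 * pi * (n * Im \<tau>))) \<le> exp (- (2 * pi * (n * Im t1))) + exp (- (2 * pi * (n * Im t2)))"
      by linarith
    hence "norm (ee (of_real n * \<tau>)) \<le> norm (ee (of_real n * t1)) + norm (ee (of_real n * t2))"
      by (simp add: norm_ee)
    thus ?thesis unfolding M_def norm_s distrib_right [symmetric] by (intro mult_right_mono) auto
  qed
  show ?thesis
  proof (rule summable_on_comparison_test)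
    show "M summable_on A"
      unfolding M_def using t1 t2 K by (intro summable_on_add abs) auto
    show "(SUP \<tau>\<in>K. norm (ee (of_real n * \<tau>) *s c n)) \<le> M n" for n
      by (rule cSUP_least [OF K(2)]) (rule M)
    show "0 \<le> (SUP \<tau>\<in>K. norm (ee (of_real n * \<tau>) *s c n))" for n
      by (rule cSUP_upper2 [OF _ t1(1)]) (auto intro!: bdd_aboveI2 [of _ _ "M n"] M)
  qed
qed

definition tidx :: "(real^'n \<Rightarrow> real^'n \<Rightarrow> real) \<Rightarrow> (real^'n) set \<Rightarrow> nat \<Rightarrow> (real^'n) set" where
  "tidx B L M = {t. \<exists>s\<in>dual_lattice B L. t = (1 / real M) *\<^sub>R s}"

lemma jidx_eq: "jidx B L M = qidx M \<times> tidx B L M"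
  by (auto simp: jidx_def qidx_def tidx_def)

definition Dcoeff :: "(real^'n \<Rightarrow> real^'n \<Rightarrow> real) \<Rightarrow> (real^'n) set \<Rightarrow> ('n \<Rightarrow> real^'n) \<Rightarrow> real \<Rightarrow> ('n \<Rightarrow> nat) \<Rightarrow> nat \<Rightarrow>
    (real \<times> (real^'n) \<Rightarrow> complex^'m) \<Rightarrow> real \<Rightarrow> complex^'m" where
  "Dcoeff B L e k p M c n = (\<chi> m. \<Sum>\<^sub>\<infinity>t\<in>tidx B L M. Dpoly B e k p (n, t) * c (n, t) $ m)"

lemma jexpansion_jseries: "jexpansion B L k f g M c \<Longrightarrow> jseries B (jidx B L M) c (jslash B k g f)"
  by (simp add: jexpansion_def jseries_def)

text \<open>By covariance the slashed operator is the operator of the slashed form, whose expansion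
  is given; summing over t for each n, by absolute summability of the double family, leaves a series
  in q alone.\<close>

lemma qexpansion_Dop:
  fixes f :: "complex \<Rightarrow> complex^'n \<Rightarrow> complex^'m"
  assumes B: "bilinear B" and g: "g \<in> Mp_pre SL2Z" and k: "2 * k \<in> \<int>"
    and f: "jseries B I c0 f" and ex: "jexpansion B L k f (g, (0, 0, 1)) M c"
  shows "qexpansion (k + real (msum p)) (Dop B e k f p) g M (Dcoeff B L e k p M c)"
proof -
  obtain a b c' d \<epsilon> where g': "g = ((a,b,c',d), \<epsilon>)" "a * d - b * c' = 1" "\<epsilon> \<in> {1, -1}"
    using g by (auto simp: Mp_pre_def SL2Z_def)
  have el: "metaplectic_element a b c' d \<epsilon> k"
    using g' k by unfold_locales auto
  note s = jexpansion_jseries [OF ex]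
  have hs: "((\<lambda>n. ee (of_real n * \<tau>) *s Dcoeff B L e k p M c n) has_sum
     mslash (k + real (msum p)) g (Dop B e k f p) \<tau>) (qidx M)" if \<tau>: "\<tau> \<in> Hset" for \<tau>
    unfolding has_sum_vec_nth
  proof
    fix m
    have cov: "Dop B e k (jslash B k (g, (0, 0, 1)) f) p \<tau> = mslash (k + real (msum p)) g (Dop B e k f p) \<tau>"
      using Dop_covariant [OF el B f _ \<tau>] s unfolding g'(1) by blast
    have h: "((\<lambda>(n, t). Dpoly B e k p (n, t) * c (n, t) $ m * ee (of_real n * \<tau>)) has_sum
       mslash (k + real (msum p)) g (Dop B e k f p) \<tau> $ m) (qidx M \<times> tidx B L M)"
      using Dop_jseries [OF B s \<tau>, of e k p m] unfolding cov jidx_eq by (simp add: case_prod_unfold)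
    show "((\<lambda>n. (ee (of_real n * \<tau>) *s Dcoeff B L e k p M c n) $ m) has_sum
       mslash (k + real (msum p)) g (Dop B e k f p) \<tau> $ m) (qidx M)"
    proof (rule has_sum_SigmaD [OF h])
      fix n assume n: "n \<in> qidx M"
      have "(\<lambda>t. Dpoly B e k p (n, t) * c (n, t) $ m * ee (of_real n * \<tau>)) summable_on tidx B L M"
        using summable_on_SigmaD1 [OF has_sum_imp_summable [OF h] n] .
      hence "(\<lambda>t. Dpoly B e k p (n, t) * c (n, t) $ m * ee (of_real n * \<tau>) * inverse (ee (of_real n * \<tau>))) summable_on tidx B L M"
        by (rule summable_on_cmult_left)
      hence "(\<lambda>t. Dpoly B e k p (n, t) * c (n, t) $ m) summable_on tidx B L M" by (simp add: mult.assoc)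
      from has_sum_cmult_right [OF has_sum_infsum [OF this], of "ee (of_real n * \<tau>)"]
      show "((\<lambda>t. case (n, t) of (n, t) \<Rightarrow> Dpoly B e k p (n, t) * c (n, t) $ m * ee (of_real n * \<tau>)) has_sum
          (ee (of_real n * \<tau>) *s Dcoeff B L e k p M c n) $ m) (tidx B L M)"
        by (simp add: Dcoeff_def mult_ac)
    qed
  qed
  show ?thesis
    unfolding qexpansion_def
    using ex hs q_series_normal_convergence [OF hs] by (auto simp: jexpansion_def)
qed

text \<open>A nonzero \<Lambda> contributes a positive power of n = 0, and \<Lambda> = 0 leaves the
  coefficient with index p of the constant function 1. In the expansion of a holomorphic Jacobi form
  (0, 0) is the only pair with n \<le> 0, so this yields cusp forms.\<close>

lemma Dpoly_0:
  assumes "bilinear B" "p \<noteq> (\<lambda>_. 0)"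
  shows "Dpoly B e k p (0, 0) = 0"
proof -
  obtain l where l: "p l \<noteq> 0" using assms(2) by auto
  have "(if \<forall>i. piL \<Lambda> i \<le> p i then (2 * of_real pi * \<i> * of_real 0) ^ msumL \<Lambda> * mono_fact (\<lambda>i. p i - piL \<Lambda> i) (\<lambda>l. B 0 (e l)) else 0) = 0"
    for \<Lambda> :: "'a \<Rightarrow> 'a \<Rightarrow> nat"
  proof (cases "msumL \<Lambda> = 0")
    case True
    hence "msum (piL \<Lambda>) = 0" by (simp add: msum_piL)
    hence "piL \<Lambda> l = 0" by (simp add: msum_def)
    hence "mono_fact (\<lambda>i. p i - piL \<Lambda> i) (\<lambda>l. B 0 (e l)) = 0"
      using l by (auto simp: mono_fact_def bilinear_lzero [OF assms(1)] intro!: exI[of _ l])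
    thus ?thesis by simp
  qed simp
  thus ?thesis unfolding Dpoly_def fst_conv snd_conv by (simp only: mult_zero_right sum.neutral_const)
qed

lemma mform_base_Dop:
  fixes f :: "complex \<Rightarrow> complex^'n \<Rightarrow> complex^'m"
  assumes B: "bilinear B" and G: "G \<subseteq> SL2Z" and L: "0 \<in> L" and k: "2 * k \<in> \<int>"
    and base: "jacobi_base B L G \<rho> k f"
    and f: "jseries B I c0 f"
    and ex: "\<And>g. g \<in> JG SL2Z L \<Longrightarrow> \<exists>M c. jexpansion B L k f g M c"
  shows "mform_base (k + real (msum p)) G (rho_res \<rho>) (Dop B e k f p)"
  unfolding mform_base_def
proof (intro conjI ballI)
  show "vholo_on Hset (Dop B e k f p)"
    unfolding vholo_on_def
  proof
    fix m
    show "(\<lambda>\<tau>. Dop B e k f p \<tau> $ m) holomorphic_on Hset"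
      by (rule exp_series_holomorphic [OF open_Hset]) (rule Dop_jseries [OF B f])
  qed
next
  fix g \<tau> assume g: "g \<in> Mp_pre G" and \<tau>: "\<tau> \<in> Hset"
  obtain a b c' d \<epsilon> where g': "g = ((a,b,c',d), \<epsilon>)" "a * d - b * c' = 1" "\<epsilon> \<in> {1, -1}"
    using g G by (auto simp: Mp_pre_def SL2Z_def)
  have el: "metaplectic_element a b c' d \<epsilon> k"
    using g' k by unfold_locales auto
  have j: "(g, (0, 0, 1)) \<in> JG G L" "(g, (0, 0, 1)) \<in> JG SL2Z L"
    using g G L by (auto simp: JG_def Mp_pre_def)
  obtain M c where "jexpansion B L k f (g, (0, 0, 1)) M c" using ex [OF j(2)] by blast
  hence s: "jseries B (jidx B L M) c (jslash B k (g, (0, 0, 1)) f)" by (rule jexpansion_jseries)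
  have "mslash (k + real (msum p)) g (Dop B e k f p) \<tau> = Dop B e k (jslash B k (g, (0, 0, 1)) f) p \<tau>"
    using Dop_covariant [OF el B f _ \<tau>] s unfolding g'(1) by metis
  also have "\<dots> = \<rho> (g, (0, 0, 1)) *v Dop B e k f p \<tau>"
    by (rule Dop_matrix_mult [OF B f _ \<tau>]) (use base j(1) in \<open>auto simp: jacobi_base_def\<close>)
  finally show "mslash (k + real (msum p)) g (Dop B e k f p) \<tau> = rho_res \<rho> g *v Dop B e k f p \<tau>"
    by (simp add: rho_res_def)
qed

lemma jslash_one:
  fixes f :: "complex \<Rightarrow> complex^'n \<Rightarrow> complex^'m"
  shows "jslash B k ((sl2_one, 1), (v, w, 1)) f \<tau> z =
     ee (\<tau> * of_real (Qr B v) + Bc B (cvec v) z + of_real (B v w) / 2) *s f \<tau> (z + \<tau> *s cvec v + cvec w)"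
  by (simp add: sl2_one_def Let_def wpow_def)

lemma jseries_of_expansion:
  assumes B: "bilinear B" and L: "0 \<in> L"
    and ex: "\<And>g. g \<in> JG SL2Z L \<Longrightarrow> \<exists>M c. jexpansion B L k f g M c \<and> P M c"
  shows "\<exists>M c. M > 0 \<and> jseries B (jidx B L M) c f \<and> P M c"
proof -
  have "((sl2_one, 1), (0, 0, 1)) \<in> JG SL2Z L"
    using L by (auto simp: JG_def Mp_pre_def SL2Z_def sl2_one_def)
  then obtain M c where ex': "jexpansion B L k f ((sl2_one, 1), (0, 0, 1)) M c" "P M c" using ex by blast
  have "jslash B k ((sl2_one, 1), (0, 0, 1)) f \<tau> z = f \<tau> z" for \<tau> z
  proof -
    have "cvec (0 :: real^'a) = 0" by (simp add: cvec_def vec_eq_iff)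
    thus ?thesis unfolding jslash_one using bilinear_lzero [OF B] by (simp add: Qr_def Bc_def)
  qed
  hence "jseries B (jidx B L M) c f" using jexpansion_jseries [OF ex'(1)] by (simp add: jseries_def)
  thus ?thesis using ex' by (auto simp: jexpansion_def)
qed

section \<open>Theta series\<close>

lemma pdi_exp_series:
  fixes b :: "'i \<Rightarrow> 'n::finite \<Rightarrow> real"
  assumes "\<And>z::complex^'n. ((\<lambda>i. a i * ee (\<Sum>l\<in>UNIV. z $ l * of_real (b i l))) has_sum f z) I"
  shows "((\<lambda>i. (a i * (2 * of_real pi * \<i> * of_real (b i l))) * ee (\<Sum>l\<in>UNIV. z $ l * of_real (b i l))) has_sum pdi l f z) I"
proof -
  let ?z = "\<lambda>w. \<chi> j. if j = l then w else z $ j"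
  let ?A = "\<lambda>i. a i * ee (\<Sum>j\<in>UNIV - {l}. z $ j * of_real (b i j))"
  have split: "a i * ee (\<Sum>j\<in>UNIV. ?z w $ j * of_real (b i j)) = ?A i * ee (of_real (b i l) * w)" for i w
  proof -
    have "(\<Sum>j\<in>UNIV. ?z w $ j * of_real (b i j)) = w * of_real (b i l) + (\<Sum>j\<in>UNIV - {l}. z $ j * of_real (b i j))"
      by (subst sum.remove [of _ l]) auto
    thus ?thesis by (simp add: ee_add mult_ac)
  qed
  have "((\<lambda>i. ?A i * ee (of_real (b i l) * w)) has_sum f (?z w)) I" for w
    using assms [of "?z w"] by (simp only: split)
  from exp_series_termwise_deriv [OF open_UNIV UNIV_I this]
  obtain D where D: "((\<lambda>w. f (?z w)) has_field_derivative D) (at (z $ l))"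
     "((\<lambda>i. 2 * of_real pi * \<i> * of_real (b i l) * ?A i * ee (of_real (b i l) * z $ l)) has_sum D) I" by blast
  have "D = pdi l f z" unfolding pdi_def using DERIV_imp_deriv [OF D(1)] by simp
  moreover have "?z (z $ l) = z" by (simp add: vec_eq_iff)
  ultimately have "2 * of_real pi * \<i> * of_real (b i l) * ?A i * ee (of_real (b i l) * z $ l) =
      (a i * (2 * of_real pi * \<i> * of_real (b i l))) * ee (\<Sum>l\<in>UNIV. z $ l * of_real (b i l))" for i
    using arg_cong [OF split [of i "z $ l"], of "(*) (2 * of_real pi * \<i> * of_real (b i l))"] by (simp only: mult_ac)
  with D(2) \<open>D = pdi l f z\<close> show ?thesis by (simp only:)
qed

lemma pdi_funpow_exp_series:
  fixes b :: "'i \<Rightarrow> 'n::finite \<Rightarrow> real"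
  assumes "\<And>z::complex^'n. ((\<lambda>i. a i * ee (\<Sum>l\<in>UNIV. z $ l * of_real (b i l))) has_sum f z) I"
  shows "((\<lambda>i. (a i * (2 * of_real pi * \<i> * of_real (b i l)) ^ r) * ee (\<Sum>l\<in>UNIV. z $ l * of_real (b i l))) has_sum (pdi l ^^ r) f z) I"
proof (induction r arbitrary: z)
  case (Suc r)
  show ?case using pdi_exp_series [OF Suc, of l z] by (simp add: mult_ac)
qed (use assms in simp)

lemma fold_pdi_exp_series:
  fixes b :: "'i \<Rightarrow> 'n::finite \<Rightarrow> real"
  assumes "distinct xs"
    and "\<And>z::complex^'n. ((\<lambda>i. a i * ee (\<Sum>l\<in>UNIV. z $ l * of_real (b i l))) has_sum f z) I"
  shows "((\<lambda>i. (a i * (\<Prod>l\<in>set xs. (2 * of_real pi * \<i> * of_real (b i l)) ^ p l)) * ee (\<Sum>l\<in>UNIV. z $ l * of_real (b i l)))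
     has_sum fold (\<lambda>i g. (pdi i ^^ p i) g) xs f z) I"
  using assms
proof (induction xs arbitrary: a f)
  case (Cons x xs)
  have "distinct xs" "x \<notin> set xs" using Cons.prems by auto
  from Cons.IH [OF this(1) pdi_funpow_exp_series [where l = x and r = "p x", OF Cons.prems(2)]] this(2)
  show ?case by (simp add: mult.assoc)
qed simp

text \<open>Termwise differentiation multiplies each summand by one product over all coordinates, so
  the arbitrary order chosen in \<open>enum_idx\<close> does not matter; the factorials convert
  Taylor coefficients into derivatives at 0.\<close>

lemma pderivs_exp_series:
  fixes b :: "'i \<Rightarrow> 'n::finite \<Rightarrow> real"
  assumes "\<And>z::complex^'n. ((\<lambda>i. a i * ee (\<Sum>l\<in>UNIV. z $ l * of_real (b i l))) has_sum f z) I"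
  shows "((\<lambda>i. (\<Prod>l\<in>UNIV. fact (p l)) * (a i * mono_fact p (b i))) has_sum pderivs p f 0) I"
proof -
  have "\<exists>xs::'n list. distinct xs \<and> set xs = UNIV"
    using finite_distinct_list [of "UNIV :: 'n set"] by auto
  hence e: "distinct (enum_idx :: 'n list)" "set (enum_idx :: 'n list) = UNIV"
    unfolding enum_idx_def using someI_ex by (metis (mono_tags, lifting))+
  have "(\<Prod>l\<in>UNIV. fact (p l)) * mono_fact p (b i) = (\<Prod>l\<in>UNIV. (2 * of_real pi * \<i> * of_real (b i l)) ^ p l)" for i
    unfolding mono_fact_def prod.distrib [symmetric] by simp
  thus ?thesis
    using fold_pdi_exp_series [where p = p and z = 0, OF e(1) assms] unfolding pderivs_def e(2)
    by (simp add: mult.left_commute)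
qed

section \<open>Determinants and Cramer's rule\<close>

lemma detL_equal_columns:
  assumes ab: "a < d" "b < d" "a \<noteq> b" and eq: "\<And>i. i < d \<Longrightarrow> A i a = A i b"
  shows "detL d A = 0"
proof -
  define T where "T = Transposition.transpose a b"
  have T: "T permutes {..<d}" using ab by (auto simp: T_def intro: permutes_swap_id)
  have AT: "A i (T j) = A i j" if "i < d" for i j
    using eq [OF that] by (auto simp: T_def Transposition.transpose_def)
  \<comment> \<open>Composition with the transposition is an involution of the permutations; it
    keeps every product, as the two columns agree, and reverses every sign.\<close>
  have "detL d A = (\<Sum>\<sigma>\<in>{\<sigma>. \<sigma> permutes {..<d}}. of_int (sign (T \<circ> \<sigma>)) * (\<Prod>i<d. A i ((T \<circ> \<sigma>) i)))"
    unfolding detL_def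
    by (rule sum.reindex_bij_witness [of _ "\<lambda>\<sigma>. T \<circ> \<sigma>" "\<lambda>\<sigma>. T \<circ> \<sigma>"])
       (auto simp: T_def o_assoc intro!: permutes_compose [OF _ T [unfolded T_def]])
  also have "\<dots> = (\<Sum>\<sigma>\<in>{\<sigma>. \<sigma> permutes {..<d}}. - (of_int (sign \<sigma>) * (\<Prod>i<d. A i (\<sigma> i))))"
  proof (intro sum.cong refl)
    fix \<sigma> assume "\<sigma> \<in> {\<sigma>. \<sigma> permutes {..<d}}"
    hence \<sigma>: "\<sigma> permutes {..<d}" by simp
    have "sign (T \<circ> \<sigma>) = sign T * sign \<sigma>"
      by (intro sign_compose permutes_imp_permutation [OF _ T] permutes_imp_permutation [OF _ \<sigma>]) auto
    also have "sign T = -1" using ab by (simp add: T_def sign_swap_id)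
    finally have sg: "sign (T \<circ> \<sigma>) = -1 * sign \<sigma>" .
    show "of_int (sign (T \<circ> \<sigma>)) * (\<Prod>i<d. A i ((T \<circ> \<sigma>) i)) = - (of_int (sign \<sigma>) * (\<Prod>i<d. A i (\<sigma> i)))"
      unfolding sg using AT by simp
  qed
  also have "\<dots> = - detL d A" by (simp add: detL_def sum_negf)
  finally show ?thesis by simp
qed

text \<open>Cramer's rule: the determinant with column \<open>j0\<close> replaced by A x is det A
  times the entry of x at \<open>j0\<close>, by linearity and the vanishing for equal columns, and
  it is 0 because A x is.\<close>

lemma detL_kernel:
  assumes ker: "\<And>i. i < d \<Longrightarrow> (\<Sum>j<d. A i j * x j) = 0" and det: "detL d A \<noteq> 0" and j0: "j0 < d"
  shows "x j0 = 0"
proof -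
  define R where "R y = (\<lambda>i j. if j = j0 then y i else A i j)" for y :: "nat \<Rightarrow> complex"
  have lin: "detL d (R (\<lambda>i. \<Sum>j<d. A i j * x j)) = (\<Sum>j<d. x j * detL d (R (\<lambda>i. A i j)))"
  proof -
    have "of_int (sign \<sigma>) * (\<Prod>i<d. R (\<lambda>i. \<Sum>j<d. A i j * x j) i (\<sigma> i)) =
       (\<Sum>j<d. x j * (of_int (sign \<sigma>) * (\<Prod>i<d. R (\<lambda>i. A i j) i (\<sigma> i))))" if \<sigma>: "\<sigma> permutes {..<d}" for \<sigma>
    proof -
      have "j0 \<in> \<sigma> ` {..<d}" using permutes_image [OF \<sigma>] j0 by auto
      then obtain i0 where i0: "i0 < d" "\<sigma> i0 = j0" by auto
      have ne: "\<sigma> i \<noteq> j0" if "i \<noteq> i0" for i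
        using permutes_inj [OF \<sigma>] i0 that by (metis injD)
      have P: "(\<Prod>i<d. R y i (\<sigma> i)) = y i0 * (\<Prod>i\<in>{..<d} - {i0}. A i (\<sigma> i))" for y
      proof -
        have "(\<Prod>i<d. R y i (\<sigma> i)) = R y i0 (\<sigma> i0) * (\<Prod>i\<in>{..<d} - {i0}. R y i (\<sigma> i))"
          using i0 by (intro prod.remove) auto
        also have "(\<Prod>i\<in>{..<d} - {i0}. R y i (\<sigma> i)) = (\<Prod>i\<in>{..<d} - {i0}. A i (\<sigma> i))"
          by (intro prod.cong refl) (use ne in \<open>auto simp: R_def\<close>)
        finally show ?thesis by (simp add: R_def i0)
      qed
      show ?thesis unfolding P by (simp add: sum_distrib_left sum_distrib_right mult_ac)
    qed
    hence "detL d (R (\<lambda>i. \<Sum>j<d. A i j * x j)) = (\<Sum>\<sigma>\<in>{\<sigma>. \<sigma> permutes {..<d}}. \<Sum>j<d. x j * (of_int (sign \<sigma>) * (\<Prod>i<d. R (\<lambda>i. A i j) i (\<sigma> i))))"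
      unfolding detL_def by (intro sum.cong) auto
    also have "\<dots> = (\<Sum>j<d. x j * detL d (R (\<lambda>i. A i j)))"
      by (subst sum.swap) (simp add: detL_def sum_distrib_left)
    finally show ?thesis .
  qed
  have "detL d (R (\<lambda>i. A i j)) = 0" if "j < d" "j \<noteq> j0" for j
    by (rule detL_equal_columns [of j0 d j]) (use that j0 in \<open>auto simp: R_def\<close>)
  hence "(\<Sum>j<d. x j * detL d (R (\<lambda>i. A i j))) = (\<Sum>j<d. if j = j0 then x j0 * detL d (R (\<lambda>i. A i j0)) else 0)"
    by (intro sum.cong refl) auto
  also have "R (\<lambda>i. A i j0) = A" by (auto simp: R_def fun_eq_iff)
  finally have "(\<Sum>j<d. x j * detL d (R (\<lambda>i. A i j))) = x j0 * detL d A" using j0 by simp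
  moreover have "detL d (R (\<lambda>i. \<Sum>j<d. A i j * x j)) = 0"
  proof -
    have "(\<Prod>i<d. R (\<lambda>i. \<Sum>j<d. A i j * x j) i (\<sigma> i)) = 0" if \<sigma>: "\<sigma> permutes {..<d}" for \<sigma>
    proof -
      have "j0 \<in> \<sigma> ` {..<d}" using permutes_image [OF \<sigma>] j0 by auto
      then obtain i0 where "i0 < d" "\<sigma> i0 = j0" by auto
      thus ?thesis using ker by (intro prod_zero) (auto simp: R_def intro!: bexI[of _ i0])
    qed
    thus ?thesis unfolding detL_def by (intro sum.neutral) (simp del: prod_zero_iff)
  qed
  ultimately show ?thesis using lin det by simp
qed

section \<open>Lattice sums\<close>

lemma exp_abs_summable_int:
  assumes "\<gamma> > 0"
  shows "(\<lambda>m::int. exp (- \<gamma> * \<bar>real_of_int m\<bar>)) summable_on UNIV"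
proof -
  have g: "(\<lambda>n::nat. exp (- \<gamma> * real n)) summable_on UNIV"
  proof -
    have "summable (\<lambda>n. exp (- \<gamma>) ^ n)" using assms by (intro summable_geometric) auto
    hence "summable (\<lambda>n::nat. exp (- \<gamma> * real n))"
      by (simp add: exp_of_nat_mult [symmetric] mult_ac)
    thus ?thesis by (subst summable_on_UNIV_nonneg_real_iff) auto
  qed
  have "(\<lambda>m::int. exp (- \<gamma> * \<bar>real_of_int m\<bar>)) summable_on (range int)"
    using g by (subst summable_on_reindex) (auto simp: o_def)
  moreover have "(\<lambda>m::int. exp (- \<gamma> * \<bar>real_of_int m\<bar>)) summable_on (range (\<lambda>n. - int n))"
    using g by (subst summable_on_reindex) (auto simp: o_def inj_on_def)
  ultimately have "(\<lambda>m::int. exp (- \<gamma> * \<bar>real_of_int m\<bar>)) summable_on (range int \<union> range (\<lambda>n. - int n))"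
    by (rule summable_on_union)
  moreover have "range int \<union> range (\<lambda>n. - int n) = UNIV"
    by (auto simp: image_iff) (metis int_cases2)
  ultimately show ?thesis by simp
qed

text \<open>The coordinate map is linear and injective, hence bounded below; the norm of a lattice
  vector thus controls the sum of its absolute integer coordinates, and the majorant is a product of
  geometric series.\<close>

lemma exp_linear_summable_lattice:
  fixes bs :: "'n::finite \<Rightarrow> real^'n"
  assumes bs: "is_real_basis bs" and \<beta>: "\<beta> > 0"
  shows "(\<lambda>v. exp (- \<beta> * norm v)) summable_on ((\<lambda>l. t + l) ` {\<Sum>i\<in>UNIV. of_int (c i) *\<^sub>R bs i | c. True})"
proof -
  define F where "F x = (\<Sum>i\<in>UNIV. x $ i *\<^sub>R bs i)" for x :: "real^'n"
  have F: "linear F"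
    unfolding F_def by (intro linearI) (auto simp: scaleR_add_left sum.distrib scaleR_sum_right)
  have injF: "inj F"
  proof (rule linear_injective_0 [OF F, THEN iffD2], intro allI impI)
    fix x assume "F x = 0"
    hence "(\<Sum>v\<in>range bs. x $ (inv bs v) *\<^sub>R v) = 0"
      using bs by (subst sum.reindex) (auto simp: F_def is_real_basis_def)
    hence "x $ (inv bs v) = 0" if "v \<in> range bs" for v
      using bs that independentD [of "range bs" "range bs" "\<lambda>v. x $ (inv bs v)" v] by (auto simp: is_real_basis_def)
    hence "x $ i = 0" for i using bs by (metis is_real_basis_def inv_f_f rangeI)
    thus "x = 0" by (simp add: vec_eq_iff)
  qed
  obtain \<delta> where \<delta>: "\<delta> > 0" "\<And>x. norm (F x) \<ge> \<delta> * norm x"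
    using linear_inj_bounded_below_pos [OF F injF] by metis
  define N where "N = real CARD('n)"
  have N: "N > 0" by (simp add: N_def)
  \<comment> \<open>The factor 1/N pays for bounding the sum of the N absolute coordinates by N
    times the Euclidean norm, and \<delta> for passing to the lattice vector.\<close>
  define \<gamma> where "\<gamma> = \<beta> * \<delta> / N"
  have \<gamma>: "\<gamma> > 0" using \<beta> \<delta> N by (simp add: \<gamma>_def)
  define vec where "vec c = (\<chi> i. real_of_int (c i))" for c :: "'n \<Rightarrow> int"
  have s1: "(\<lambda>c::'n \<Rightarrow> int. norm (\<Prod>i\<in>UNIV. complex_of_real (exp (- \<gamma> * \<bar>real_of_int (c i)\<bar>)))) summable_on (PiE UNIV (\<lambda>_. UNIV))"
    by (rule abs_summable_prod_PiE) (use exp_abs_summable_int [OF \<gamma>] in simp)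
  hence s2: "(\<lambda>c::'n \<Rightarrow> int. exp (\<beta> * norm t) * exp (- \<gamma> * (\<Sum>i\<in>UNIV. \<bar>real_of_int (c i)\<bar>))) summable_on UNIV"
    by (intro summable_on_cmult_right) (simp add: prod_norm [symmetric] exp_sum sum_distrib_left sum_negf [symmetric])
  have "(\<lambda>c. exp (- \<beta> * norm (t + F (vec c)))) summable_on UNIV"
  proof (rule summable_on_comparison_test [OF s2])
    fix c :: "'n \<Rightarrow> int"
    have "\<bar>real_of_int (c i)\<bar> \<le> norm (vec c)" for i
      using component_le_norm_cart [of "vec c" i] by (simp add: vec_def)
    hence "(\<Sum>i\<in>UNIV. \<bar>real_of_int (c i)\<bar>) \<le> N * norm (vec c)"
      unfolding N_def using sum_bounded_above [of UNIV "\<lambda>i. \<bar>real_of_int (c i)\<bar>"] by auto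
    hence "\<gamma> * (\<Sum>i\<in>UNIV. \<bar>real_of_int (c i)\<bar>) \<le> \<gamma> * (N * norm (vec c))" using \<gamma> by (intro mult_left_mono) auto
    also have "\<dots> = \<beta> * (\<delta> * norm (vec c))" using N by (simp add: \<gamma>_def)
    also have "\<dots> \<le> \<beta> * norm (F (vec c))" using \<beta> \<delta> by (intro mult_left_mono) auto
    also have "norm (F (vec c)) \<le> norm (t + F (vec c)) + norm t"
      using norm_triangle_ineq4 [of "t + F (vec c)" t] by simp
    finally have "\<gamma> * (\<Sum>i\<in>UNIV. \<bar>real_of_int (c i)\<bar>) \<le> \<beta> * (norm (t + F (vec c)) + norm t)"
      using \<beta> by (simp add: mult_left_mono)
    thus "exp (- \<beta> * norm (t + F (vec c))) \<le> exp (\<beta> * norm t) * exp (- \<gamma> * (\<Sum>i\<in>UNIV. \<bar>real_of_int (c i)\<bar>))"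
      unfolding exp_add [symmetric] by (simp add: algebra_simps)
  qed auto
  moreover have "inj (\<lambda>c. t + F (vec c))"
  proof (rule injI)
    fix c c' assume "t + F (vec c) = t + F (vec c')"
    hence "vec c = vec c'" using injF by (auto dest: injD)
    thus "c = c'" by (simp add: vec_def vec_eq_iff fun_eq_iff)
  qed
  ultimately have "(\<lambda>v. exp (- \<beta> * norm v)) summable_on range (\<lambda>c. t + F (vec c))"
    by (subst summable_on_reindex) (auto simp: o_def)
  moreover have "range (\<lambda>c. t + F (vec c)) = (\<lambda>l. t + l) ` {\<Sum>i\<in>UNIV. of_int (c i) *\<^sub>R bs i | c. True}"
    by (auto simp: F_def vec_def image_iff)
  ultimately show ?thesis by simp
qed

lemma lattice_props:
  fixes L :: "(real^'n) set"
  assumes "is_lattice L"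
  shows "0 \<in> L" "x \<in> L \<Longrightarrow> y \<in> L \<Longrightarrow> x + y \<in> L" "x \<in> L \<Longrightarrow> - x \<in> L"
proof -
  obtain b :: "'n \<Rightarrow> real^'n" where L: "L = {\<Sum>i\<in>UNIV. of_int (c i) *\<^sub>R b i | c. True}"
    using assms unfolding is_lattice_def by blast
  show "0 \<in> L" unfolding L by (auto intro!: exI[of _ "\<lambda>_. 0"])
  show "x + y \<in> L" if "x \<in> L" "y \<in> L"
  proof -
    obtain c c' where "x = (\<Sum>i\<in>UNIV. of_int (c i) *\<^sub>R b i)" "y = (\<Sum>i\<in>UNIV. of_int (c' i) *\<^sub>R b i)"
      using \<open>x \<in> L\<close> \<open>y \<in> L\<close> unfolding L by blast
    hence "x + y = (\<Sum>i\<in>UNIV. of_int (c i + c' i) *\<^sub>R b i)"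
      by (simp add: scaleR_add_left sum.distrib)
    thus ?thesis unfolding L by (intro CollectI exI[of _ "\<lambda>i. c i + c' i"]) simp
  qed
  show "- x \<in> L" if "x \<in> L"
  proof -
    obtain c where "x = (\<Sum>i\<in>UNIV. of_int (c i) *\<^sub>R b i)" using \<open>x \<in> L\<close> unfolding L by blast
    hence "- x = (\<Sum>i\<in>UNIV. of_int (- c i) *\<^sub>R b i)" by (simp add: sum_negf)
    thus ?thesis unfolding L by (intro CollectI exI[of _ "\<lambda>i. - c i"]) simp
  qed
qed

lemma dual_lattice_add: "bilinear B \<Longrightarrow> s \<in> dual_lattice B L \<Longrightarrow> t \<in> dual_lattice B L \<Longrightarrow> s + t \<in> dual_lattice B L"
  by (auto simp: dual_lattice_def bilinear_ladd)

lemma dual_lattice_of_nat: "bilinear B \<Longrightarrow> s \<in> dual_lattice B L \<Longrightarrow> real M *\<^sub>R s \<in> dual_lattice B L"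
  by (auto simp: dual_lattice_def bilinear_lmul intro!: Ints_mult)

lemma dual_subset_tidx:
  assumes "bilinear B" "M > 0" shows "dual_lattice B L \<subseteq> tidx B L M"
proof
  fix s assume "s \<in> dual_lattice B L"
  thus "s \<in> tidx B L M" unfolding tidx_def
    using assms by (auto intro!: bexI[of _ "real M *\<^sub>R s"] dual_lattice_of_nat)
qed

lemma tidx_add:
  assumes "bilinear B" "M > 0" "t \<in> tidx B L M" "v \<in> dual_lattice B L"
  shows "t + v \<in> tidx B L M"
proof -
  obtain s where s: "s \<in> dual_lattice B L" "t = (1 / real M) *\<^sub>R s" using assms(3) by (auto simp: tidx_def)
  have "t + v = (1 / real M) *\<^sub>R (s + real M *\<^sub>R v)"
    using assms(2) by (simp add: s scaleR_add_right)
  moreover have "s + real M *\<^sub>R v \<in> dual_lattice B L"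
    by (intro dual_lattice_add dual_lattice_of_nat assms s)
  ultimately show ?thesis unfolding tidx_def by blast
qed

lemma jidx_mono:
  assumes B: "bilinear B" and M: "M > 0" and N: "N > 0"
  shows "jidx B L M \<subseteq> jidx B L (M * N)"
proof -
  have "n \<in> qidx (M * N)" if "n \<in> qidx M" for n
  proof -
    obtain a where a: "a \<in> \<int>" "n = a / real M" using \<open>n \<in> qidx M\<close> unfolding qidx_def by blast
    have "n = (a * real N) / real (M * N)" using M N a by (simp add: field_simps)
    moreover have "a * real N \<in> \<int>" using a by (auto intro: Ints_mult)
    ultimately show ?thesis unfolding qidx_def by blast
  qed
  moreover have "t \<in> tidx B L (M * N)" if "t \<in> tidx B L M" for t
  proof -
    obtain s where s: "s \<in> dual_lattice B L" "t = (1 / real M) *\<^sub>R s" using \<open>t \<in> tidx B L M\<close> by (auto simp: tidx_def)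
    have "t = (1 / real (M * N)) *\<^sub>R (real N *\<^sub>R s)" using M N s by simp
    thus ?thesis unfolding tidx_def using dual_lattice_of_nat [OF B s(1)] by blast
  qed
  ultimately show ?thesis unfolding jidx_eq by blast
qed

lemma Bc_add_right: "Bc B x (y + z) = Bc B x y + Bc B x z"
  by (simp add: Bc_def algebra_simps sum.distrib)

lemma Bc_add_left: "Bc B (x + y) z = Bc B x z + Bc B y z"
  by (simp add: Bc_def algebra_simps sum.distrib)

lemma Bc_scale_right: "Bc B x (c *s y) = c * Bc B x y"
  by (simp add: Bc_def sum_distrib_left mult_ac)

lemma Bc_cvec: "bilinear B \<Longrightarrow> Bc B (cvec v) (cvec w) = of_real (B v w)"
  by (subst bilinear_expand_axis, assumption) (simp add: Bc_def cvec_def)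

lemma cvec_add: "cvec (v + w) = cvec v + cvec w"
  by (simp add: cvec_def vec_eq_iff)

lemma cvec_0 [simp]: "cvec 0 = 0"
  by (simp add: cvec_def vec_eq_iff)

text \<open>If B(s - t, .) kills a basis it kills s - t itself, and B is positive definite. Distinct
  t thus give distinct characters, as uniqueness of expansions requires.\<close>

lemma basis_frequencies_inj:
  fixes B :: "real^'n \<Rightarrow> real^'n \<Rightarrow> real"
  assumes B: "pos_def_sym_bilinear B" and e: "is_real_basis e"
  shows "inj (\<lambda>t l. B t (e l))"
proof (rule injI)
  fix s t assume eq: "(\<lambda>l. B s (e l)) = (\<lambda>l. B t (e l))"
  have bil: "bilinear B" using B by (simp add: pos_def_sym_bilinear_def)
  have lin: "linear (B (s - t))" using bil by (simp add: bilinear_def)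
  have "B (s - t) x = 0" if "x \<in> range e" for x
    using that fun_cong [OF eq] by (auto simp: bilinear_lsub [OF bil])
  hence "B (s - t) x = 0" if "x \<in> span (range e)" for x
    using linear_eq_0_on_span [OF lin] that by blast
  hence "B (s - t) (s - t) = 0" using e by (simp add: is_real_basis_def)
  thus "s = t" using B unfolding pos_def_sym_bilinear_def by (metis less_irrefl right_minus_eq)
qed

lemma frequency_coeff_eq_0:
  fixes B :: "real^'n \<Rightarrow> real^'n \<Rightarrow> real"
  assumes B: "pos_def_sym_bilinear B" and e: "is_real_basis (e :: 'n \<Rightarrow> real^'n)"
    and zero: "\<And>z. ((\<lambda>t. a t * ee (Bc B (cvec t) z)) has_sum 0) T" and t: "t \<in> T"
  shows "a t = 0"
proof (rule character_sum_coeff_eq_0 [where b = "\<lambda>t l. B t (e l)", OF _ _ t])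
  have bil: "bilinear B" using B by (simp add: pos_def_sym_bilinear_def)
  show "inj_on (\<lambda>t l. B t (e l)) T"
    using basis_frequencies_inj [OF B e] inj_on_subset by blast
  fix \<theta> :: "'n \<Rightarrow> real"
  show "((\<lambda>i. a i * ee (of_real (\<Sum>l\<in>UNIV. \<theta> l * B i (e l)))) has_sum 0) T"
    using zero [of "coordv e (\<chi> l. of_real (\<theta> l))"] by (simp add: Bc_coordv [OF bil])
qed

text \<open>The form attains a positive minimum on the compact unit sphere, and scaling does the
  rest.\<close>

lemma pos_def_lower_bound:
  fixes B :: "real^'n \<Rightarrow> real^'n \<Rightarrow> real"
  assumes B: "pos_def_sym_bilinear B"
  shows "\<exists>\<kappa>>0. \<forall>v. \<kappa> * (norm v)\<^sup>2 \<le> Qr B v"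
proof -
  have bil: "bilinear B" using B by (simp add: pos_def_sym_bilinear_def)
  have cont: "continuous_on (sphere 0 1) (\<lambda>v. B v v)"
    by (intro bounded_bilinear.continuous_on [OF bilinear_conv_bounded_bilinear [THEN iffD1, OF bil]] continuous_intros)
  have ne: "sphere (0 :: real^'n) 1 \<noteq> {}" by simp
  obtain u where u: "u \<in> sphere 0 1" "\<And>v. v \<in> sphere 0 1 \<Longrightarrow> B u u \<le> B v v"
    using continuous_attains_inf [OF compact_sphere ne cont] by blast
  have "u \<noteq> 0" using u by auto
  hence pos: "B u u > 0" using B by (simp add: pos_def_sym_bilinear_def)
  have "B u u * (norm v)\<^sup>2 \<le> B v v" for v
  proof (cases "v = 0")
    case True
    thus ?thesis by (simp add: bilinear_lzero [OF bil])
  next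
    case False
    have "B u u \<le> B (v /\<^sub>R norm v) (v /\<^sub>R norm v)" using False by (intro u(2)) simp
    also have "\<dots> = B v v / (norm v)\<^sup>2"
      by (simp add: bilinear_lmul [OF bil] bilinear_rmul [OF bil] power2_eq_square divide_inverse)
    finally show ?thesis using False by (simp add: field_simps)
  qed
  thus ?thesis using pos by (intro exI[of _ "B u u / 2"]) (simp add: Qr_def)
qed

text \<open>The quadratic decay from Im \<tau> > 0 absorbs the linear growth in v of the exponent
  that a complex z causes.\<close>

lemma theta_summable:
  fixes B :: "real^'n \<Rightarrow> real^'n \<Rightarrow> real"
  assumes B: "pos_def_sym_bilinear B" and L: "is_lattice L" and \<tau>: "\<tau> \<in> Hset"
  shows "(\<lambda>v. ee (\<tau> * of_real (Qr B v) + Bc B (cvec v) z)) summable_on (\<lambda>l. t + l) ` L"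
proof -
  have bil: "bilinear B" using B by (simp add: pos_def_sym_bilinear_def)
  obtain \<kappa> where \<kappa>: "\<kappa> > 0" "\<And>v. \<kappa> * (norm v)\<^sup>2 \<le> Qr B v" using pos_def_lower_bound [OF B] by blast
  define y where "y = Im \<tau>"
  have y: "y > 0" using \<tau> by (simp add: y_def Hset_def)
  define Z where "Z = (\<chi> i. Im (z $ i))"
  have ImB: "Im (Bc B (cvec v) z) = B v Z" for v
    by (subst bilinear_expand_axis [OF bil]) (simp add: Bc_def cvec_def Z_def)
  have "\<exists>C. \<forall>v. norm (B v Z) \<le> norm v * C"
    by (rule bounded_linear.bounded, rule bounded_bilinear.bounded_linear_left)
       (use bil in \<open>simp add: bilinear_conv_bounded_bilinear\<close>)
  then obtain C where C: "\<And>v. \<bar>B v Z\<bar> \<le> norm v * C" unfolding real_norm_def by blast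
  define \<alpha> where "\<alpha> = 2 * pi * y * \<kappa>"
  have \<alpha>: "\<alpha> > 0" using y \<kappa> by (simp add: \<alpha>_def)
  \<comment> \<open>The summand 1 is spare: after completing the square it leaves the factor exp(-
    norm v), which is summable over the lattice.\<close>
  define D where "D = 2 * pi * C + 1"
  have quad: "D * x \<le> \<alpha> * x\<^sup>2 + D\<^sup>2 / (4 * \<alpha>)" for x
  proof -
    have "0 \<le> (2 * \<alpha> * x - D)\<^sup>2 / (4 * \<alpha>)" using \<alpha> by simp
    also have "\<dots> = \<alpha> * x\<^sup>2 - D * x + D\<^sup>2 / (4 * \<alpha>)"
      using \<alpha> by (simp add: power2_eq_square field_simps)
    finally show ?thesis by simp
  qed
  obtain bs where bs: "is_real_basis bs" "L = {\<Sum>i\<in>UNIV. of_int (c i) *\<^sub>R bs i | c. True}"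
    using L unfolding is_lattice_def by blast
  have s: "(\<lambda>v. exp (D\<^sup>2 / (4 * \<alpha>)) * exp (- 1 * norm v)) summable_on (\<lambda>l. t + l) ` L"
    unfolding bs(2) by (intro summable_on_cmult_right exp_linear_summable_lattice bs(1)) simp
  have "(\<lambda>v. norm (ee (\<tau> * of_real (Qr B v) + Bc B (cvec v) z))) summable_on (\<lambda>l. t + l) ` L"
  proof (rule summable_on_comparison_test [OF s])
    fix v
    have "\<alpha> * (norm v)\<^sup>2 \<le> 2 * pi * (y * Qr B v)"
      using mult_left_mono [OF \<kappa>(2) [of v], of "2 * pi * y"] y by (simp add: \<alpha>_def mult_ac)
    moreover have "- (2 * pi * B v Z) \<le> 2 * pi * (norm v * C)"
    proof -
      have "- B v Z \<le> norm v * C" using C [of v] by linarith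
      from mult_left_mono [OF this, of "2 * pi"] show ?thesis by simp
    qed
    moreover have "D * norm v = 2 * pi * (norm v * C) + norm v" by (simp add: D_def algebra_simps)
    ultimately have "- (2 * pi * (y * Qr B v + B v Z)) \<le> D\<^sup>2 / (4 * \<alpha>) - norm v"
      using quad [of "norm v"] by (simp add: algebra_simps)
    thus "norm (ee (\<tau> * of_real (Qr B v) + Bc B (cvec v) z)) \<le> exp (D\<^sup>2 / (4 * \<alpha>)) * exp (- 1 * norm v)"
      by (simp add: norm_ee ImB y_def [symmetric] exp_add [symmetric])
  qed auto
  thus ?thesis by (rule abs_summable_summable)
qed

text \<open>The Taylor coefficient at z = 0 of the theta series in the coordinates of
  \<open>e\<close>; it differs from the partial derivative by the factorials of q.\<close>

definition theta_coeff :: "(real^'n \<Rightarrow> real^'n \<Rightarrow> real) \<Rightarrow> (real^'n) set \<Rightarrow> ('n \<Rightarrow> real^'n) \<Rightarrow> real^'n \<Rightarrow> ('n \<Rightarrow> nat) \<Rightarrow> complex \<Rightarrow> complex" where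
  "theta_coeff B L e t q \<tau> = (\<Sum>\<^sub>\<infinity>v\<in>(\<lambda>l. t + l) ` L. mono_fact q (\<lambda>l. B v (e l)) * ee (of_real (Qr B v) * \<tau>))"

lemma theta_coeff_has_sum:
  fixes B :: "real^'n \<Rightarrow> real^'n \<Rightarrow> real"
  assumes B: "pos_def_sym_bilinear B" and L: "is_lattice L" and \<tau>: "\<tau> \<in> Hset"
  shows "((\<lambda>v. mono_fact q (\<lambda>l. B v (e l)) * ee (of_real (Qr B v) * \<tau>)) has_sum theta_coeff B L e t q \<tau>) ((\<lambda>l. t + l) ` L)"
    and "pderivs q (\<lambda>z. theta B L t \<tau> (coordv e z)) 0 = (\<Prod>l\<in>UNIV. fact (q l)) * theta_coeff B L e t q \<tau>"
proof -
  have bil: "bilinear B" using B by (simp add: pos_def_sym_bilinear_def)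
  have th: "((\<lambda>v. ee (of_real (Qr B v) * \<tau>) * ee (\<Sum>l\<in>UNIV. z $ l * of_real (B v (e l)))) has_sum theta B L t \<tau> (coordv e z)) ((\<lambda>l. t + l) ` L)" for z
    using has_sum_infsum [OF theta_summable [OF B L \<tau>, of "coordv e z" t]]
    by (simp add: theta_def ee_add Bc_coordv [OF bil] mult_ac)
  have th': "((\<lambda>v. ee (of_real (Qr B v) * \<tau>) * ee (\<Sum>l\<in>UNIV. z l * of_real (B v (e l)))) has_sum theta B L t \<tau> (coordv e (\<chi> l. z l))) ((\<lambda>l. t + l) ` L)" for z
    using th [of "\<chi> l. z l"] by simp
  show 1: "((\<lambda>v. mono_fact q (\<lambda>l. B v (e l)) * ee (of_real (Qr B v) * \<tau>)) has_sum theta_coeff B L e t q \<tau>) ((\<lambda>l. t + l) ` L)"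
    unfolding theta_coeff_def
    using exp_series_taylor(1) [OF th', of q] by (intro has_sum_infsum) (simp add: mult.commute)
  show "pderivs q (\<lambda>z. theta B L t \<tau> (coordv e z)) 0 = (\<Prod>l\<in>UNIV. fact (q l)) * theta_coeff B L e t q \<tau>"
    by (rule has_sum_unique [OF pderivs_exp_series [OF th, of q]])
       (use has_sum_cmult_right [OF 1, of "\<Prod>l\<in>UNIV. fact (q l)"] in \<open>simp add: mult_ac\<close>)
qed

lemma theta_coeff_holomorphic:
  assumes "pos_def_sym_bilinear B" "is_lattice L"
  shows "theta_coeff B L e t q holomorphic_on Hset"
  by (rule exp_series_holomorphic [OF open_Hset]) (rule theta_coeff_has_sum(1) [OF assms])

section \<open>Theta decomposition and injectivity\<close>

text \<open>At fixed \<tau> all powers of q are folded into one coefficient G(u) for each frequency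
  u. Periodicity in w makes G vanish off the dual lattice, and quasi-periodicity in v makes G(u)
  e(-\<tau> Q(u)) constant on cosets of L; these constants are the F_j.\<close>

lemma theta_decomposition:
  fixes B :: "real^'n \<Rightarrow> real^'n \<Rightarrow> real" and f :: "complex \<Rightarrow> complex^'n \<Rightarrow> complex^'m" and d :: nat
  assumes B: "pos_def_sym_bilinear B" and L: "integral_lattice B L" and e: "is_real_basis e" and M: "M > 0"
    and s: "jseries B (jidx B L M) c f" and \<tau>: "\<tau> \<in> Hset"
    and per: "\<And>z w. w \<in> L \<Longrightarrow> f \<tau> (z + cvec w) = f \<tau> z"
    and qper: "\<And>z v. v \<in> L \<Longrightarrow> ee (\<tau> * of_real (Qr B v) + Bc B (cvec v) z) *s f \<tau> (z + \<tau> *s cvec v) = f \<tau> z"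
    and t: "\<forall>j<d. t j \<in> dual_lattice B L"
    and t_bij: "bij_betw (\<lambda>j. (\<lambda>l. t j + l) ` L) {..<d} (lat_cosets B L)"
  shows "\<exists>F. (\<forall>q. taylor_coeffs e f \<tau> q $ m = (\<Sum>j<d. F j * theta_coeff B L e (t j) q \<tau>)) \<and>
     ((\<forall>j<d. F j = 0) \<longrightarrow> (\<forall>z. f \<tau> z $ m = 0))"
proof -
  have bil: "bilinear B" and sym: "\<And>v w. B v w = B w v" using B by (auto simp: pos_def_sym_bilinear_def)
  have lat: "is_lattice L" and intg: "\<And>v w. v \<in> L \<Longrightarrow> w \<in> L \<Longrightarrow> B v w \<in> \<int>"
    using L by (auto simp: integral_lattice_def)
  have Ldual: "L \<subseteq> dual_lattice B L" using intg by (auto simp: dual_lattice_def)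
  define T where "T = tidx B L M"
  define G where "G u = (\<Sum>\<^sub>\<infinity>n\<in>qidx M. c (n, u) $ m * ee (of_real n * \<tau>))" for u
  have base: "((\<lambda>(u, n). c (n, u) $ m * ee (of_real n * \<tau>) * ee (Bc B (cvec u) z)) has_sum f \<tau> z $ m) (T \<times> qidx M)" for z
  proof -
    have "(jterm B c \<tau> z has_sum f \<tau> z) (qidx M \<times> T)"
      using s \<tau> by (auto simp: jseries_def jidx_eq T_def)
    hence "((\<lambda>x. jterm B c \<tau> z x $ m) has_sum f \<tau> z $ m) (qidx M \<times> T)" by (simp add: has_sum_vec_nth)
    hence "((\<lambda>(u, n). jterm B c \<tau> z (n, u) $ m) has_sum f \<tau> z $ m) (T \<times> qidx M)"
      by (subst (asm) has_sum_swap)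
    thus ?thesis by (simp add: jterm_def mult_ac)
  qed
  have G: "((\<lambda>n. c (n, u) $ m * ee (of_real n * \<tau>)) has_sum G u) (qidx M)" if "u \<in> T" for u
  proof -
    have "Bc B x 0 = 0" for x by (simp add: Bc_def)
    hence "(\<lambda>(u, n). c (n, u) $ m * ee (of_real n * \<tau>)) summable_on (T \<times> qidx M)"
      using has_sum_imp_summable [OF base [of 0]] by simp
    from summable_on_SigmaD1 [OF this that] show ?thesis unfolding G_def by (rule has_sum_infsum)
  qed
  have Gz: "((\<lambda>u. G u * ee (Bc B (cvec u) z)) has_sum f \<tau> z $ m) T" for z
  proof (rule has_sum_SigmaD [OF base])
    fix u assume "u \<in> T"
    from has_sum_cmult_right [OF G [OF this], of "ee (Bc B (cvec u) z)"]
    show "((\<lambda>n. case (u, n) of (u, n) \<Rightarrow> c (n, u) $ m * ee (of_real n * \<tau>) * ee (Bc B (cvec u) z)) has_sum G u * ee (Bc B (cvec u) z)) (qidx M)"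
      by (simp add: mult_ac)
  qed
  have Gq: "((\<lambda>u. G u * mono_fact q (\<lambda>l. B u (e l))) has_sum taylor_coeffs e f \<tau> q $ m) T" for q
  proof (rule has_sum_SigmaD)
    have "((\<lambda>nt. mono_fact q (\<lambda>l. B (snd nt) (e l)) * c nt $ m * ee (of_real (fst nt) * \<tau>))
           has_sum taylor_coeffs e f \<tau> q $ m) (qidx M \<times> T)"
      using taylor_coeffs_jseries(1) [OF bil s \<tau>, of q e m] by (simp add: jidx_eq T_def)
    thus "((\<lambda>(u, n). mono_fact q (\<lambda>l. B u (e l)) * c (n, u) $ m * ee (of_real n * \<tau>)) has_sum taylor_coeffs e f \<tau> q $ m) (T \<times> qidx M)"
      by (subst (asm) has_sum_swap) simp
    fix u assume "u \<in> T"
    from has_sum_cmult_right [OF G [OF this], of "mono_fact q (\<lambda>l. B u (e l))"]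
    show "((\<lambda>n. case (u, n) of (u, n) \<Rightarrow> mono_fact q (\<lambda>l. B u (e l)) * c (n, u) $ m * ee (of_real n * \<tau>)) has_sum G u * mono_fact q (\<lambda>l. B u (e l))) (qidx M)"
      by (simp add: mult_ac)
  qed
  have Gdual: "u \<in> dual_lattice B L" if u: "u \<in> T" and nz: "G u \<noteq> 0" for u
    unfolding dual_lattice_def
  proof (intro CollectI ballI)
    fix w assume w: "w \<in> L"
    have "G u * (ee (of_real (B u w)) - 1) = 0"
    proof (rule frequency_coeff_eq_0 [OF B e _ u, where a = "\<lambda>u. G u * (ee (of_real (B u w)) - 1)"])
      fix z
      have "((\<lambda>u. G u * ee (Bc B (cvec u) (z + cvec w)) - G u * ee (Bc B (cvec u) z)) has_sum f \<tau> z $ m - f \<tau> z $ m) T"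
        using has_sum_minus [OF Gz [of "z + cvec w"] Gz [of z]] unfolding per [OF w] .
      thus "((\<lambda>u. G u * (ee (of_real (B u w)) - 1) * ee (Bc B (cvec u) z)) has_sum 0) T"
        by (simp add: Bc_add_right Bc_cvec [OF bil] ee_add algebra_simps)
    qed
    hence "ee (of_real (B u w)) = 1" using nz by simp
    hence "complex_of_real (B u w) \<in> \<int>" by (simp add: ee_eq_1_iff)
    thus "B u w \<in> \<int>" by (metis Ints_cases Ints_of_int of_real_eq_iff of_real_of_int_eq)
  qed
  have Gshift: "G (u + v) = G u * ee (\<tau> * of_real (B u v + Qr B v))" if u: "u \<in> T" and v: "v \<in> L" for u v
  proof -
    have Tadd: "x + y \<in> T" if "x \<in> T" "y \<in> L" for x y
      using tidx_add [OF bil M] that Ldual by (auto simp: T_def)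
    have mv: "- v \<in> L" by (rule lattice_props(3) [OF lat v])
    \<comment> \<open>The coefficients of the expansion after translation by \<tau> v, reindexed by
      u \<mapsto> u + v; uniqueness forces them to agree with G.\<close>
    define H where "H u = G (u - v) * ee (\<tau> * of_real (B (u - v) v + Qr B v))" for u
    have "G (u + v) - H (u + v) = 0"
    proof (rule frequency_coeff_eq_0 [OF B e _ Tadd [OF u v], where a = "\<lambda>u. G u - H u"])
      fix z
      have "((\<lambda>u. ee (\<tau> * of_real (Qr B v) + Bc B (cvec v) z) * (G u * ee (Bc B (cvec u) (z + \<tau> *s cvec v)))) has_sum
         ee (\<tau> * of_real (Qr B v) + Bc B (cvec v) z) * f \<tau> (z + \<tau> *s cvec v) $ m) T"
        by (intro has_sum_cmult_right Gz)
      also have "ee (\<tau> * of_real (Qr B v) + Bc B (cvec v) z) * f \<tau> (z + \<tau> *s cvec v) $ m = f \<tau> z $ m"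
        using arg_cong [OF qper [OF v, of z], of "\<lambda>x. x $ m"] by simp
      also have "(\<lambda>u. ee (\<tau> * of_real (Qr B v) + Bc B (cvec v) z) * (G u * ee (Bc B (cvec u) (z + \<tau> *s cvec v)))) =
         (\<lambda>u. H (u + v) * ee (Bc B (cvec (u + v)) z))"
        by (simp add: H_def fun_eq_iff Bc_add_right Bc_add_left cvec_add Bc_scale_right Bc_cvec [OF bil] ee_add distrib_left mult_ac)
      finally have "((\<lambda>u. H u * ee (Bc B (cvec u) z)) has_sum f \<tau> z $ m) T"
        by (rule has_sum_reindex_bij_betw [THEN iffD1, rotated, of _ "\<lambda>u. u + v"])
           (rule bij_betwI [of _ _ _ "\<lambda>u. u + (- v)"],
            use Tadd [OF _ v] Tadd [OF _ mv] in \<open>auto simp del: add_uminus_conv_diff\<close>)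
      from has_sum_minus [OF Gz [of z] this]
      show "((\<lambda>u. (G u - H u) * ee (Bc B (cvec u) z)) has_sum 0) T" by (simp add: algebra_simps)
    qed
    thus ?thesis by (simp add: H_def)
  qed
  define F where "F j = G (t j) * ee (- (\<tau> * of_real (Qr B (t j))))" for j
  have tT: "t j \<in> T" if "j < d" for j using t that dual_subset_tidx [OF bil M] by (auto simp: T_def)
  have GF: "G u = F j * ee (of_real (Qr B u) * \<tau>)" if j: "j < d" and u: "u \<in> (\<lambda>l. t j + l) ` L" for u j
  proof -
    obtain v where v: "v \<in> L" "u = t j + v" using u by auto
    have Q: "Qr B u = Qr B (t j) + (B (t j) v + Qr B v)"
      unfolding v(2) Qr_def by (simp add: bilinear_ladd [OF bil] bilinear_radd [OF bil] sym [of v "t j"] field_simps)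
    have "G u = G (t j) * ee (\<tau> * of_real (B (t j) v + Qr B v))" unfolding v(2) by (rule Gshift [OF tT [OF j] v(1)])
    also have "ee (\<tau> * of_real (B (t j) v + Qr B v)) = ee (- (\<tau> * of_real (Qr B (t j)))) * ee (of_real (Qr B u) * \<tau>)"
      unfolding ee_add [symmetric] Q by (rule arg_cong [where f = ee]) (simp add: algebra_simps)
    finally show ?thesis by (simp add: F_def)
  qed
  have cover: "(\<Union>j<d. (\<lambda>l. t j + l) ` L) = dual_lattice B L"
  proof -
    have img: "(\<lambda>j. (\<lambda>l. t j + l) ` L) ` {..<d} = lat_cosets B L" using t_bij by (simp add: bij_betw_def)
    have "(\<Union>j<d. (\<lambda>l. t j + l) ` L) = \<Union> (lat_cosets B L)" using img by metis
    also have "\<dots> = dual_lattice B L"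
    proof
      show "\<Union> (lat_cosets B L) \<subseteq> dual_lattice B L"
        using dual_lattice_add [OF bil] Ldual by (auto simp: lat_cosets_def)
      show "dual_lattice B L \<subseteq> \<Union> (lat_cosets B L)"
      proof
        fix x assume "x \<in> dual_lattice B L"
        moreover have "x \<in> (\<lambda>l. x + l) ` L" using lattice_props(1) [OF lat] by (auto intro!: image_eqI[of _ _ 0])
        ultimately show "x \<in> \<Union> (lat_cosets B L)" unfolding lat_cosets_def by blast
      qed
    qed
    finally show ?thesis .
  qed
  have disj: "(\<lambda>l. t i + l) ` L \<inter> (\<lambda>l. t j + l) ` L = {}" if ij: "i < d" "j < d" "i \<noteq> j" for i j
  proof (rule ccontr)
    assume "(\<lambda>l. t i + l) ` L \<inter> (\<lambda>l. t j + l) ` L \<noteq> {}"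
    then obtain l1 l2 where l: "l1 \<in> L" "l2 \<in> L" "t i + l1 = t j + l2" by auto
    have "(\<lambda>l. t i + l) ` L = (\<lambda>l. t j + l) ` L"
    proof (intro equalityI image_subsetI)
      fix l assume "l \<in> L"
      hence "l + (l2 + - l1) \<in> L" "l + (l1 + - l2) \<in> L" by (intro lattice_props(2,3) [OF lat] l; assumption)+
      moreover have ti: "t i = t j + l2 - l1" using l(3) by (simp add: eq_diff_eq)
      have "t i + l = t j + (l + (l2 + - l1))" "t j + l = t i + (l + (l1 + - l2))"
        unfolding ti by simp_all
      ultimately show "t i + l \<in> (\<lambda>l. t j + l) ` L" "t j + l \<in> (\<lambda>l. t i + l) ` L" by blast+
    qed
    thus False using t_bij ij by (auto simp: bij_betw_def inj_on_def)
  qed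
  have "taylor_coeffs e f \<tau> q $ m = (\<Sum>j<d. F j * theta_coeff B L e (t j) q \<tau>)" for q
  proof -
    have "((\<lambda>u. G u * mono_fact q (\<lambda>l. B u (e l))) has_sum (\<Sum>j<d. F j * theta_coeff B L e (t j) q \<tau>)) (\<Union>j<d. (\<lambda>l. t j + l) ` L)"
    proof (rule sum_has_sum)
      fix j assume "j \<in> {..<d}"
      hence j: "j < d" by simp
      have "((\<lambda>u. F j * (mono_fact q (\<lambda>l. B u (e l)) * ee (of_real (Qr B u) * \<tau>))) has_sum F j * theta_coeff B L e (t j) q \<tau>) ((\<lambda>l. t j + l) ` L)"
        by (intro has_sum_cmult_right theta_coeff_has_sum(1) [OF B lat \<tau>])
      thus "((\<lambda>u. G u * mono_fact q (\<lambda>l. B u (e l))) has_sum F j * theta_coeff B L e (t j) q \<tau>) ((\<lambda>l. t j + l) ` L)"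
        by (rule has_sum_cong [THEN iffD1, rotated]) (simp add: GF [OF j] mult_ac)
    qed (use disj in auto)
    \<comment> \<open>The cosets exhaust only the dual lattice; on the rest of \<open>T\<close> the
      coefficient G is zero.\<close>
    hence "((\<lambda>u. G u * mono_fact q (\<lambda>l. B u (e l))) has_sum (\<Sum>j<d. F j * theta_coeff B L e (t j) q \<tau>)) T"
      unfolding cover
      by (rule has_sum_cong_neutral [THEN iffD1, rotated -1])
         (use Gdual dual_subset_tidx [OF bil M] in \<open>auto simp: T_def\<close>)
    thus ?thesis using Gq has_sum_unique by blast
  qed
  moreover have "f \<tau> z $ m = 0" if F0: "\<forall>j<d. F j = 0" for z
  proof -
    have "G u = 0" if u: "u \<in> T" for u
    proof (rule ccontr)
      assume nz: "G u \<noteq> 0"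
      hence "u \<in> (\<Union>j<d. (\<lambda>l. t j + l) ` L)" unfolding cover by (rule Gdual [OF u])
      then obtain j where "j < d" "u \<in> (\<lambda>l. t j + l) ` L" by auto
      thus False using GF F0 nz by simp
    qed
    hence "((\<lambda>u. G u * ee (Bc B (cvec u) z)) has_sum 0) T" by (intro has_sum_0) simp
    thus ?thesis using Gz has_sum_unique by blast
  qed
  ultimately show ?thesis by blast
qed

text \<open>A factor occurs only for s \<ge> 2, and then each factor is k + m with an integer m
  \<ge> 0; for s = 0 the lower end -1 does no harm because the product is empty.\<close>

lemma Dweight_0_nonzero:
  assumes "\<not> (k \<in> \<int> \<and> k \<le> 0)"
  shows "Dweight k s 0 \<noteq> 0"
proof
  assume z: "Dweight k s 0 = 0"
  then obtain n where n: "n < s div 2" "of_real k + of_int ((int s - 1) div 2) = (- of_nat n :: complex)"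
    unfolding Dweight_def pochhammer_eq_0_iff by auto
  define l where "l = (int s - 1) div 2"
  have l: "l \<ge> 0" using n(1) by (simp add: l_def)
  have "complex_of_real (k + of_int l) = of_real (- real n)" using n(2) by (simp add: l_def)
  hence "k + of_int l = - real n" by (simp only: of_real_eq_iff)
  hence k: "k = of_int (- l - int n)" by simp
  have "k \<in> \<int>" unfolding k by (rule Ints_of_int)
  moreover have "k \<le> 0" unfolding k using l by simp
  ultimately show False using assms by simp
qed

text \<open>A nonzero \<Lambda> leads to the index q - \<pi>(\<Lambda>) of smaller degree; the
  parity is unchanged because \<pi>(\<Lambda>) has degree 2 s(\<Lambda>), so the index stays in
  \<open>Phat P\<close>. The induction hypothesis removes these terms, and \<Lambda> = 0 isolates
  the Taylor coefficient itself.\<close>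

lemma taylor_coeffs_vanish_Phat:
  fixes f :: "complex \<Rightarrow> complex^'n \<Rightarrow> complex^'m"
  assumes B: "bilinear B" and k: "\<not> (k \<in> \<int> \<and> k \<le> 0)"
    and D: "\<And>q \<tau>. q \<in> Phat P \<Longrightarrow> \<tau> \<in> Hset \<Longrightarrow> Dop B e k f q \<tau> = 0"
    and q: "q \<in> Phat P" and \<tau>: "\<tau> \<in> Hset"
  shows "taylor_coeffs e f \<tau> q $ m = 0"
  using q \<tau>
proof (induction "msum q" arbitrary: q \<tau> rule: less_induct)
  case less
  let ?X = "\<lambda>\<Lambda>. gram_coeff B e \<Lambda> * Dweight k (msum q) (msumL \<Lambda>) *
        (if \<forall>i. piL \<Lambda> i \<le> q i then (deriv ^^ msumL \<Lambda>) (\<lambda>\<tau>. taylor_coeffs e f \<tau> (\<lambda>i. q i - piL \<Lambda> i) $ m) \<tau> else 0)"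
  have msumL0: "msumL \<Lambda> = 0 \<longleftrightarrow> \<Lambda> = (\<lambda>_ _. 0)" for \<Lambda> :: "'n \<Rightarrow> 'n \<Rightarrow> nat"
    by (auto simp: msumL_def fun_eq_iff)
  have X0: "?X \<Lambda> = 0" if \<Lambda>: "\<Lambda> \<noteq> (\<lambda>_ _. 0)" for \<Lambda>
  proof (cases "\<forall>i. piL \<Lambda> i \<le> q i")
    case True
    define r where "r i = q i - piL \<Lambda> i" for i
    have qr: "q = (\<lambda>i. r i + piL \<Lambda> i)" using True by (auto simp: r_def)
    hence ms: "msum q = msum r + 2 * msumL \<Lambda>"
      using msum_piL [of \<Lambda>] by (simp add: msum_def sum.distrib)
    have "msumL \<Lambda> > 0" using msumL0 \<Lambda> by (metis gr0I)
    hence lt: "msum r < msum q" using ms by simp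
    obtain p where p: "p \<in> P" "mle q p" using less.prems by (auto simp: Phat_def)
    have "mle r p" using p(2) True ms by (auto simp: mle_def r_def intro: order_trans [OF diff_le_self])
    hence "r \<in> Phat P" using p by (auto simp: Phat_def)
    \<comment> \<open>Vanishing is taken on the whole half plane and not at one point, since
      derivatives of these coefficients occur.\<close>
    hence z: "taylor_coeffs e f \<tau> r $ m = 0" if "\<tau> \<in> Hset" for \<tau>
      using less.hyps [OF lt] that by blast
    have "(deriv ^^ msumL \<Lambda>) (\<lambda>\<tau>. taylor_coeffs e f \<tau> r $ m) \<tau> = (deriv ^^ msumL \<Lambda>) (\<lambda>_. 0) \<tau>"
    proof (rule higher_deriv_transform_within_open [OF _ _ open_Hset less.prems(2)])
      show "(\<lambda>\<tau>. taylor_coeffs e f \<tau> r $ m) holomorphic_on Hset"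
        using z by (simp cong: holomorphic_cong)
    qed (use z in auto)
    thus ?thesis using True by (simp add: r_def [abs_def])
  qed auto
  have "(\<Sum>\<Lambda> | msumL \<Lambda> \<le> msum q div 2. ?X \<Lambda>) = (\<Sum>\<Lambda>\<in>{\<lambda>_ _. 0}. ?X \<Lambda>)"
    by (rule sum.mono_neutral_right [OF finite_msumL_le]) (use X0 in \<open>auto simp: msumL0 intro: order_trans [of _ 0]\<close>)
  also have "\<dots> = Dweight k (msum q) 0 * taylor_coeffs e f \<tau> q $ m"
    by (simp add: gram_coeff_def msumL_def piL_def)
  finally have "Dop B e k f q \<tau> $ m = 4 ^ (msum q div 2) * fact (msum q div 2) * (Dweight k (msum q) 0 * taylor_coeffs e f \<tau> q $ m)"
    by (simp only: Dop_component)
  thus ?case using D [OF less.prems] Dweight_0_nonzero [OF k] by simp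
qed

lemma Dcoeff_eq_0:
  assumes "\<And>t. t \<in> tidx B L M \<Longrightarrow> Dpoly B e k p (n, t) = 0 \<or> c (n, t) = 0"
  shows "Dcoeff B L e k p M c n = 0"
proof -
  have "(\<Sum>\<^sub>\<infinity>t\<in>tidx B L M. Dpoly B e k p (n, t) * c (n, t) $ m) = 0" for m
    by (rule infsum_0) (use assms in force)
  thus ?thesis by (simp add: Dcoeff_def vec_eq_iff)
qed

lemma detL_continuous:
  assumes "\<And>i j. i < d \<Longrightarrow> j < d \<Longrightarrow> continuous_on U (A i j)"
  shows "continuous_on U (\<lambda>\<tau>. detL d (\<lambda>i j. A i j \<tau>))"
  unfolding detL_def
proof (intro continuous_intros)
  fix \<sigma> i assume "\<sigma> \<in> {\<sigma>. \<sigma> permutes {..<d}}" "i \<in> {..<d}"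
  thus "continuous_on U (A i (\<sigma> i))" using assms permutes_in_image by fastforce
qed

lemma Hset_connected: "connected Hset"
  unfolding Hset_def by (intro convex_connected convex_halfspace_Im_gt)

text \<open>Stated for any function with an expansion and the two lattice invariances, so that it
  applies directly to a difference of Jacobi forms.\<close>

lemma jacobi_form_eq_0:
  fixes B :: "real^'n \<Rightarrow> real^'n \<Rightarrow> real" and f :: "complex \<Rightarrow> complex^'n \<Rightarrow> complex^'m"
  assumes B: "pos_def_sym_bilinear B" and L: "integral_lattice B L" and e: "is_real_basis e" and M: "M > 0"
    and k: "\<not> (k \<in> \<int> \<and> k \<le> 0)"
    and s: "jseries B (jidx B L M) c f"
    and per: "\<And>\<tau> z w. \<tau> \<in> Hset \<Longrightarrow> w \<in> L \<Longrightarrow> f \<tau> (z + cvec w) = f \<tau> z"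
    and qper: "\<And>\<tau> z v. \<tau> \<in> Hset \<Longrightarrow> v \<in> L \<Longrightarrow> ee (\<tau> * of_real (Qr B v) + Bc B (cvec v) z) *s f \<tau> (z + \<tau> *s cvec v) = f \<tau> z"
    and t: "\<forall>j<d. t j \<in> dual_lattice B L"
    and t_bij: "bij_betw (\<lambda>j. (\<lambda>l. t j + l) ` L) {..<d} (lat_cosets B L)"
    and F: "\<exists>\<tau>\<in>Hset. Fdet B L e d p t \<tau> \<noteq> 0"
    and D: "\<And>q \<tau>. q \<in> Phat (p ` {..<d}) \<Longrightarrow> \<tau> \<in> Hset \<Longrightarrow> Dop B e k f q \<tau> = 0"
    and \<tau>: "\<tau> \<in> Hset"
  shows "f \<tau> z = 0"
proof -
  have bil: "bilinear B" using B by (simp add: pos_def_sym_bilinear_def)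
  have lat: "is_lattice L" using L by (simp add: integral_lattice_def)
  \<comment> \<open>The scalar by which a row of normalised derivatives differs from the row of
    Taylor coefficients; a row factor does not disturb the kernel relation.\<close>
  define C where "C q = (1 / (2 * of_real pi * \<i>) ^ msum q) * (\<Prod>l\<in>UNIV. fact (q l))" for q :: "'n \<Rightarrow> nat"
  have Fdet: "Fdet B L e d p t \<tau> = detL d (\<lambda>i j. C (p i) * theta_coeff B L e (t j) (p i) \<tau>)" if "\<tau> \<in> Hset" for \<tau>
    unfolding Fdet_def theta_coeff_has_sum(2) [OF B lat that] C_def by (simp add: mult.assoc)
  have pP: "p i \<in> Phat (p ` {..<d})" if "i < d" for i
    using that by (auto simp: Phat_def mle_def)
  have van: "f \<tau> z $ m = 0" if \<tau>: "\<tau> \<in> Hset" and nz: "Fdet B L e d p t \<tau> \<noteq> 0" for \<tau> z m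
  proof -
    obtain F where F: "\<And>q. taylor_coeffs e f \<tau> q $ m = (\<Sum>j<d. F j * theta_coeff B L e (t j) q \<tau>)"
       "(\<forall>j<d. F j = 0) \<longrightarrow> (\<forall>z. f \<tau> z $ m = 0)"
      using theta_decomposition [OF B L e M s \<tau> per [OF \<tau>] qper [OF \<tau>] t t_bij, of m] by blast
    have "F j = 0" if "j < d" for j
    proof (rule detL_kernel [OF _ _ that])
      fix i assume "i < d"
      hence "taylor_coeffs e f \<tau> (p i) $ m = 0"
        using taylor_coeffs_vanish_Phat [OF bil k D pP \<tau>] by blast
      hence "C (p i) * (\<Sum>j<d. F j * theta_coeff B L e (t j) (p i) \<tau>) = 0" by (simp add: F)
      thus "(\<Sum>j<d. C (p i) * theta_coeff B L e (t j) (p i) \<tau> * F j) = 0"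
        by (simp only: sum_distrib_left mult_ac)
    qed (use nz Fdet [OF \<tau>] in simp)
    thus ?thesis using F(2) by blast
  qed
  obtain \<tau>0 where \<tau>0: "\<tau>0 \<in> Hset" "Fdet B L e d p t \<tau>0 \<noteq> 0" using F by blast
  have "continuous_on Hset (\<lambda>\<tau>. detL d (\<lambda>i j. C (p i) * theta_coeff B L e (t j) (p i) \<tau>))"
    by (intro detL_continuous continuous_on_mult continuous_on_const
        holomorphic_on_imp_continuous_on theta_coeff_holomorphic [OF B lat])
  hence cont: "continuous_on Hset (Fdet B L e d p t)"
    by (rule continuous_on_eq) (simp add: Fdet)
  \<comment> \<open>Continuity of the determinant makes its nonvanishing locus open; the identity
    theorem is then applied to f in \<tau> with z fixed.\<close>
  define U where "U = Hset \<inter> Fdet B L e d p t -` (- {0})"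
  have U: "open U" unfolding U_def by (rule continuous_open_preimage [OF cont open_Hset]) auto
  have "f \<tau> z $ m = 0" for m
  proof (rule analytic_continuation_open [of U Hset "\<lambda>\<tau>. f \<tau> z $ m" "\<lambda>_. 0" \<tau>])
    show "U \<noteq> {}" using \<tau>0 by (auto simp: U_def)
    show "f \<tau> z $ m = 0" if "\<tau> \<in> U" for \<tau> using that van by (auto simp: U_def)
    show "(\<lambda>\<tau>. f \<tau> z $ m) holomorphic_on Hset"
    proof (rule exp_series_holomorphic [OF open_Hset])
      fix \<tau> assume "\<tau> \<in> Hset"
      hence "(jterm B c \<tau> z has_sum f \<tau> z) (jidx B L M)" using s by (auto simp: jseries_def)
      thus "((\<lambda>nt. (c nt $ m * ee (Bc B (cvec (snd nt)) z)) * ee (of_real (fst nt) * \<tau>)) has_sum f \<tau> z $ m) (jidx B L M)"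
        unfolding has_sum_vec_nth by (simp add: jterm_def mult_ac)
    qed
  qed (use U open_Hset Hset_connected \<tau> in \<open>auto simp: U_def\<close>)
  thus ?thesis by (simp add: vec_eq_iff)
qed

lemma jacobi_base_periodic:
  fixes \<rho> :: "'n::finite jg \<Rightarrow> complex^'m^'m"
  assumes base: "jacobi_base B L G \<rho> k f" and B: "bilinear B" and G: "sl2_one \<in> G" and L: "0 \<in> L"
    and rho_L: "\<forall>v\<in>L. \<rho> ((sl2_one, 1), (v, 0, 1)) = mat 1 \<and> \<rho> ((sl2_one, 1), (0, v, 1)) = mat 1"
    and \<tau>: "\<tau> \<in> Hset" and v: "v \<in> L"
  shows "f \<tau> (z + cvec v) = f \<tau> z"
    and "ee (\<tau> * of_real (Qr B v) + Bc B (cvec v) z) *s f \<tau> (z + \<tau> *s cvec v) = f \<tau> z"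
proof -
  have z0: "Bc B 0 z = 0" by (simp add: Bc_def)
  have "((sl2_one, 1), (0, v, 1)) \<in> JG G L" "((sl2_one, 1), (v, 0, 1)) \<in> JG G L"
    using G L v by (auto simp: JG_def Mp_pre_def)
  hence "jslash B k ((sl2_one, 1), (0, v, 1)) f \<tau> z = f \<tau> z" "jslash B k ((sl2_one, 1), (v, 0, 1)) f \<tau> z = f \<tau> z"
    using base rho_L v \<tau> by (auto simp: jacobi_base_def simp del: jslash.simps)
  thus "f \<tau> (z + cvec v) = f \<tau> z"
    "ee (\<tau> * of_real (Qr B v) + Bc B (cvec v) z) *s f \<tau> (z + \<tau> *s cvec v) = f \<tau> z"
    unfolding jslash_one by (simp_all add: z0 Qr_def bilinear_lzero [OF B] bilinear_rzero [OF B])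
qed

theorem theorem6p2:
  fixes B :: "real^'n \<Rightarrow> real^'n \<Rightarrow> real"
    and L :: "(real^'n) set"
    and G :: "sl2 set"
    and \<rho> :: "'n jg \<Rightarrow> complex^'m^'m"
    and k :: real
    and e :: "'n \<Rightarrow> real^'n"
    and d :: nat
    and p :: "nat \<Rightarrow> ('n \<Rightarrow> nat)"
    and t :: "nat \<Rightarrow> real^'n"
  assumes B: "pos_def_sym_bilinear B"
    and L: "integral_lattice B L"
    and G: "finite_index_subgroup G"
    and rep: "jg_rep B G L \<rho>"
    and ker: "rep_kernel_finite_index B G L \<rho>"
    and rho_xi: "\<rho> ((sl2_one, 1), (0, 0, -1)) = - mat 1"
    and rho_L: "\<forall>v\<in>L. \<rho> ((sl2_one, 1), (v, 0, 1)) = mat 1 \<and> \<rho> ((sl2_one, 1), (0, v, 1)) = mat 1"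
    and k_half: "2 * k \<in> \<int>"
    and k_notnp: "\<not> (k \<in> \<int> \<and> k \<le> 0)"
    and e: "is_real_basis e"
    and d: "d = card (lat_cosets B L)"
    and p: "inj_on p {..<d}"
    and t: "\<forall>j<d. t j \<in> dual_lattice B L"
    and t_bij: "bij_betw (\<lambda>j. (\<lambda>l. t j + l) ` L) {..<d} (lat_cosets B L)"
    and F: "\<exists>\<tau>\<in>Hset. Fdet B L e d p t \<tau> \<noteq> 0"
  shows "(\<forall>\<phi>\<in>Jwh B L G \<rho> k. \<forall>q\<in>Phat (p ` {..<d}).
            Dop B e k \<phi> q \<in> Mwh (k + real (msum q)) G (rho_res \<rho>))
       \<and> (\<forall>\<phi>\<in>Jwh B L G \<rho> k. \<forall>\<psi>\<in>Jwh B L G \<rho> k. \<forall>a b. \<forall>q\<in>Phat (p ` {..<d}). \<forall>\<tau>\<in>Hset.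
            Dop B e k (\<lambda>\<tau> z. a *s \<phi> \<tau> z + b *s \<psi> \<tau> z) q \<tau>
              = a *s Dop B e k \<phi> q \<tau> + b *s Dop B e k \<psi> q \<tau>)
       \<and> (\<forall>\<phi>\<in>Jwh B L G \<rho> k. \<forall>\<psi>\<in>Jwh B L G \<rho> k.
            (\<forall>q\<in>Phat (p ` {..<d}). \<forall>\<tau>\<in>Hset. Dop B e k \<phi> q \<tau> = Dop B e k \<psi> q \<tau>)
            \<longrightarrow> (\<forall>\<tau>\<in>Hset. \<forall>z. \<phi> \<tau> z = \<psi> \<tau> z))
       \<and> (\<forall>\<phi>\<in>Jweak B L G \<rho> k. \<forall>q\<in>Phat (p ` {..<d}).
            Dop B e k \<phi> q \<in> Mhol (k + real (msum q)) G (rho_res \<rho>))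
       \<and> ((\<lambda>_. 0) \<in> Phat (p ` {..<d}) \<longrightarrow>
            (\<forall>\<phi>\<in>Jhol B L G \<rho> k.
               Dop B e k \<phi> (\<lambda>_. 0) \<in> Mhol k G (rho_res \<rho>) \<and>
               (\<forall>q\<in>Phat (p ` {..<d}). q \<noteq> (\<lambda>_. 0) \<longrightarrow>
                  Dop B e k \<phi> q \<in> Scusp (k + real (msum q)) G (rho_res \<rho>))))"
proof -
  have bil: "bilinear B" using B by (simp add: pos_def_sym_bilinear_def)
  have lat: "is_lattice L" using L by (simp add: integral_lattice_def)
  have L0: "0 \<in> L" by (rule lattice_props(1) [OF lat])
  have GS: "G \<subseteq> SL2Z" and G1: "sl2_one \<in> G" using G by (auto simp: finite_index_subgroup_def)
  note [simp del] = jslash.simps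
  \<comment> \<open>\<open>P\<close> stands for the condition on the coefficients at a cusp; keeping
    it attached to the same \<open>M\<close> and \<open>c\<close> lets one argument serve the weakly
    holomorphic, weak and holomorphic cases.\<close>
  have modular: "mform_base (k + real (msum q)) G (rho_res \<rho>) (Dop B e k \<phi> q) \<and>
      (\<forall>g\<in>Mp_pre SL2Z. \<exists>M c. qexpansion (k + real (msum q)) (Dop B e k \<phi> q) g M (Dcoeff B L e k q M c) \<and> P M c)"
    if base: "jacobi_base B L G \<rho> k \<phi>" and ex: "\<And>g. g \<in> JG SL2Z L \<Longrightarrow> \<exists>M c. jexpansion B L k \<phi> g M c \<and> P M c"
    for \<phi> q P
  proof -
    obtain M0 c0 where s: "jseries B (jidx B L M0) c0 \<phi>"
      using jseries_of_expansion [OF bil L0 ex] by blast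
    have "\<exists>M c. qexpansion (k + real (msum q)) (Dop B e k \<phi> q) g M (Dcoeff B L e k q M c) \<and> P M c" if g: "g \<in> Mp_pre SL2Z" for g
    proof -
      have "(g, (0, 0, 1)) \<in> JG SL2Z L" using g L0 by (auto simp: JG_def)
      then obtain M c where "jexpansion B L k \<phi> (g, (0, 0, 1)) M c" "P M c" using ex by blast
      thus ?thesis using qexpansion_Dop [OF bil g k_half s] by blast
    qed
    moreover have "mform_base (k + real (msum q)) G (rho_res \<rho>) (Dop B e k \<phi> q)"
      by (rule mform_base_Dop [OF bil GS L0 k_half base s]) (use ex in blast)
    ultimately show ?thesis by blast
  qed
  have series: "\<exists>M c. M > 0 \<and> jseries B (jidx B L M) c \<phi>" if "\<phi> \<in> Jwh B L G \<rho> k" for \<phi>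
  proof -
    have "\<exists>M c. jexpansion B L k \<phi> g M c \<and> True" if "g \<in> JG SL2Z L" for g
      using \<open>\<phi> \<in> Jwh B L G \<rho> k\<close> that unfolding Jwh_def by blast
    from jseries_of_expansion [OF bil L0 this] show ?thesis by blast
  qed
  have wh: "Dop B e k \<phi> q \<in> Mwh (k + real (msum q)) G (rho_res \<rho>)" if \<phi>: "\<phi> \<in> Jwh B L G \<rho> k" for \<phi> q
  proof -
    have z: "\<exists>N0. \<forall>n\<in>qidx M. n < N0 \<longrightarrow> Dcoeff B L e k q M c n = 0"
      if c: "\<exists>N0. \<forall>nt\<in>jidx B L M. fst nt < N0 \<longrightarrow> c nt = 0" for M and c :: "real \<times> (real^'n) \<Rightarrow> complex^'m"
    proof -
      obtain N0 where "\<And>n u. n \<in> qidx M \<Longrightarrow> u \<in> tidx B L M \<Longrightarrow> n < N0 \<Longrightarrow> c (n, u) = 0"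
        using c unfolding jidx_eq by force
      thus ?thesis by (intro exI [of _ N0] ballI impI Dcoeff_eq_0 disjI2) blast
    qed
    have "jacobi_base B L G \<rho> k \<phi>"
      and "\<And>g. g \<in> JG SL2Z L \<Longrightarrow> \<exists>M c. jexpansion B L k \<phi> g M c \<and> (\<lambda>M c. \<exists>N0. \<forall>nt\<in>jidx B L M. fst nt < N0 \<longrightarrow> c nt = 0) M c"
      using \<phi> unfolding Jwh_def by blast+
    note m = modular [OF this, of q]
    show ?thesis
      unfolding Mwh_def
    proof (intro CollectI conjI ballI)
      fix g assume "g \<in> Mp_pre SL2Z"
      with m show "\<exists>M c. qexpansion (k + real (msum q)) (Dop B e k \<phi> q) g M c \<and> (\<exists>N0. \<forall>n\<in>qidx M. n < N0 \<longrightarrow> c n = 0)"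
        using z by meson
    qed (use m in blast)
  qed
  have weak: "Dop B e k \<phi> q \<in> Mhol (k + real (msum q)) G (rho_res \<rho>)" if \<phi>: "\<phi> \<in> Jweak B L G \<rho> k" for \<phi> q
  proof -
    have z: "\<forall>n\<in>qidx M. n < 0 \<longrightarrow> Dcoeff B L e k q M c n = 0"
      if "\<forall>nt\<in>jidx B L M. fst nt < 0 \<longrightarrow> c nt = 0" for M and c :: "real \<times> (real^'n) \<Rightarrow> complex^'m"
    proof -
      have "\<And>n u. n \<in> qidx M \<Longrightarrow> u \<in> tidx B L M \<Longrightarrow> n < 0 \<Longrightarrow> c (n, u) = 0"
        using that unfolding jidx_eq by force
      thus ?thesis by (intro ballI impI Dcoeff_eq_0 disjI2) blast
    qed
    have "jacobi_base B L G \<rho> k \<phi>"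
      and "\<And>g. g \<in> JG SL2Z L \<Longrightarrow> \<exists>M c. jexpansion B L k \<phi> g M c \<and> (\<lambda>M c. \<forall>nt\<in>jidx B L M. fst nt < 0 \<longrightarrow> c nt = 0) M c"
      using \<phi> unfolding Jweak_def by blast+
    note m = modular [OF this, of q]
    show ?thesis
      unfolding Mhol_def
    proof (intro CollectI conjI ballI)
      fix g assume "g \<in> Mp_pre SL2Z"
      with m show "\<exists>M c. qexpansion (k + real (msum q)) (Dop B e k \<phi> q) g M c \<and> (\<forall>n\<in>qidx M. n < 0 \<longrightarrow> c n = 0)"
        using z by meson
    qed (use m in blast)
  qed
  have Q0: "Qr B v \<ge> 0" "Qr B v = 0 \<Longrightarrow> v = 0" for v
  proof -
    have pos: "v \<noteq> 0 \<Longrightarrow> B v v > 0" using B by (simp add: pos_def_sym_bilinear_def)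
    thus "Qr B v \<ge> 0" using bilinear_lzero [OF bil, of 0] by (cases "v = 0") (auto simp: Qr_def)
    show "v = 0" if "Qr B v = 0" using pos that by (cases "v = 0") (auto simp: Qr_def)
  qed
  \<comment> \<open>Positivity of Q turns n \<ge> Q(t) into n \<ge> 0, so a holomorphic Jacobi form
    is weak.\<close>
  have hol: "Dop B e k \<phi> q \<in> Mhol (k + real (msum q)) G (rho_res \<rho>)" if \<phi>: "\<phi> \<in> Jhol B L G \<rho> k" for \<phi> q
  proof (rule weak)
    have neg: "\<forall>nt\<in>jidx B L M. fst nt < 0 \<longrightarrow> c nt = 0"
      if c: "\<forall>nt\<in>jidx B L M. \<not> (fst nt \<ge> Qr B (snd nt)) \<longrightarrow> c nt = 0" for M and c :: "real \<times> (real^'n) \<Rightarrow> complex^'m"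
    proof (intro ballI impI)
      fix nt assume nt: "nt \<in> jidx B L M" "fst nt < 0"
      hence "\<not> (fst nt \<ge> Qr B (snd nt))" using Q0(1) [of "snd nt"] by linarith
      thus "c nt = 0" using c nt by blast
    qed
    show "\<phi> \<in> Jweak B L G \<rho> k"
      unfolding Jweak_def
    proof (intro CollectI conjI ballI)
      fix g assume "g \<in> JG SL2Z L"
      then obtain M c where "jexpansion B L k \<phi> g M c" "\<forall>nt\<in>jidx B L M. \<not> (fst nt \<ge> Qr B (snd nt)) \<longrightarrow> c nt = 0"
        using \<phi> unfolding Jhol_def by blast
      thus "\<exists>M c. jexpansion B L k \<phi> g M c \<and> (\<forall>nt\<in>jidx B L M. fst nt < 0 \<longrightarrow> c nt = 0)"
        using neg by blast
    qed (use \<phi> in \<open>simp add: Jhol_def\<close>)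
  qed
  \<comment> \<open>For n \<le> 0 the condition n \<ge> Q(u) forces n = 0 and u = 0, and there
    \<open>Dpoly\<close> vanishes because q \<noteq> 0.\<close>
  have cusp: "Dop B e k \<phi> q \<in> Scusp (k + real (msum q)) G (rho_res \<rho>)"
    if \<phi>: "\<phi> \<in> Jhol B L G \<rho> k" and q: "q \<noteq> (\<lambda>_. 0)" for \<phi> q
  proof -
    have z: "\<forall>n\<in>qidx M. n \<le> 0 \<longrightarrow> Dcoeff B L e k q M c n = 0"
      if c: "\<forall>nt\<in>jidx B L M. \<not> (fst nt \<ge> Qr B (snd nt)) \<longrightarrow> c nt = 0" for M and c :: "real \<times> (real^'n) \<Rightarrow> complex^'m"
    proof (intro ballI impI Dcoeff_eq_0)
      fix n u assume n: "n \<in> qidx M" "n \<le> 0" and u: "u \<in> tidx B L M"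
      show "Dpoly B e k q (n, u) = 0 \<or> c (n, u) = 0"
      proof (cases "n \<ge> Qr B u")
        case True
        hence "n = 0" "u = 0" using n Q0 [of u] by auto
        thus ?thesis using Dpoly_0 [OF bil q] by simp
      next
        case False
        thus ?thesis using c n u by (auto simp: jidx_eq)
      qed
    qed
    have "jacobi_base B L G \<rho> k \<phi>"
      and "\<And>g. g \<in> JG SL2Z L \<Longrightarrow> \<exists>M c. jexpansion B L k \<phi> g M c \<and> (\<lambda>M c. \<forall>nt\<in>jidx B L M. \<not> (fst nt \<ge> Qr B (snd nt)) \<longrightarrow> c nt = 0) M c"
      using \<phi> unfolding Jhol_def by blast+
    note m = modular [OF this, of q]
    show ?thesis
      unfolding Scusp_def
    proof (intro CollectI conjI ballI)
      fix g assume "g \<in> Mp_pre SL2Z"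
      with m show "\<exists>M c. qexpansion (k + real (msum q)) (Dop B e k \<phi> q) g M c \<and> (\<forall>n\<in>qidx M. n \<le> 0 \<longrightarrow> c n = 0)"
        using z by meson
    qed (use m in blast)
  qed
  have lin: "Dop B e k (\<lambda>\<tau> z. a *s \<phi> \<tau> z + b *s \<psi> \<tau> z) q \<tau> = a *s Dop B e k \<phi> q \<tau> + b *s Dop B e k \<psi> q \<tau>"
    if "\<phi> \<in> Jwh B L G \<rho> k" "\<psi> \<in> Jwh B L G \<rho> k" "\<tau> \<in> Hset" for \<phi> \<psi> a b q \<tau>
    using series [OF that(1)] series [OF that(2)] Dop_linear [OF bil _ _ that(3)] by blast
  have inj: "\<phi> \<tau> z = \<psi> \<tau> z"
    if \<phi>: "\<phi> \<in> Jwh B L G \<rho> k" and \<psi>: "\<psi> \<in> Jwh B L G \<rho> k" and \<tau>: "\<tau> \<in> Hset"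
      and D: "\<forall>q\<in>Phat (p ` {..<d}). \<forall>\<tau>\<in>Hset. Dop B e k \<phi> q \<tau> = Dop B e k \<psi> q \<tau>" for \<phi> \<psi> \<tau> z
  proof -
    obtain M c where M: "M > 0" and s1: "jseries B (jidx B L M) c \<phi>" using series [OF \<phi>] by blast
    obtain N c' where N: "N > 0" and s2: "jseries B (jidx B L N) c' \<psi>" using series [OF \<psi>] by blast
    \<comment> \<open>The two forms may come with different denominators, and the series of their
      difference needs one index set.\<close>
    have "jidx B L M \<subseteq> jidx B L (M * N)" "jidx B L N \<subseteq> jidx B L (M * N)"
      using jidx_mono [OF bil M N] jidx_mono [OF bil N M] by (auto simp: mult.commute)
    note s = jseries_add [OF jseries_extend [OF s1 this(1)] jseries_extend [OF s2 this(2)], of 1 "-1"]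
    \<comment> \<open>Written as a linear combination so that \<open>lin\<close> applies to it as it
      stands.\<close>
    define \<delta> where "\<delta> = (\<lambda>\<tau> z. 1 *s \<phi> \<tau> z + (-1) *s \<psi> \<tau> z)"
    have base: "jacobi_base B L G \<rho> k \<phi>" "jacobi_base B L G \<rho> k \<psi>" using \<phi> \<psi> by (auto simp: Jwh_def)
    note per = jacobi_base_periodic [OF _ bil G1 L0 rho_L]
    have "\<delta> \<tau> z = 0"
    proof (rule jacobi_form_eq_0 [OF B L e _ k_notnp s [folded \<delta>_def] _ _ t t_bij F _ \<tau>])
      show "M * N > 0" using M N by simp
      show "\<delta> \<tau> (z + cvec w) = \<delta> \<tau> z" if "\<tau> \<in> Hset" "w \<in> L" for \<tau> z w
        using per(1) [OF base(1) that] per(1) [OF base(2) that] by (simp add: \<delta>_def)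
      show "ee (\<tau> * of_real (Qr B v) + Bc B (cvec v) z) *s \<delta> \<tau> (z + \<tau> *s cvec v) = \<delta> \<tau> z" if "\<tau> \<in> Hset" "v \<in> L" for \<tau> z v
        using arg_cong2 [OF per(2) [OF base(1) that, of z] per(2) [OF base(2) that, of z], of "\<lambda>x y. 1 *s x + (-1) *s y"]
        by (simp add: \<delta>_def vec_eq_iff algebra_simps)
      show "Dop B e k \<delta> q \<tau> = 0" if "q \<in> Phat (p ` {..<d})" "\<tau> \<in> Hset" for q \<tau>
        unfolding \<delta>_def lin [OF \<phi> \<psi> that(2)] using D that by (simp add: vec_eq_iff)
    qed
    thus ?thesis by (simp add: \<delta>_def vec_eq_iff)
  qed
  have hol0: "Dop B e k \<phi> (\<lambda>_. 0) \<in> Mhol k G (rho_res \<rho>)" if "\<phi> \<in> Jhol B L G \<rho> k" for \<phi>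
    using hol [OF that, of "\<lambda>_. 0"] by (simp add: msum_def)
  show ?thesis
    by (intro conjI ballI allI impI) (rule wh lin inj weak hol0 cusp; assumption)+
qed

end
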